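(* For every $s$ with $-\frac74<s<\frac52$ there exists $b=b(s)<\frac12$ such that for all $\alpha>\frac12$ we have $$\|\partial_x(uv)\|_{Y^{s,-b}}\le c\,\|u\|_{X^{s,b}\cap D^\alpha}\,\|v\|_{X^{s,b}\cap D^\alpha},$$ where the constant $c$ is independent of $u$ and $v$.
   Context: Let $\langle\cdot\rangle=(1+|\cdot|^2)^{1/2}$ and, for functions $f(t,x)$ on $\mathbb{R}^2$, let $\widetilde f(\tau,\xi)=\int_{\mathbb{R}^2}e^{-ix\xi}e^{-it\tau}f(t,x)\,dx\,dt$. For $s,b,\alpha\in\mathbb{R}$, $X^{s,b}$, $Y^{s,b}$ and $D^\alpha$ are the completions of the Schwartz space $\mathcal S(\mathbb{R}^2)$ under $$\|f\|_{X^{s,b}}^2=\int_{\mathbb{R}^2}\langle\xi\rangle^{2s}\langle\tau-\xi^5\rangle^{2b}|\widetilde f(\tau,\xi)|^2\,d\xi\,d\tau,$$ $$\|f\|_{Y^{s,b}}^2=\int_{\mathbb{R}^2}\langle\tau\rangle^{\frac{2s}{5}}\langle\tau-\xi^5\rangle^{2b}|\widetilde f(\tau,\xi)|^2\,d\xi\,d\tau,$$ $$\|f\|_{D^\alpha}^2=\int_{\mathbb{R}^2}\langle\tau\rangle^{2\alpha}\mathbf 1_{\{|\xi|\le1\}}(\xi)|\widetilde f(\tau,\xi)|^2\,d\xi\,d\tau,$$ and $\|f\|_{X^{s,b}\cap D^\alpha}=\|f\|_{X^{s,b}}+\|f\|_{D^\alpha}$. *)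

theory Defs
  imports "HOL-Analysis.Analysis"
begin

text \<open>Functions on the plane are written in the variables \<open>(t, x)\<close>, their Fourier transforms in
  the variables \<open>(\<tau>, \<xi>)\<close>.\<close>

type_synonym plane_fun = "real \<times> real \<Rightarrow> complex"

definition dt :: "plane_fun \<Rightarrow> plane_fun" where
  "dt f = (\<lambda>(t, x). vector_derivative (\<lambda>r. f (r, x)) (at t))"

definition dx :: "plane_fun \<Rightarrow> plane_fun" where
  "dx f = (\<lambda>(t, x). vector_derivative (\<lambda>y. f (t, y)) (at x))"

text \<open>Total differentiability of all the functions \<open>\<partial>\<^sub>t\<^sup>i \<partial>\<^sub>x\<^sup>j f\<close> makes them continuous, and hence makes
  mixed partial derivatives commute; so \<open>f\<close> is smooth and no other order of differentiation has
  to be considered.\<close>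

definition schwartz :: "plane_fun set" where
  "schwartz = {f. \<forall>i j. (\<forall>z. (dt ^^ i) ((dx ^^ j) f) differentiable (at z)) \<and>
     (\<forall>k::nat. bounded (range (\<lambda>z. (1 + norm z) ^ k *\<^sub>R (dt ^^ i) ((dx ^^ j) f) z)))}"

definition fourier :: "plane_fun \<Rightarrow> plane_fun" where
  "fourier f = (\<lambda>(\<tau>, \<xi>). \<integral>(t, x). exp (- (\<i> * complex_of_real (x * \<xi>))) *
     exp (- (\<i> * complex_of_real (t * \<tau>))) * f (t, x) \<partial>lborel)"

definition jb :: "real \<Rightarrow> real" where
  "jb r = sqrt (1 + \<bar>r\<bar>\<^sup>2)"

text \<open>The following integrals converge, and thus have their intended value, for \<open>f \<in> schwartz\<close>;
  the norms are only applied to such \<open>f\<close>.\<close>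

definition X_norm :: "real \<Rightarrow> real \<Rightarrow> plane_fun \<Rightarrow> real" where
  "X_norm s b f = sqrt (\<integral>(\<tau>, \<xi>). jb \<xi> powr (2 * s) * jb (\<tau> - \<xi> ^ 5) powr (2 * b) *
     (cmod (fourier f (\<tau>, \<xi>)))\<^sup>2 \<partial>lborel)"

definition Y_norm :: "real \<Rightarrow> real \<Rightarrow> plane_fun \<Rightarrow> real" where
  "Y_norm s b f = sqrt (\<integral>(\<tau>, \<xi>). jb \<tau> powr (2 * s / 5) * jb (\<tau> - \<xi> ^ 5) powr (2 * b) *
     (cmod (fourier f (\<tau>, \<xi>)))\<^sup>2 \<partial>lborel)"

definition D_norm :: "real \<Rightarrow> plane_fun \<Rightarrow> real" where
  "D_norm \<alpha> f = sqrt (\<integral>(\<tau>, \<xi>). jb \<tau> powr (2 * \<alpha>) * indicator {\<xi>. \<bar>\<xi>\<bar> \<le> 1} \<xi> *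
     (cmod (fourier f (\<tau>, \<xi>)))\<^sup>2 \<partial>lborel)"

definition XD_norm :: "real \<Rightarrow> real \<Rightarrow> real \<Rightarrow> plane_fun \<Rightarrow> real" where
  "XD_norm s b \<alpha> f = X_norm s b f + D_norm \<alpha> f"

text \<open>The completion of the Schwartz space under a (semi)norm \<open>N\<close>: Cauchy sequences of Schwartz
  functions modulo null sequences. A Schwartz function is identified with the class of the
  corresponding constant sequence.\<close>

definition cauchy_seqs :: "(plane_fun \<Rightarrow> real) \<Rightarrow> (nat \<Rightarrow> plane_fun) set" where
  "cauchy_seqs N = {w. (\<forall>n. w n \<in> schwartz) \<and>
     (\<forall>\<epsilon>>0. \<exists>M. \<forall>m\<ge>M. \<forall>n\<ge>M. N (\<lambda>z. w m z - w n z) < \<epsilon>)}"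

definition null_rel :: "(plane_fun \<Rightarrow> real) \<Rightarrow> ((nat \<Rightarrow> plane_fun) \<times> (nat \<Rightarrow> plane_fun)) set" where
  "null_rel N = {(w, w'). w \<in> cauchy_seqs N \<and> w' \<in> cauchy_seqs N \<and>
     (\<lambda>n. N (\<lambda>z. w n z - w' n z)) \<longlonglongrightarrow> 0}"

definition schwartz_completion :: "(plane_fun \<Rightarrow> real) \<Rightarrow> (nat \<Rightarrow> plane_fun) set set" where
  "schwartz_completion N = cauchy_seqs N // null_rel N"

text \<open>The limit is the same for every representative of \<open>U\<close>.\<close>

definition completion_norm :: "(plane_fun \<Rightarrow> real) \<Rightarrow> (nat \<Rightarrow> plane_fun) set \<Rightarrow> real" where
  "completion_norm N U = lim (\<lambda>n. N ((SOME w. w \<in> U) n))"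

text \<open>The expression \<open>\<partial>\<^sub>x(uv)\<close> for elements \<open>U\<close>, \<open>V\<close> of a completion, where the product need not
  make sense pointwise: the common limit, in the \<open>N\<close>-completion, of \<open>\<partial>\<^sub>x(u\<^sub>n v\<^sub>n)\<close> along all
  sequences representing \<open>U\<close> and \<open>V\<close>. If there is no such limit the set is empty, hence not an
  element of \<open>schwartz_completion N\<close>.\<close>

definition dx_mult :: "(plane_fun \<Rightarrow> real) \<Rightarrow> (nat \<Rightarrow> plane_fun) set \<Rightarrow> (nat \<Rightarrow> plane_fun) set \<Rightarrow>
    (nat \<Rightarrow> plane_fun) set" where
  "dx_mult N U V = {w \<in> cauchy_seqs N. \<forall>u\<in>U. \<forall>v\<in>V.
     (\<lambda>n. N (\<lambda>z. w n z - dx (\<lambda>y. u n y * v n y) z)) \<longlonglongrightarrow> 0}"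

end

theory Submission
  imports Defs "HOL-Probability.Probability" "HOL-Real_Asymp.Real_Asymp"
begin

text \<open>By duality the estimate is a bound \<open>\<integral>\<integral> m(a, c) f(a) g(c) h(a + c) \<le> C \<parallel>f\<parallel> \<parallel>g\<parallel> \<parallel>h\<parallel>\<close> in \<open>L\<^sup>2\<close> for an explicit
  multiplier \<open>m\<close>. It holds if \<open>m\<^sup>2\<close> has bounded integrals over the fibres on which one of \<open>a\<close>, \<open>c\<close>, \<open>a + c\<close> is
  fixed, and bounded multipliers are closed under geometric means. As \<open>m\<close> is log-linear in \<open>(s, b)\<close>,
  it suffices to treat \<open>s = - 7/4\<close> with \<open>b\<close> slightly above \<open>1/2\<close>, and \<open>s = 5 b\<close> with \<open>b\<close> slightly below \<open>1/2\<close>: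
  every \<open>s\<close> strictly between \<open>- 7/4\<close> and \<open>5/2\<close> lies between two such endpoints with an interpolated \<open>b < 1/2\<close>. At the endpoints the
  resonance identity makes one of the three modulations \<open>\<tau> - \<xi>\<^sup>5\<close> large; integrating the other two in time leaves the
  function \<open>\<eta>\<^sup>5 + (\<xi> - \<eta>)\<^sup>5\<close> of \<open>\<eta>\<close>, which is then taken as a new variable. The estimate passes from Schwartz
  functions to the completions by continuity.\<close>

section \<open>Integrals\<close>

text \<open>Taking the phase as a new variable requires two modulation factors whose squares have
  exponent above 1, for then their convolution decays like an integrable power of the distance of
  the centres. This forces \<open>b > 1/2\<close> at \<open>s = -7/4\<close>; the mean with an
  endpoint below 1/2 removes the excess. The upper endpoints lie on \<open>s = 5 b\<close> because
  the output weight is then the b-th power of \<open>jb \<tau>\<close>. The output modulation factor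
  absorbs it up to |\<xi>| to the power 5b, which the weight of the larger input pays for. There the
  frequency weights are square integrable and no change of variables is made. Low input frequencies
  are the obstacle: the resonance function vanishes with the smaller input frequency x2, so dividing
  by it leaves |x2| to the power -b, square integrable near 0 only for \<open>b < 1/2\<close>. If
  the low input itself has the large modulation, \<alpha> > 1/2 leaves enough decay after b of it
  has been spent; this is the role of \<open>D_norm\<close>. Since the multiplier is nonnegative,
  the transform of a product enters only through the bound by the convolution of absolute
  values.\<close>

lemma nn_integral_shift:
  fixes f :: "'a::euclidean_space \<Rightarrow> ennreal"
  assumes [measurable]: "f \<in> borel_measurable borel"
  shows "(\<integral>\<^sup>+x. f (c + x) \<partial>lborel) = (\<integral>\<^sup>+x. f x \<partial>lborel)"
proof -
  have "(\<integral>\<^sup>+x. f x \<partial>lborel) = (\<integral>\<^sup>+x. f x \<partial>distr lborel borel ((+) c))"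
    by (simp add: lborel_distr_plus)
  also have "\<dots> = (\<integral>\<^sup>+x. f (c + x) \<partial>lborel)"
    by (subst nn_integral_distr) auto
  finally show ?thesis by simp
qed

lemma nn_integral_reflect:
  fixes f :: "'a::euclidean_space \<Rightarrow> ennreal"
  assumes [measurable]: "f \<in> borel_measurable borel"
  shows "(\<integral>\<^sup>+x. f (- x) \<partial>lborel) = (\<integral>\<^sup>+x. f x \<partial>lborel)"
proof -
  have "lborel = density (distr lborel borel (\<lambda>x::'a. 0 + (-1) *\<^sub>R x)) (\<lambda>_. ennreal (\<bar>-1\<bar>^DIM('a)))"
    using lborel_affine[of "-1" "0::'a"] by simp
  then have "(lborel :: 'a measure) = distr lborel borel uminus"
    by (simp add: density_1)
  then have "(\<integral>\<^sup>+x. f x \<partial>lborel) = (\<integral>\<^sup>+x. f x \<partial>distr lborel borel uminus)"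
    by simp
  also have "\<dots> = (\<integral>\<^sup>+x. f (- x) \<partial>lborel)"
    by (subst nn_integral_distr) auto
  finally show ?thesis by simp
qed

lemma nn_integral_plane_tx:
  fixes f :: "real \<times> real \<Rightarrow> ennreal"
  assumes [measurable]: "f \<in> borel_measurable borel"
  shows "(\<integral>\<^sup>+z. f z \<partial>lborel) = (\<integral>\<^sup>+x. \<integral>\<^sup>+t. f (t, x) \<partial>lborel \<partial>lborel)"
proof -
  have "f \<in> borel_measurable (lborel \<Otimes>\<^sub>M lborel)"
    by (simp add: lborel_prod)
  from lborel_pair.nn_integral_snd[OF this] show ?thesis by (simp add: lborel_prod)
qed

lemma nn_integral_swap:
  fixes f :: "'a::euclidean_space \<Rightarrow> 'b::euclidean_space \<Rightarrow> ennreal"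
  assumes "case_prod f \<in> borel_measurable (borel \<Otimes>\<^sub>M borel)"
  shows "(\<integral>\<^sup>+x. \<integral>\<^sup>+y. f x y \<partial>lborel \<partial>lborel) = (\<integral>\<^sup>+y. \<integral>\<^sup>+x. f x y \<partial>lborel \<partial>lborel)"
proof -
  have "case_prod f \<in> borel_measurable (lborel \<Otimes>\<^sub>M lborel)"
    using assms by (simp cong: measurable_cong_sets add: sets_pair_measure_cong[OF sets_lborel sets_lborel])
  from lborel_pair.Fubini'[OF this] show ?thesis by simp
qed

text \<open>Allows multipliers to be compared at nonzero frequencies only. As
  \<open>0 powr (- b)\<close> is 0, a bound by a negative power of a frequency would fail on the
  null set where that frequency vanishes.\<close>

lemma AE_lborel_snd_nonzero: "AE z in lborel. snd (z :: real \<times> real) \<noteq> 0"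
proof -
  have "(\<integral>\<^sup>+z. indicator {z::real\<times>real. snd z = 0} z \<partial>lborel) = (\<integral>\<^sup>+x. \<integral>\<^sup>+t. indicator {z::real\<times>real. snd z = 0} (t, x) \<partial>lborel \<partial>(lborel::real measure))"
    by (intro nn_integral_plane_tx borel_measurable_indicator borel_closed closed_Collect_eq continuous_intros)
  also have "\<dots> = (\<integral>\<^sup>+x. (\<integral>\<^sup>+t. indicator {0} x \<partial>(lborel::real measure)) \<partial>(lborel::real measure))"
    by (intro nn_integral_cong) (auto split: split_indicator)
  also have "\<dots> = (\<integral>\<^sup>+x. \<infinity> * indicator {0} x \<partial>(lborel::real measure))"
    by (simp add: mult.commute)
  also have "\<dots> = 0"
    by (subst nn_integral_cmult_indicator) auto
  finally have "emeasure lborel {z::real\<times>real. snd z = 0} = 0"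
    by (subst (asm) nn_integral_indicator) (auto intro!: borel_closed closed_Collect_eq continuous_intros)
  then show ?thesis
    by (intro AE_I[where N="{z. snd z = 0}"]) (auto intro!: borel_closed closed_Collect_eq continuous_intros)
qed

section \<open>The bracket\<close>

lemma jb_ge_1: "1 \<le> jb r" by (simp add: jb_def)
lemma jb_pos [simp]: "0 < jb r" using jb_ge_1[of r] by linarith
lemma jb_neq_0 [simp]: "jb r \<noteq> 0" using jb_pos[of r] by linarith
lemma jb_nonneg [simp]: "0 \<le> jb r" using jb_ge_1[of r] by linarith
lemma abs_le_jb: "\<bar>r\<bar> \<le> jb r" unfolding jb_def by (rule real_le_rsqrt) auto
lemma jb_le: "jb r \<le> 1 + \<bar>r\<bar>"
  unfolding jb_def by (rule real_le_lsqrt) (auto simp: power2_eq_square algebra_simps)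
lemma jb_minus [simp]: "jb (- r) = jb r" by (simp add: jb_def)
lemma jb_minus_commute: "jb (a - b) = jb (b - a)"
  by (metis jb_minus minus_diff_eq)
text \<open>\<open>jb r\<close> is the Euclidean norm of the vector (1, r), hence 1-Lipschitz in
  \<open>r\<close>. After squaring, the claim is
  \<open>a * b \<le> jb a * \<bar>b\<bar>\<close>.\<close>

lemma jb_add_abs: "jb (a + b) \<le> jb a + \<bar>b\<bar>"
  unfolding jb_def
proof (rule real_le_lsqrt)
  have "\<bar>a\<bar> \<le> sqrt (1 + \<bar>a\<bar>\<^sup>2)" by (rule real_le_rsqrt) auto
  then have "\<bar>a\<bar> * \<bar>b\<bar> \<le> sqrt (1 + \<bar>a\<bar>\<^sup>2) * \<bar>b\<bar>" by (rule mult_right_mono) auto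
  moreover have "a * b \<le> \<bar>a\<bar> * \<bar>b\<bar>" by (metis abs_ge_self abs_mult)
  ultimately show "1 + \<bar>a + b\<bar>\<^sup>2 \<le> (sqrt (1 + \<bar>a\<bar>\<^sup>2) + \<bar>b\<bar>)\<^sup>2"
    by (simp add: power2_sum algebra_simps)
qed auto

lemma jb_triangle: "jb (a + b) \<le> jb a + jb b"
  using jb_add_abs[of a b] abs_le_jb[of b] by linarith
lemma jb_measurable [measurable]: "jb \<in> borel_measurable borel"
  unfolding jb_def by measurable
lemma jb_powr_neg_le_1: "0 \<le> p \<Longrightarrow> jb r powr (- p) \<le> 1"
  using powr_mono[of "-p" 0 "jb r"] jb_ge_1[of r] by simp

lemma powr_neg_antimono: "0 < x \<Longrightarrow> x \<le> y \<Longrightarrow> 0 \<le> p \<Longrightarrow> y powr (- p) \<le> x powr (- p)" for x y p :: real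
  by (rule powr_mono2') auto

lemma jb_powr_integral_finite:
  fixes r :: real
  assumes "1 < r"
  shows "\<exists>K\<ge>0. (\<integral>\<^sup>+x. ennreal (jb x powr (- r)) \<partial>lborel) \<le> ennreal K"
proof -
  have half: "(\<integral>\<^sup>+x. ennreal ((1 + x) powr (- r)) * indicator {0..} x \<partial>lborel) = ennreal (0 - (1 + 0) powr (1 - r) / (1 - r))"
  proof (rule nn_integral_FTC_atLeast)
    show "DERIV (\<lambda>x. (1 + x) powr (1 - r) / (1 - r)) x :> (1 + x) powr (- r)" if "0 \<le> x" for x
      using that assms by (auto intro!: derivative_eq_intros)
    show "((\<lambda>x. (1 + x) powr (1 - r) / (1 - r)) \<longlongrightarrow> 0) at_top"
    proof -
      have "((\<lambda>x. (1 + x) powr (1 - r)) \<longlongrightarrow> 0) at_top"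
        using assms by (intro tendsto_neg_powr filterlim_tendsto_add_at_top[OF tendsto_const] filterlim_ident) auto
      from tendsto_divide[OF this tendsto_const[of "1 - r"]] show ?thesis using assms by simp
    qed
  qed auto
  \<comment> \<open>\<open>jb x\<close> is at least 1 and at least |x|, hence at least their mean;
    the 2 of the mean becomes \<open>2 powr r\<close>.\<close>
  have le: "jb x powr (- r) \<le> 2 powr r * (1 + \<bar>x\<bar>) powr (- r)" for x
  proof -
    have "(1 + \<bar>x\<bar>) / 2 \<le> jb x" using add_mono[OF jb_ge_1[of x] abs_le_jb[of x]] by simp
    then have "jb x powr (- r) \<le> ((1 + \<bar>x\<bar>) / 2) powr (- r)"
      using assms by (intro powr_neg_antimono) auto
    also have "\<dots> = 2 powr r * (1 + \<bar>x\<bar>) powr (- r)"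
      by (simp add: powr_divide powr_minus field_simps)
    finally show ?thesis .
  qed
  let ?h = "\<lambda>x. ennreal ((1 + x) powr (- r)) * indicator {0..} x"
  have "(\<integral>\<^sup>+x. ennreal (jb x powr (- r)) \<partial>lborel) \<le> (\<integral>\<^sup>+x. ennreal (2 powr r) * (?h x + ?h (- x)) \<partial>lborel)"
  proof (intro nn_integral_mono)
    fix x :: real
    have "ennreal (jb x powr (- r)) \<le> ennreal (2 powr r * (1 + \<bar>x\<bar>) powr (- r))"
      using le by (rule ennreal_leI)
    also have "\<dots> = ennreal (2 powr r) * ennreal ((1 + \<bar>x\<bar>) powr (- r))"
      by (simp add: ennreal_mult)
    also have "\<dots> \<le> ennreal (2 powr r) * (?h x + ?h (- x))"
      by (rule mult_left_mono) (auto split: split_indicator)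
    finally show "ennreal (jb x powr (- r)) \<le> ennreal (2 powr r) * (?h x + ?h (- x))" .
  qed
  also have "\<dots> = ennreal (2 powr r) * ((\<integral>\<^sup>+x. ?h x \<partial>lborel) + (\<integral>\<^sup>+x. ?h (- x) \<partial>lborel))"
    by (subst nn_integral_cmult, simp, subst nn_integral_add) auto
  also have "(\<integral>\<^sup>+x. ?h (- x) \<partial>lborel) = (\<integral>\<^sup>+x. ?h x \<partial>lborel)"
    by (rule nn_integral_reflect[of ?h]) auto
  also have "ennreal (2 powr r) * ((\<integral>\<^sup>+x. ?h x \<partial>lborel) + (\<integral>\<^sup>+x. ?h x \<partial>lborel)) = ennreal (2 powr r * (2 * (1 / (r - 1))))"
    unfolding half using assms by (simp add: ennreal_mult[symmetric] ennreal_plus[symmetric] field_simps del: ennreal_plus)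
  finally show ?thesis using assms by (intro exI[of _ "2 powr r * (2 * (1 / (r - 1)))"]) auto
qed

lemma jb_powr_shift_integral:
  assumes "(\<integral>\<^sup>+x. ennreal (jb x powr (- r)) \<partial>lborel) \<le> ennreal K"
  shows "(\<integral>\<^sup>+x. ennreal (jb (x - c) powr (- r)) \<partial>lborel) \<le> ennreal K"
  using nn_integral_shift[of "\<lambda>x. ennreal (jb x powr (- r))" "- c"] assms
  by (simp add: add.commute)

text \<open>Replacing the larger bracket by the smaller one bounds the product by a single bracket
  to the power \<open>p + q\<close>, centred at \<open>a\<close> or at \<open>c\<close>. One of the
  exponents may be 0, which is used when a single modulation is left.\<close>

lemma two_brackets_integral:
  fixes p q :: real
  assumes "0 \<le> p" "0 \<le> q" "1 < p + q"
  shows "\<exists>K\<ge>0. \<forall>a c. (\<integral>\<^sup>+x. ennreal (jb (x - a) powr (- p) * jb (x - c) powr (- q)) \<partial>lborel) \<le> ennreal K"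
proof -
  obtain K where K: "K \<ge> 0" "(\<integral>\<^sup>+x. ennreal (jb x powr (- (p + q))) \<partial>lborel) \<le> ennreal K"
    using jb_powr_integral_finite[OF assms(3)] by auto
  have "(\<integral>\<^sup>+x. ennreal (jb (x - a) powr (- p) * jb (x - c) powr (- q)) \<partial>lborel) \<le> ennreal (K + K)" for a c
  proof -
    have "(\<integral>\<^sup>+x. ennreal (jb (x - a) powr (- p) * jb (x - c) powr (- q)) \<partial>lborel)
      \<le> (\<integral>\<^sup>+x. ennreal (jb (x - a) powr (- (p + q))) + ennreal (jb (x - c) powr (- (p + q))) \<partial>lborel)"
    proof (intro nn_integral_mono)
      fix x
      have "jb (x - a) powr (- p) * jb (x - c) powr (- q) \<le> jb (x - a) powr (- (p + q)) + jb (x - c) powr (- (p + q))"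
      proof (cases "jb (x - a) \<le> jb (x - c)")
        case True
        then have "jb (x - a) powr (- p) * jb (x - c) powr (- q) \<le> jb (x - a) powr (- p) * jb (x - a) powr (- q)"
          using assms by (intro mult_left_mono powr_neg_antimono) auto
        also have "\<dots> = jb (x - a) powr (- (p + q))" by (simp add: powr_add[symmetric])
        finally show ?thesis using powr_ge_zero[of "jb (x - c)" "- (p + q)"] by linarith
      next
        case False
        then have "jb (x - a) powr (- p) * jb (x - c) powr (- q) \<le> jb (x - c) powr (- p) * jb (x - c) powr (- q)"
          using assms by (intro mult_right_mono powr_neg_antimono) auto
        also have "\<dots> = jb (x - c) powr (- (p + q))" by (simp add: powr_add[symmetric])
        finally show ?thesis using powr_ge_zero[of "jb (x - a)" "- (p + q)"] by linarith
      qed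
      then show "ennreal (jb (x - a) powr (- p) * jb (x - c) powr (- q)) \<le> ennreal (jb (x - a) powr (- (p + q))) + ennreal (jb (x - c) powr (- (p + q)))"
        by (subst ennreal_plus[symmetric]) (auto intro: ennreal_leI simp del: ennreal_plus)
    qed
    also have "\<dots> = (\<integral>\<^sup>+x. ennreal (jb (x - a) powr (- (p + q))) \<partial>lborel) + (\<integral>\<^sup>+x. ennreal (jb (x - c) powr (- (p + q))) \<partial>lborel)"
      by (subst nn_integral_add) auto
    also have "\<dots> \<le> ennreal K + ennreal K"
      by (intro add_mono jb_powr_shift_integral K)
    finally show ?thesis using K by (simp add: ennreal_plus[symmetric] del: ennreal_plus)
  qed
  with K show ?thesis by (intro exI[of _ "K + K"]) auto
qed

text \<open>By the triangle inequality the larger of the two brackets is at least half of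
  \<open>jb (a - c)\<close>, so it can be taken out of the integral. The other one is integrable
  because the exponent exceeds 1, and the full power survives in \<open>a - c\<close>.\<close>

lemma two_brackets_convolution:
  fixes p :: real
  assumes "1 < p"
  shows "\<exists>K\<ge>0. \<forall>a c. (\<integral>\<^sup>+x. ennreal (jb (x - a) powr (- p) * jb (x - c) powr (- p)) \<partial>lborel) \<le> ennreal (K * jb (a - c) powr (- p))"
proof -
  obtain K where K: "K \<ge> 0" "(\<integral>\<^sup>+x. ennreal (jb x powr (- p)) \<partial>lborel) \<le> ennreal K"
    using jb_powr_integral_finite[OF assms(1)] by auto
  have "(\<integral>\<^sup>+x. ennreal (jb (x - a) powr (- p) * jb (x - c) powr (- p)) \<partial>lborel) \<le> ennreal (2 powr p * (K + K) * jb (a - c) powr (- p))" for a c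
  proof -
    let ?D = "2 powr p * jb (a - c) powr (- p)"
    have "(\<integral>\<^sup>+x. ennreal (jb (x - a) powr (- p) * jb (x - c) powr (- p)) \<partial>lborel)
      \<le> (\<integral>\<^sup>+x. ennreal ?D * (ennreal (jb (x - a) powr (- p)) + ennreal (jb (x - c) powr (- p))) \<partial>lborel)"
    proof (intro nn_integral_mono)
      fix x
      have half: "(jb (a - c) / 2) powr (- p) = ?D" by (simp add: powr_divide powr_minus field_simps)
      have tri: "jb (a - c) \<le> jb (x - a) + jb (x - c)"
        using jb_triangle[of "a - x" "x - c"] by (simp add: jb_minus_commute)
      have "jb (x - a) powr (- p) * jb (x - c) powr (- p) \<le> ?D * (jb (x - a) powr (- p) + jb (x - c) powr (- p))"
      proof (cases "jb (x - a) \<le> jb (x - c)")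
        case True
        then have "jb (a - c) / 2 \<le> jb (x - c)" using tri by linarith
        then have "jb (x - c) powr (- p) \<le> ?D" using assms unfolding half[symmetric] by (intro powr_neg_antimono) auto
        then have "jb (x - a) powr (- p) * jb (x - c) powr (- p) \<le> jb (x - a) powr (- p) * ?D" by (rule mult_left_mono) auto
        also have "\<dots> \<le> ?D * (jb (x - a) powr (- p) + jb (x - c) powr (- p))"
          by (simp add: distrib_left mult.commute)
        finally show ?thesis .
      next
        case False
        then have "jb (a - c) / 2 \<le> jb (x - a)" using tri by linarith
        then have "jb (x - a) powr (- p) \<le> ?D" using assms unfolding half[symmetric] by (intro powr_neg_antimono) auto
        then have "jb (x - a) powr (- p) * jb (x - c) powr (- p) \<le> ?D * jb (x - c) powr (- p)" by (rule mult_right_mono) auto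
        also have "\<dots> \<le> ?D * (jb (x - a) powr (- p) + jb (x - c) powr (- p))"
          by (simp add: distrib_left)
        finally show ?thesis .
      qed
      then show "ennreal (jb (x - a) powr (- p) * jb (x - c) powr (- p)) \<le> ennreal ?D * (ennreal (jb (x - a) powr (- p)) + ennreal (jb (x - c) powr (- p)))"
        by (subst ennreal_plus[symmetric], simp, simp, subst ennreal_mult[symmetric]) (auto intro: ennreal_leI simp del: ennreal_plus)
    qed
    also have "\<dots> = ennreal ?D * ((\<integral>\<^sup>+x. ennreal (jb (x - a) powr (- p)) \<partial>lborel) + (\<integral>\<^sup>+x. ennreal (jb (x - c) powr (- p)) \<partial>lborel))"
      by (subst nn_integral_cmult, simp, subst nn_integral_add) auto
    also have "\<dots> \<le> ennreal ?D * (ennreal K + ennreal K)"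
      by (intro mult_left_mono add_mono jb_powr_shift_integral K) auto
    also have "\<dots> = ennreal (2 powr p * (K + K) * jb (a - c) powr (- p))"
      using K by (simp add: ennreal_plus[symmetric] ennreal_mult[symmetric] mult_ac del: ennreal_plus)
    finally show ?thesis .
  qed
  with K show ?thesis by (intro exI[of _ "2 powr p * (K + K)"]) auto
qed

section \<open>Bounded trilinear multipliers\<close>

lemma fst_borel [measurable]: "fst \<in> borel_measurable (borel :: ('a::second_countable_topology \<times> 'b::second_countable_topology) measure)"
  by (simp add: borel_measurable_continuous_onI continuous_on_fst continuous_on_id)
lemma snd_borel [measurable]: "snd \<in> borel_measurable (borel :: ('a::second_countable_topology \<times> 'b::second_countable_topology) measure)"
  by (simp add: borel_measurable_continuous_onI continuous_on_snd continuous_on_id)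
text \<open>With extended nonnegative functions the order of integration can be changed without
  integrability conditions. Negative values of \<open>m\<close> count as 0 through
  \<open>ennreal\<close>.\<close>

definition trilin :: "(real \<times> real \<Rightarrow> real \<times> real \<Rightarrow> real) \<Rightarrow> (real \<times> real \<Rightarrow> ennreal) \<Rightarrow>
    (real \<times> real \<Rightarrow> ennreal) \<Rightarrow> (real \<times> real \<Rightarrow> ennreal) \<Rightarrow> ennreal" where
  "trilin m f g h = (\<integral>\<^sup>+a. \<integral>\<^sup>+c. ennreal (m a c) * f a * g c * h (a + c) \<partial>lborel \<partial>lborel)"

definition unit_ball :: "(real \<times> real \<Rightarrow> ennreal) set" where
  "unit_ball = {f. f \<in> borel_measurable borel \<and> (\<integral>\<^sup>+z. f z ^ 2 \<partial>lborel) \<le> 1}"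

definition bdd_mult :: "(real \<times> real \<Rightarrow> real \<times> real \<Rightarrow> real) \<Rightarrow> bool" where
  "bdd_mult m \<longleftrightarrow> case_prod m \<in> borel_measurable (borel \<Otimes>\<^sub>M borel) \<and>
     (\<exists>C\<ge>0. \<forall>f\<in>unit_ball. \<forall>g\<in>unit_ball. \<forall>h\<in>unit_ball. trilin m f g h \<le> ennreal C)"

lemma unit_ball_meas: "f \<in> unit_ball \<Longrightarrow> f \<in> borel_measurable borel"
  by (simp add: unit_ball_def)

lemma bdd_multE:
  assumes "bdd_mult m"
  obtains C where "C \<ge> 0" "\<And>f g h. f \<in> unit_ball \<Longrightarrow> g \<in> unit_ball \<Longrightarrow> h \<in> unit_ball \<Longrightarrow> trilin m f g h \<le> ennreal C"
  using assms unfolding bdd_mult_def by metis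

lemma bdd_mult_meas: "bdd_mult m \<Longrightarrow> case_prod m \<in> borel_measurable (borel \<Otimes>\<^sub>M borel)"
  by (simp add: bdd_mult_def)

lemma bdd_mult_add:
  assumes "bdd_mult m" "bdd_mult m'"
  shows "bdd_mult (\<lambda>a c. m a c + m' a c)"
proof -
  obtain C where C: "C \<ge> 0" "\<And>f g h. f \<in> unit_ball \<Longrightarrow> g \<in> unit_ball \<Longrightarrow> h \<in> unit_ball \<Longrightarrow> trilin m f g h \<le> ennreal C"
    by (rule bdd_multE[OF assms(1)]) blast
  obtain C' where C': "C' \<ge> 0" "\<And>f g h. f \<in> unit_ball \<Longrightarrow> g \<in> unit_ball \<Longrightarrow> h \<in> unit_ball \<Longrightarrow> trilin m' f g h \<le> ennreal C'"
    by (rule bdd_multE[OF assms(2)]) blast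
  note [measurable] = bdd_mult_meas[OF assms(1)] bdd_mult_meas[OF assms(2)]
  have "trilin (\<lambda>a c. m a c + m' a c) f g h \<le> ennreal (C + C')"
    if u: "f \<in> unit_ball" "g \<in> unit_ball" "h \<in> unit_ball" for f g h
  proof -
    note [measurable] = u[THEN unit_ball_meas]
    \<comment> \<open>No sign is assumed of the two multipliers and \<open>ennreal\<close> cuts off
      negative values, so there is subadditivity rather than additivity.\<close>
    have plus: "ennreal (x + y) \<le> ennreal x + ennreal y" for x y
    proof -
      have "ennreal (x + y) \<le> ennreal (max 0 x + max 0 y)" by (intro ennreal_leI) auto
      also have "\<dots> = ennreal (max 0 x) + ennreal (max 0 y)" by (rule ennreal_plus) auto
      also have "\<dots> = ennreal x + ennreal y" by (auto simp: max_def ennreal_neg)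
      finally show ?thesis .
    qed
    have "trilin (\<lambda>a c. m a c + m' a c) f g h \<le>
       (\<integral>\<^sup>+a. \<integral>\<^sup>+c. ennreal (m a c) * f a * g c * h (a + c) + ennreal (m' a c) * f a * g c * h (a + c) \<partial>lborel \<partial>lborel)"
      unfolding trilin_def
      by (intro nn_integral_mono) (simp add: distrib_right[symmetric] mult_right_mono plus)
    also have "\<dots> = trilin m f g h + trilin m' f g h"
      unfolding trilin_def by (simp add: nn_integral_add)
    also have "\<dots> \<le> ennreal C + ennreal C'"
      using C(2)[OF u] C'(2)[OF u] by (rule add_mono)
    finally show ?thesis using C C' by simp
  qed
  then show ?thesis
    unfolding bdd_mult_def using C C' by (auto intro!: exI[of _ "C + C'"] simp: case_prod_unfold)
qed

lemma bdd_mult_mono: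
  assumes "bdd_mult m'" and [measurable]: "case_prod m \<in> borel_measurable (borel \<Otimes>\<^sub>M borel)"
    and le: "\<And>a c. snd a \<noteq> 0 \<Longrightarrow> snd c \<noteq> 0 \<Longrightarrow> m a c \<le> m' a c"
  shows "bdd_mult m"
proof -
  obtain C where C: "C \<ge> 0" "\<And>f g h. f \<in> unit_ball \<Longrightarrow> g \<in> unit_ball \<Longrightarrow> h \<in> unit_ball \<Longrightarrow> trilin m' f g h \<le> ennreal C"
    by (rule bdd_multE[OF assms(1)]) blast
  have "trilin m f g h \<le> trilin m' f g h" for f g h
    unfolding trilin_def
    using AE_lborel_snd_nonzero
    by (intro nn_integral_mono_AE, eventually_elim, intro nn_integral_mono_AE)
       (use AE_lborel_snd_nonzero in eventually_elim, auto intro!: mult_right_mono ennreal_leI le)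
  then show ?thesis
    unfolding bdd_mult_def using C assms(2) by (meson order_trans)
qed

lemma bdd_mult_cmult:
  assumes "bdd_mult m" "0 \<le> k"
  shows "bdd_mult (\<lambda>a c. k * m a c)"
proof -
  obtain C where C: "C \<ge> 0" "\<And>f g h. f \<in> unit_ball \<Longrightarrow> g \<in> unit_ball \<Longrightarrow> h \<in> unit_ball \<Longrightarrow> trilin m f g h \<le> ennreal C"
    by (rule bdd_multE[OF assms(1)]) blast
  note [measurable] = bdd_mult_meas[OF assms(1)]
  have "trilin (\<lambda>a c. k * m a c) f g h \<le> ennreal (k * C)"
    if u: "f \<in> unit_ball" "g \<in> unit_ball" "h \<in> unit_ball" for f g h
  proof -
    note [measurable] = u[THEN unit_ball_meas]
    have "trilin (\<lambda>a c. k * m a c) f g h =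
       (\<integral>\<^sup>+a. \<integral>\<^sup>+c. ennreal k * (ennreal (m a c) * f a * g c * h (a + c)) \<partial>lborel \<partial>lborel)"
      unfolding trilin_def by (intro nn_integral_cong) (simp add: ennreal_mult' assms(2) mult_ac)
    also have "\<dots> = ennreal k * trilin m f g h"
      unfolding trilin_def by (simp add: nn_integral_cmult)
    also have "\<dots> \<le> ennreal k * ennreal C"
      using C(2)[OF u] by (rule mult_left_mono) auto
    finally show ?thesis using C assms(2) by (simp add: ennreal_mult)
  qed
  then show ?thesis
    unfolding bdd_mult_def using C assms(2) by (auto intro!: exI[of _ "k * C"] simp: case_prod_unfold)
qed

lemma bdd_mult_swap:
  assumes "bdd_mult m"
  shows "bdd_mult (\<lambda>a c. m c a)"
proof -
  obtain C where C: "C \<ge> 0" "\<And>f g h. f \<in> unit_ball \<Longrightarrow> g \<in> unit_ball \<Longrightarrow> h \<in> unit_ball \<Longrightarrow> trilin m f g h \<le> ennreal C"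
    by (rule bdd_multE[OF assms(1)]) blast
  note [measurable] = bdd_mult_meas[OF assms(1)]
  have "trilin (\<lambda>a c. m c a) f g h \<le> ennreal C"
    if u: "f \<in> unit_ball" "g \<in> unit_ball" "h \<in> unit_ball" for f g h
  proof -
    note [measurable] = u[THEN unit_ball_meas]
    have "trilin (\<lambda>a c. m c a) f g h = trilin m g f h"
      unfolding trilin_def
      by (subst nn_integral_swap) (auto simp: case_prod_unfold mult_ac add.commute)
    with C(2)[OF u(2,1,3)] show ?thesis by simp
  qed
  then show ?thesis
    unfolding bdd_mult_def using C by (auto intro!: exI[of _ "C"] simp: case_prod_unfold)
qed

lemma unit_ball_reflect: "f \<in> unit_ball \<Longrightarrow> (\<lambda>z. f (- z)) \<in> unit_ball"
  using nn_integral_reflect[of "\<lambda>z. f z ^ 2"] by (auto simp: unit_ball_def)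

text \<open>Relabelling the three frequencies: \<open>a = (a + c) + (- c)\<close> makes the output frequency an input.\<close>

lemma bdd_mult_rotate:
  assumes "bdd_mult (\<lambda>a c. m (a + c) (- c))" and [measurable]: "case_prod m \<in> borel_measurable (borel \<Otimes>\<^sub>M borel)"
  shows "bdd_mult m"
proof -
  obtain C where C: "C \<ge> 0" "\<And>f g h. f \<in> unit_ball \<Longrightarrow> g \<in> unit_ball \<Longrightarrow> h \<in> unit_ball \<Longrightarrow>
      trilin (\<lambda>a c. m (a + c) (- c)) f g h \<le> ennreal C"
    by (rule bdd_multE[OF assms(1)]) blast
  have "trilin m f g h \<le> ennreal C"
    if u: "f \<in> unit_ball" "g \<in> unit_ball" "h \<in> unit_ball" for f g h
  proof -
    note [measurable] = u[THEN unit_ball_meas]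
    let ?G = "\<lambda>c a. ennreal (m (c + a) (- c)) * h a * g (- c) * f (c + a)"
    let ?F = "\<lambda>c a. ennreal (m a c) * f a * g c * h (a + c)"
    have "trilin m f g h = (\<integral>\<^sup>+c. \<integral>\<^sup>+a. ?F c a \<partial>lborel \<partial>lborel)"
      unfolding trilin_def by (subst nn_integral_swap) (auto simp: case_prod_unfold)
    \<comment> \<open>First \<open>c\<close> is reflected, then \<open>a\<close> is translated by
      \<open>c\<close>: the old output becomes the new first input and the old first input becomes
      the new output.\<close>
    also have "\<dots> = (\<integral>\<^sup>+c. \<integral>\<^sup>+a. ?F (- c) a \<partial>lborel \<partial>lborel)"
      by (subst nn_integral_reflect[of "\<lambda>c. \<integral>\<^sup>+a. ?F c a \<partial>lborel"]) simp_all
    also have "\<dots> = (\<integral>\<^sup>+c. \<integral>\<^sup>+a. ?F (- c) (c + a) \<partial>lborel \<partial>lborel)"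
    proof (rule nn_integral_cong)
      fix c
      show "(\<integral>\<^sup>+a. ?F (- c) a \<partial>lborel) = (\<integral>\<^sup>+a. ?F (- c) (c + a) \<partial>lborel)"
        by (subst nn_integral_shift[of "\<lambda>a. ?F (- c) a" c]) simp_all
    qed
    also have "\<dots> = (\<integral>\<^sup>+c. \<integral>\<^sup>+a. ?G c a \<partial>lborel \<partial>lborel)"
      by (intro nn_integral_cong) (simp add: mult_ac)
    also have "\<dots> = (\<integral>\<^sup>+a. \<integral>\<^sup>+c. ?G c a \<partial>lborel \<partial>lborel)"
      by (subst nn_integral_swap) (auto simp: case_prod_unfold)
    also have "\<dots> = trilin (\<lambda>a c. m (a + c) (- c)) h (\<lambda>z. g (- z)) f"
      unfolding trilin_def by (simp add: add.commute)
    also have "\<dots> \<le> ennreal C"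
      by (intro C unit_ball_reflect u)
    finally show ?thesis .
  qed
  then show ?thesis
    unfolding bdd_mult_def using C by (auto intro!: exI[of _ "C"] simp: case_prod_unfold)
qed

lemma trilin_alt:
  assumes [measurable]: "case_prod m \<in> borel_measurable (borel \<Otimes>\<^sub>M borel)"
    "f \<in> borel_measurable borel" "g \<in> borel_measurable borel" "h \<in> borel_measurable borel"
  shows "trilin m f g h = (\<integral>\<^sup>+z. \<integral>\<^sup>+a. ennreal (m a (z - a)) * f a * g (z - a) * h z \<partial>lborel \<partial>lborel)"
proof -
  let ?F = "\<lambda>a z. ennreal (m a (z - a)) * f a * g (z - a) * h z"
  have "trilin m f g h = (\<integral>\<^sup>+a. \<integral>\<^sup>+z. ?F a z \<partial>lborel \<partial>lborel)"
    unfolding trilin_def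
  proof (rule nn_integral_cong)
    fix a
    show "(\<integral>\<^sup>+c. ennreal (m a c) * f a * g c * h (a + c) \<partial>lborel) = (\<integral>\<^sup>+z. ?F a z \<partial>lborel)"
      by (subst nn_integral_shift[of "\<lambda>z. ?F a z" a, symmetric]) simp_all
  qed
  also have "\<dots> = (\<integral>\<^sup>+z. \<integral>\<^sup>+a. ?F a z \<partial>lborel \<partial>lborel)"
    by (subst nn_integral_swap) (auto simp: case_prod_unfold)
  finally show ?thesis .
qed

text \<open>Cauchy-Schwarz on the fibre \<open>a + c = z\<close>, in the additive form
  \<open>x * y \<le> x\<^sup>2 + y\<^sup>2\<close>, which suffices because the three functions are
  normalised. The square of \<open>m * h\<close> integrates to at most \<open>C\<close>, that of
  \<open>f * g\<close> to at most 1 by translation.\<close>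

lemma bdd_mult_square_integral:
  assumes [measurable]: "case_prod m \<in> borel_measurable (borel \<Otimes>\<^sub>M borel)"
    and C: "0 \<le> C" "\<And>z. (\<integral>\<^sup>+a. ennreal ((m a (z - a))\<^sup>2) \<partial>lborel) \<le> ennreal C"
  shows "bdd_mult m"
proof -
  have "trilin m f g h \<le> ennreal (C + 1)"
    if u: "f \<in> unit_ball" "g \<in> unit_ball" "h \<in> unit_ball" for f g h
  proof -
    note [measurable] = u[THEN unit_ball_meas]
    have amgm: "x * y \<le> x\<^sup>2 + y\<^sup>2" for x y :: ennreal
    proof (cases "x \<le> y")
      case True
      then have "x * y \<le> y * y" by (rule mult_right_mono) auto
      also have "\<dots> \<le> x\<^sup>2 + y\<^sup>2" by (simp add: power2_eq_square)
      finally show ?thesis .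
    next
      case False
      then have "x * y \<le> x * x" by (intro mult_left_mono) auto
      also have "\<dots> \<le> x\<^sup>2 + y\<^sup>2" by (simp add: power2_eq_square)
      finally show ?thesis .
    qed
    have sq: "ennreal t ^ 2 \<le> ennreal (t\<^sup>2)" for t
      by (cases "0 \<le> t") (auto simp: ennreal_power ennreal_neg)
    let ?F = "\<lambda>a z. ennreal (m a (z - a)) * f a * g (z - a) * h z"
    have "trilin m f g h = (\<integral>\<^sup>+z. \<integral>\<^sup>+a. ?F a z \<partial>lborel \<partial>lborel)"
      by (rule trilin_alt) auto
    also have "\<dots> \<le> (\<integral>\<^sup>+z. \<integral>\<^sup>+a. ennreal ((m a (z - a))\<^sup>2) * h z ^ 2 + f a ^ 2 * g (z - a) ^ 2 \<partial>lborel \<partial>lborel)"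
    proof (intro nn_integral_mono)
      fix z a
      have "?F a z = (ennreal (m a (z - a)) * h z) * (f a * g (z - a))" by (simp add: mult_ac)
      also have "\<dots> \<le> (ennreal (m a (z - a)) * h z)\<^sup>2 + (f a * g (z - a))\<^sup>2" by (rule amgm)
      also have "\<dots> \<le> ennreal ((m a (z - a))\<^sup>2) * h z ^ 2 + f a ^ 2 * g (z - a) ^ 2"
        unfolding power_mult_distrib by (intro add_right_mono mult_right_mono sq) auto
      finally show "?F a z \<le> ennreal ((m a (z - a))\<^sup>2) * h z ^ 2 + f a ^ 2 * g (z - a) ^ 2" .
    qed
    also have "\<dots> = (\<integral>\<^sup>+z. (\<integral>\<^sup>+a. ennreal ((m a (z - a))\<^sup>2) \<partial>lborel) * h z ^ 2 \<partial>lborel)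
       + (\<integral>\<^sup>+z. \<integral>\<^sup>+a. f a ^ 2 * g (z - a) ^ 2 \<partial>lborel \<partial>lborel)"
      by (simp add: nn_integral_add nn_integral_multc)
    also have "(\<integral>\<^sup>+z. (\<integral>\<^sup>+a. ennreal ((m a (z - a))\<^sup>2) \<partial>lborel) * h z ^ 2 \<partial>lborel)
        \<le> (\<integral>\<^sup>+z. ennreal C * h z ^ 2 \<partial>lborel)"
      by (intro nn_integral_mono mult_right_mono C) auto
    also have "\<dots> = ennreal C * (\<integral>\<^sup>+z. h z ^ 2 \<partial>lborel)" by (simp add: nn_integral_cmult)
    also have "\<dots> \<le> ennreal C * 1" using u(3) by (intro mult_left_mono) (auto simp: unit_ball_def)
    also have "(\<integral>\<^sup>+z. \<integral>\<^sup>+a. f a ^ 2 * g (z - a) ^ 2 \<partial>lborel \<partial>lborel)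
       = (\<integral>\<^sup>+a. \<integral>\<^sup>+z. f a ^ 2 * g (z - a) ^ 2 \<partial>lborel \<partial>lborel)"
      by (subst nn_integral_swap) (auto simp: case_prod_unfold)
    also have "\<dots> = (\<integral>\<^sup>+a. f a ^ 2 * (\<integral>\<^sup>+z. g z ^ 2 \<partial>lborel) \<partial>lborel)"
    proof (rule nn_integral_cong)
      fix a
      have "(\<integral>\<^sup>+z. g (- a + z) ^ 2 \<partial>lborel) = (\<integral>\<^sup>+z. g z ^ 2 \<partial>lborel)"
        by (rule nn_integral_shift) auto
      then show "(\<integral>\<^sup>+z. f a ^ 2 * g (z - a) ^ 2 \<partial>lborel) = f a ^ 2 * (\<integral>\<^sup>+z. g z ^ 2 \<partial>lborel)"
        by (simp add: nn_integral_cmult)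
    qed
    also have "\<dots> \<le> (\<integral>\<^sup>+a. f a ^ 2 * 1 \<partial>lborel)"
      using u(2) by (intro nn_integral_mono mult_left_mono) (auto simp: unit_ball_def)
    also have "\<dots> \<le> 1" using u(1) by (auto simp: unit_ball_def)
    finally show ?thesis using C by (simp add: add_mono)
  qed
  then show ?thesis
    unfolding bdd_mult_def using C by (auto intro!: exI[of _ "C + 1"])
qed

section \<open>The phase function\<close>

text \<open>\<open>\<eta>\<^sup>5 + (\<xi> - \<eta>)\<^sup>5\<close> written in the centred variable \<open>z = \<eta> - \<xi>/2\<close>, in which it is even.\<close>

definition phase :: "real \<Rightarrow> real \<Rightarrow> real" where
  "phase \<xi> z = \<xi> ^ 5 / 16 + 5 / 2 * \<xi> ^ 3 * z\<^sup>2 + 5 * \<xi> * z ^ 4"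

lemma phase_eq: "\<eta> ^ 5 + (\<xi> - \<eta>) ^ 5 = phase \<xi> (\<eta> - \<xi> / 2)"
  by (simp add: phase_def field_simps eval_nat_numeral)

text \<open>The first two terms are, up to constants, the derivative of \<open>phase \<xi>\<close>. The third one may be added because the
  only critical point \<open>z = 0\<close> is nondegenerate, with second derivative \<open>5 \<xi>\<^sup>3\<close>.\<close>

definition phase_weight :: "real \<Rightarrow> real \<Rightarrow> real" where
  "phase_weight \<xi> z = \<bar>\<xi>\<bar> ^ 3 * \<bar>z\<bar> + \<bar>\<xi>\<bar> * \<bar>z\<bar> ^ 3 + (if 1 / 4 \<le> \<bar>\<xi>\<bar> then sqrt \<bar>\<xi>\<bar> else 0)"

lemma phase_measurable [measurable]:
  assumes [measurable]: "f \<in> borel_measurable M" "g \<in> borel_measurable M"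
  shows "(\<lambda>x. phase (f x) (g x)) \<in> borel_measurable M"
  unfolding phase_def by measurable

lemma phase_weight_measurable [measurable]:
  assumes [measurable]: "f \<in> borel_measurable M" "g \<in> borel_measurable M"
  shows "(\<lambda>x. phase_weight (f x) (g x)) \<in> borel_measurable M"
  unfolding phase_weight_def by measurable

lemma phase_weight_nonneg: "0 \<le> phase_weight \<xi> z"
  by (simp add: phase_weight_def)

text \<open>Substitution on the bounded intervals from 0 to \<open>Suc n\<close>, which are never
  degenerate, followed by monotone convergence. It is an inequality since \<open>g\<close> need not
  attain all real values; \<open>g'\<close> may vanish, as the derivative of the phase does at
  0.\<close>

lemma nn_integral_monotone_substitution:
  fixes F :: "real \<Rightarrow> ennreal"
  assumes [measurable]: "F \<in> borel_measurable borel"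
    and deriv: "\<And>x. 0 \<le> x \<Longrightarrow> (g has_real_derivative g' x) (at x)"
    and cont: "continuous_on UNIV g'" and nonneg: "\<And>x. 0 \<le> x \<Longrightarrow> 0 \<le> g' x"
    and [measurable]: "g \<in> borel_measurable borel"
  shows "(\<integral>\<^sup>+x. ennreal (g' x) * F (g x) * indicator {0..} x \<partial>lborel) \<le> (\<integral>\<^sup>+y. F y \<partial>lborel)"
proof -
  have [measurable]: "g' \<in> borel_measurable borel"
    using cont by (rule borel_measurable_continuous_onI)
  let ?f = "\<lambda>n x. ennreal (g' x) * F (g x) * indicator {0..real (Suc n)} x"
  have inc: "incseq ?f"
    by (intro incseq_SucI le_funI mult_left_mono) (auto split: split_indicator)
  have "(\<lambda>x. ennreal (g' x) * F (g x) * indicator {0..} x) = (\<lambda>x. SUP n. ?f n x)"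
  proof
    fix x
    have "(SUP n. ?f n x) = ennreal (g' x) * F (g x) * (SUP n. indicator {0..real (Suc n)} x)"
      by (rule SUP_mult_left_ennreal[symmetric])
    also have "(SUP n. indicator {0..real (Suc n)} x) = (indicator {0..} x :: ennreal)"
    proof (rule antisym)
      show "(SUP n. indicator {0..real (Suc n)} x) \<le> (indicator {0..} x :: ennreal)"
        by (intro SUP_least) (auto split: split_indicator)
      obtain n where "x \<le> real n" using real_arch_simple by blast
      then have "(indicator {0..} x :: ennreal) \<le> indicator {0..real (Suc n)} x"
        by (auto split: split_indicator)
      also have "\<dots> \<le> (SUP n. indicator {0..real (Suc n)} x)" by (rule SUP_upper) auto
      finally show "(indicator {0..} x :: ennreal) \<le> (SUP n. indicator {0..real (Suc n)} x)" .
    qed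
    finally show "ennreal (g' x) * F (g x) * indicator {0..} x = (SUP n. ?f n x)" by simp
  qed
  then have "(\<integral>\<^sup>+x. ennreal (g' x) * F (g x) * indicator {0..} x \<partial>lborel) = (SUP n. \<integral>\<^sup>+x. ?f n x \<partial>lborel)"
    using nn_integral_monotone_convergence_SUP[OF inc, of lborel] by simp
  also have "\<dots> \<le> (\<integral>\<^sup>+y. F y \<partial>lborel)"
  proof (rule SUP_least)
    fix n
    have "(\<integral>\<^sup>+x. ?f n x \<partial>lborel) = (\<integral>\<^sup>+x. F (g x) * g' x * indicator {0..real (Suc n)} x \<partial>lborel)"
      by (simp add: mult_ac)
    also have "\<dots> = (\<integral>\<^sup>+y. F y * indicator {g 0..g (real (Suc n))} y \<partial>lborel)"
      by (rule nn_integral_substitution_aux[symmetric])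
         (auto intro!: deriv nonneg continuous_on_subset[OF cont])
    also have "\<dots> \<le> (\<integral>\<^sup>+y. F y \<partial>lborel)"
      by (intro nn_integral_mono) (auto split: split_indicator)
    finally show "(\<integral>\<^sup>+x. ?f n x \<partial>lborel) \<le> (\<integral>\<^sup>+y. F y \<partial>lborel)" .
  qed
  finally show ?thesis .
qed

text \<open>\<open>phase\<close> is even in \<open>z\<close>, odd in \<open>\<xi>\<close>, and
  increasing in \<open>z \<ge> 0\<close> when \<open>\<xi> \<ge> 0\<close>. There its derivative
  dominates the first two terms of the weight, so the value of the phase as new variable reduces
  their integral to that of one bracket, uniformly in \<open>\<xi>\<close> and
  \<open>\<tau>\<close>. Near the critical point the square root is estimated by the length of an
  interval.\<close>

lemma phase_integral:
  fixes r :: real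
  assumes "1 < r"
  shows "\<exists>K\<ge>0. \<forall>\<xi> \<tau>. (\<integral>\<^sup>+z. ennreal (phase_weight \<xi> z * jb (phase \<xi> z - \<tau>) powr (- r)) \<partial>lborel) \<le> ennreal K"
proof -
  obtain K where K: "K \<ge> 0" "(\<integral>\<^sup>+x. ennreal (jb x powr (- r)) \<partial>lborel) \<le> ennreal K"
    using jb_powr_integral_finite[OF assms(1)] by auto
  define w where "w \<xi> z = \<bar>\<xi>\<bar> ^ 3 * \<bar>z\<bar> + \<bar>\<xi>\<bar> * \<bar>z\<bar> ^ 3" for \<xi> z :: real
  have [measurable]: "w \<xi> \<in> borel_measurable borel" for \<xi> unfolding w_def by measurable
  have pos: "(\<integral>\<^sup>+z. ennreal (w \<xi> z * jb (phase \<xi> z - \<tau>) powr (- r)) * indicator {0..} z \<partial>lborel) \<le> ennreal K"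
    if "0 \<le> \<xi>" for \<xi> \<tau>
  proof -
    let ?g' = "\<lambda>z. 5 * \<xi> ^ 3 * z + 20 * \<xi> * z ^ 3"
    have "(\<integral>\<^sup>+z. ennreal (w \<xi> z * jb (phase \<xi> z - \<tau>) powr (- r)) * indicator {0..} z \<partial>lborel)
       \<le> (\<integral>\<^sup>+z. ennreal (?g' z) * ennreal (jb (phase \<xi> z - \<tau>) powr (- r)) * indicator {0..} z \<partial>lborel)"
    proof (intro nn_integral_mono)
      fix z
      have "w \<xi> z \<le> ?g' z" if "0 \<le> z"
      proof -
        have "0 \<le> \<xi> ^ 3 * z" "0 \<le> \<xi> * z ^ 3" using \<open>0 \<le> \<xi>\<close> that by auto
        then show ?thesis using that \<open>0 \<le> \<xi>\<close> by (simp add: w_def)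
      qed
      then have "ennreal (w \<xi> z * jb (phase \<xi> z - \<tau>) powr (- r)) \<le> ennreal (?g' z) * ennreal (jb (phase \<xi> z - \<tau>) powr (- r))" if "0 \<le> z"
        using that \<open>0 \<le> \<xi>\<close> by (subst ennreal_mult[symmetric]) (auto intro!: ennreal_leI mult_right_mono)
      then show "ennreal (w \<xi> z * jb (phase \<xi> z - \<tau>) powr (- r)) * indicator {0..} z \<le> ennreal (?g' z) * ennreal (jb (phase \<xi> z - \<tau>) powr (- r)) * indicator {0..} z"
        by (auto split: split_indicator)
    qed
    also have "\<dots> \<le> (\<integral>\<^sup>+y. ennreal (jb (y - \<tau>) powr (- r)) \<partial>lborel)"
      by (rule nn_integral_monotone_substitution[where F="\<lambda>y. ennreal (jb (y - \<tau>) powr (- r))" and g="phase \<xi>"])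
         (use that in \<open>auto intro!: derivative_eq_intros continuous_intros simp: phase_def [abs_def]\<close>)
    also have "\<dots> \<le> ennreal K" by (rule jb_powr_shift_integral[OF K(2)])
    finally show ?thesis .
  qed
  have pos': "(\<integral>\<^sup>+z. ennreal (w \<xi> z * jb (phase \<xi> z - \<tau>) powr (- r)) * indicator {0..} z \<partial>lborel) \<le> ennreal K" for \<xi> \<tau>
  proof (cases "0 \<le> \<xi>")
    case False
    have "phase (- \<xi>) z = - phase \<xi> z" for z by (simp add: phase_def power_minus_odd)
    then have "jb (phase \<xi> z - \<tau>) = jb (phase (- \<xi>) z - (- \<tau>))" for z
      by (metis jb_minus minus_diff_eq minus_diff_commute diff_minus_eq_add minus_add_distrib uminus_add_conv_diff)
    then show ?thesis using pos[of "- \<xi>" "- \<tau>"] False by (simp add: w_def)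
  qed (rule pos)
  have w: "(\<integral>\<^sup>+z. ennreal (w \<xi> z * jb (phase \<xi> z - \<tau>) powr (- r)) \<partial>lborel) \<le> ennreal (K + K)" for \<xi> \<tau>
  proof -
    let ?h = "\<lambda>z. ennreal (w \<xi> z * jb (phase \<xi> z - \<tau>) powr (- r)) * indicator {0..} z"
    have ev: "w \<xi> (- z) * jb (phase \<xi> (- z) - \<tau>) powr (- r) = w \<xi> z * jb (phase \<xi> z - \<tau>) powr (- r)" for z
      by (simp add: w_def phase_def)
    have "(\<integral>\<^sup>+z. ennreal (w \<xi> z * jb (phase \<xi> z - \<tau>) powr (- r)) \<partial>lborel) \<le> (\<integral>\<^sup>+z. ?h z + ?h (- z) \<partial>lborel)"
      unfolding ev by (intro nn_integral_mono) (auto split: split_indicator)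
    also have "\<dots> = (\<integral>\<^sup>+z. ?h z \<partial>lborel) + (\<integral>\<^sup>+z. ?h (- z) \<partial>lborel)"
      by (rule nn_integral_add) auto
    also have "(\<integral>\<^sup>+z. ?h (- z) \<partial>lborel) = (\<integral>\<^sup>+z. ?h z \<partial>lborel)"
      by (rule nn_integral_reflect) auto
    also have "(\<integral>\<^sup>+z. ?h z \<partial>lborel) + (\<integral>\<^sup>+z. ?h z \<partial>lborel) \<le> ennreal K + ennreal K"
      by (intro add_mono pos')
    finally show ?thesis using K by (simp add: ennreal_plus[symmetric] del: ennreal_plus)
  qed
  have "(\<integral>\<^sup>+z. ennreal (phase_weight \<xi> z * jb (phase \<xi> z - \<tau>) powr (- r)) \<partial>lborel) \<le> ennreal (2 * (K + K) + 32)" for \<xi> \<tau>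
  proof -
    let ?c = "\<bar>\<xi>\<bar> powr (- 5 / 2)"
    let ?J = "indicator {- ?c..?c} :: real \<Rightarrow> real"
    let ?s = "if 1 / 4 \<le> \<bar>\<xi>\<bar> then sqrt \<bar>\<xi>\<bar> else 0"
    \<comment> \<open>\<open>?c\<close> is the value of |z| at which
      \<open>\<bar>\<xi>\<bar> ^ 3 * \<bar>z\<bar>\<close> reaches
      \<open>sqrt \<bar>\<xi>\<bar>\<close>. Beyond it \<open>w\<close> dominates the square root;
      the interval inside contributes at most \<open>2 * \<bar>\<xi>\<bar> powr (- 2)\<close>, which
      is at most 32 as |\<xi>| is at least 1/4.\<close>
    have s: "?s \<le> w \<xi> z + ?s * ?J z" for z
    proof (cases "1 / 4 \<le> \<bar>\<xi>\<bar> \<and> ?c < \<bar>z\<bar>")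
      case True
      have "\<bar>\<xi>\<bar> ^ 3 = \<bar>\<xi>\<bar> powr 3" using powr_realpow[of "\<bar>\<xi>\<bar>" 3] True by auto
      then have "sqrt \<bar>\<xi>\<bar> = \<bar>\<xi>\<bar> ^ 3 * ?c"
        by (simp add: powr_half_sqrt[symmetric] powr_add[symmetric] del: powr_numeral)
      also have "\<dots> \<le> \<bar>\<xi>\<bar> ^ 3 * \<bar>z\<bar>" using True by (intro mult_left_mono) auto
      also have "\<dots> \<le> w \<xi> z" by (simp add: w_def)
      finally have "sqrt \<bar>\<xi>\<bar> \<le> w \<xi> z" .
      then show ?thesis using True by (simp add: add_increasing2)
    next
      case False
      have "0 \<le> w \<xi> z" by (simp add: w_def)
      with False show ?thesis by (auto split: split_indicator)
    qed
    have "(\<integral>\<^sup>+z. ennreal (phase_weight \<xi> z * jb (phase \<xi> z - \<tau>) powr (- r)) \<partial>lborel)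
       \<le> (\<integral>\<^sup>+z. 2 * ennreal (w \<xi> z * jb (phase \<xi> z - \<tau>) powr (- r)) + ennreal ?s * indicator {- ?c..?c} z \<partial>lborel)"
    proof (intro nn_integral_mono)
      fix z
      have "phase_weight \<xi> z * jb (phase \<xi> z - \<tau>) powr (- r) \<le> (2 * w \<xi> z + ?s * ?J z) * jb (phase \<xi> z - \<tau>) powr (- r)"
      proof (rule mult_right_mono)
        have "phase_weight \<xi> z = w \<xi> z + ?s" by (simp add: phase_weight_def w_def)
        then show "phase_weight \<xi> z \<le> 2 * w \<xi> z + ?s * ?J z" using s[of z] by linarith
      qed auto
      also have "\<dots> \<le> 2 * (w \<xi> z * jb (phase \<xi> z - \<tau>) powr (- r)) + ?s * ?J z * 1"
        unfolding distrib_right mult.assoc using assms by (intro add_left_mono mult_left_mono jb_powr_neg_le_1) auto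
      finally have *: "phase_weight \<xi> z * jb (phase \<xi> z - \<tau>) powr (- r) \<le> 2 * (w \<xi> z * jb (phase \<xi> z - \<tau>) powr (- r)) + ?s * ?J z" by simp
      have "0 \<le> w \<xi> z" by (simp add: w_def)
      then have "ennreal (2 * (w \<xi> z * jb (phase \<xi> z - \<tau>) powr (- r)) + ?s * ?J z)
         = 2 * ennreal (w \<xi> z * jb (phase \<xi> z - \<tau>) powr (- r)) + ennreal ?s * indicator {- ?c..?c} z"
        by (subst ennreal_plus) (auto simp: ennreal_mult split: split_indicator)
      with * show "ennreal (phase_weight \<xi> z * jb (phase \<xi> z - \<tau>) powr (- r)) \<le> 2 * ennreal (w \<xi> z * jb (phase \<xi> z - \<tau>) powr (- r)) + ennreal ?s * indicator {- ?c..?c} z"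
        by (metis ennreal_leI)
    qed
    also have "\<dots> = 2 * (\<integral>\<^sup>+z. ennreal (w \<xi> z * jb (phase \<xi> z - \<tau>) powr (- r)) \<partial>lborel) + ennreal ?s * emeasure lborel {- ?c..?c}"
      by (simp add: nn_integral_add nn_integral_cmult)
    also have "emeasure lborel {- ?c..?c} = ennreal (2 * ?c)" by simp
    also have "ennreal ?s * ennreal (2 * ?c) = ennreal (?s * (2 * ?c))" by (rule ennreal_mult[symmetric]) auto
    also have "\<dots> \<le> ennreal 32"
    proof (rule ennreal_leI, cases "1 / 4 \<le> \<bar>\<xi>\<bar>")
      case True
      then have "sqrt \<bar>\<xi>\<bar> * ?c = \<bar>\<xi>\<bar> powr (- 2)"
        by (simp add: powr_half_sqrt[symmetric] powr_add[symmetric])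
      also have "\<dots> \<le> (1 / 4) powr (- 2)" using True by (intro powr_neg_antimono) auto
      also have "\<dots> = 16" by (simp add: powr_minus powr_realpow[of "1/4" 2, simplified] power2_eq_square)
      finally show "?s * (2 * ?c) \<le> 32" using True by simp
    qed auto
    also have "2 * (\<integral>\<^sup>+z. ennreal (w \<xi> z * jb (phase \<xi> z - \<tau>) powr (- r)) \<partial>lborel) + ennreal 32 \<le> 2 * ennreal (K + K) + ennreal 32"
      by (intro add_mono mult_left_mono w) auto
    also have "\<dots> = ennreal (2 * (K + K) + 32)"
    proof -
      have "2 * ennreal (K + K) = ennreal (2 * (K + K))" using K by (subst ennreal_mult) auto
      then show ?thesis using K by (subst ennreal_plus) (auto simp del: ennreal_numeral)
    qed
    finally show ?thesis by (simp add: mult.commute)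
  qed
  with K show ?thesis by (intro exI[of _ "2 * (K + K) + 32"]) auto
qed

section \<open>Criteria for multipliers\<close>

definition md :: "real \<times> real \<Rightarrow> real" where
  "md z = jb (fst z - snd z ^ 5)"

lemma md_pos [simp]: "0 < md z" by (simp add: md_def)
lemma md_neq_0 [simp]: "md z \<noteq> 0" by (simp add: md_def)
lemma md_nonneg [simp]: "0 \<le> md z" by (simp add: md_def)
lemma md_ge_1: "1 \<le> md z" by (simp add: md_def jb_ge_1)
lemma md_minus [simp]: "md (- z) = md z"
  unfolding md_def using jb_minus[of "fst z - snd z ^ 5"] by (simp add: power_minus_odd)
lemma md_measurable [measurable]: "md \<in> borel_measurable borel"
  unfolding md_def by measurable

text \<open>With the output \<open>z\<close> fixed, \<open>k\<close> depends on the frequency alone,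
  so the time variable can be integrated first. It sees just two brackets, and a one-dimensional
  frequency integral is left.\<close>

lemma square_modulation_integral:
  assumes [measurable]: "case_prod k \<in> borel_measurable (borel \<Otimes>\<^sub>M borel)"
  shows "(\<integral>\<^sup>+a. ennreal ((k (snd a) (snd (z - a)) * md a powr (- p) * md (z - a) powr (- q))\<^sup>2) \<partial>lborel) =
    (\<integral>\<^sup>+\<eta>. ennreal ((k \<eta> (snd z - \<eta>))\<^sup>2) * (\<integral>\<^sup>+t. ennreal (jb (t - \<eta> ^ 5) powr (- (2 * p)) *
       jb (t - (fst z - (snd z - \<eta>) ^ 5)) powr (- (2 * q))) \<partial>lborel) \<partial>lborel)"
proof -
  have sq: "(x powr (- u))\<^sup>2 = x powr (- (2 * u))" for x u :: real
    by (simp add: power2_eq_square powr_add[symmetric])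
  have "(\<integral>\<^sup>+a. ennreal ((k (snd a) (snd (z - a)) * md a powr (- p) * md (z - a) powr (- q))\<^sup>2) \<partial>lborel) =
    (\<integral>\<^sup>+\<eta>. \<integral>\<^sup>+t. ennreal ((k \<eta> (snd z - \<eta>) * md (t, \<eta>) powr (- p) * md (z - (t, \<eta>)) powr (- q))\<^sup>2) \<partial>lborel \<partial>lborel)"
    by (subst nn_integral_plane_tx) auto
  also have "\<dots> = (\<integral>\<^sup>+\<eta>. \<integral>\<^sup>+t. ennreal ((k \<eta> (snd z - \<eta>))\<^sup>2) * ennreal (jb (t - \<eta> ^ 5) powr (- (2 * p)) *
       jb (t - (fst z - (snd z - \<eta>) ^ 5)) powr (- (2 * q))) \<partial>lborel \<partial>lborel)"
  proof (intro nn_integral_cong)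
    fix \<eta> t
    have "md (z - (t, \<eta>)) = jb (t - (fst z - (snd z - \<eta>) ^ 5))"
      unfolding md_def by (subst jb_minus[symmetric]) (simp add: algebra_simps)
    then show "ennreal ((k \<eta> (snd z - \<eta>) * md (t, \<eta>) powr (- p) * md (z - (t, \<eta>)) powr (- q))\<^sup>2) =
      ennreal ((k \<eta> (snd z - \<eta>))\<^sup>2) * ennreal (jb (t - \<eta> ^ 5) powr (- (2 * p)) *
       jb (t - (fst z - (snd z - \<eta>) ^ 5)) powr (- (2 * q)))"
      by (subst ennreal_mult[symmetric]) (simp_all add: power_mult_distrib sq mult.assoc, simp add: md_def)
  qed
  also have "\<dots> = (\<integral>\<^sup>+\<eta>. ennreal ((k \<eta> (snd z - \<eta>))\<^sup>2) * (\<integral>\<^sup>+t. ennreal (jb (t - \<eta> ^ 5) powr (- (2 * p)) *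
       jb (t - (fst z - (snd z - \<eta>) ^ 5)) powr (- (2 * q))) \<partial>lborel) \<partial>lborel)"
    by (intro nn_integral_cong nn_integral_cmult) auto
  finally show ?thesis .
qed

text \<open>The criterion without phase: the time integral is bounded uniformly by
  \<open>two_brackets_integral\<close>, so \<open>k\<close> must be square integrable along the
  lines of constant output frequency by itself.\<close>

lemma bdd_mult_fibre:
  assumes [measurable]: "case_prod k \<in> borel_measurable (borel \<Otimes>\<^sub>M borel)"
    and "0 \<le> p" "0 \<le> q" "1 / 2 < p + q"
    and C: "0 \<le> C" "\<And>\<xi>. (\<integral>\<^sup>+\<eta>. ennreal ((k \<eta> (\<xi> - \<eta>))\<^sup>2) \<partial>lborel) \<le> ennreal C"
  shows "bdd_mult (\<lambda>a c. k (snd a) (snd c) * md a powr (- p) * md c powr (- q))"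
proof -
  obtain K where K: "K \<ge> 0" "\<And>a c. (\<integral>\<^sup>+x. ennreal (jb (x - a) powr (- (2 * p)) * jb (x - c) powr (- (2 * q))) \<partial>lborel) \<le> ennreal K"
    using two_brackets_integral[of "2 * p" "2 * q"] assms(2-4) by auto
  have "(\<integral>\<^sup>+a. ennreal ((k (snd a) (snd (z - a)) * md a powr (- p) * md (z - a) powr (- q))\<^sup>2) \<partial>lborel) \<le> ennreal (C * K)" for z
  proof -
    have "(\<integral>\<^sup>+a. ennreal ((k (snd a) (snd (z - a)) * md a powr (- p) * md (z - a) powr (- q))\<^sup>2) \<partial>lborel)
       \<le> (\<integral>\<^sup>+\<eta>. ennreal ((k \<eta> (snd z - \<eta>))\<^sup>2) * ennreal K \<partial>lborel)"
      unfolding square_modulation_integral[OF assms(1)]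
      by (intro nn_integral_mono mult_left_mono K) auto
    also have "\<dots> = (\<integral>\<^sup>+\<eta>. ennreal ((k \<eta> (snd z - \<eta>))\<^sup>2) \<partial>lborel) * ennreal K"
      by (rule nn_integral_multc) auto
    also have "\<dots> \<le> ennreal C * ennreal K"
      by (intro mult_right_mono C) auto
    finally show ?thesis using C K by (simp add: ennreal_mult)
  qed
  then show ?thesis
    using C K by (intro bdd_mult_square_integral[where C="C * K"]) auto
qed

text \<open>Here the time integral decays in the distance of the two centres, which is the phase
  minus the output time frequency. A \<open>k\<close> whose square is bounded by the Jacobian-like
  \<open>phase_weight\<close> is then admissible although it need not be square integrable.\<close>

lemma bdd_mult_phase:
  assumes [measurable]: "case_prod k \<in> borel_measurable (borel \<Otimes>\<^sub>M borel)"
    and p: "1 / 2 < p"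
    and C: "0 \<le> C" "\<And>x1 x2. (k x1 x2)\<^sup>2 \<le> C * phase_weight (x1 + x2) ((x1 - x2) / 2)"
  shows "bdd_mult (\<lambda>a c. k (snd a) (snd c) * md a powr (- p) * md c powr (- p))"
proof -
  obtain K where K: "K \<ge> 0" "\<And>a c. (\<integral>\<^sup>+x. ennreal (jb (x - a) powr (- (2 * p)) * jb (x - c) powr (- (2 * p))) \<partial>lborel) \<le> ennreal (K * jb (a - c) powr (- (2 * p)))"
    using two_brackets_convolution[of "2 * p"] p by auto
  obtain J where J: "J \<ge> 0" "\<And>\<xi> \<tau>. (\<integral>\<^sup>+z. ennreal (phase_weight \<xi> z * jb (phase \<xi> z - \<tau>) powr (- (2 * p))) \<partial>lborel) \<le> ennreal J"
    using phase_integral[of "2 * p"] p by auto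
  have "(\<integral>\<^sup>+a. ennreal ((k (snd a) (snd (z - a)) * md a powr (- p) * md (z - a) powr (- p))\<^sup>2) \<partial>lborel) \<le> ennreal (C * K * J)" for z
  proof -
    let ?h = "\<lambda>u. ennreal (phase_weight (snd z) u * jb (phase (snd z) u - fst z) powr (- (2 * p)))"
    have "(\<integral>\<^sup>+a. ennreal ((k (snd a) (snd (z - a)) * md a powr (- p) * md (z - a) powr (- p))\<^sup>2) \<partial>lborel)
       \<le> (\<integral>\<^sup>+\<eta>. ennreal (C * K) * ?h (- (snd z / 2) + \<eta>) \<partial>lborel)"
      unfolding square_modulation_integral[OF assms(1)]
    proof (intro nn_integral_mono)
      fix \<eta>
      let ?u = "- (snd z / 2) + \<eta>"
      have e: "\<eta> ^ 5 - (fst z - (snd z - \<eta>) ^ 5) = phase (snd z) ?u - fst z"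
        using phase_eq[of \<eta> "snd z"] by (simp add: algebra_simps)
      have "ennreal ((k \<eta> (snd z - \<eta>))\<^sup>2) * (\<integral>\<^sup>+t. ennreal (jb (t - \<eta> ^ 5) powr (- (2 * p)) *
         jb (t - (fst z - (snd z - \<eta>) ^ 5)) powr (- (2 * p))) \<partial>lborel)
        \<le> ennreal (C * phase_weight (snd z) ?u) * ennreal (K * jb (phase (snd z) ?u - fst z) powr (- (2 * p)))"
      proof (intro mult_mono ennreal_leI)
        have "(\<eta> - (snd z - \<eta>)) / 2 = ?u" by (simp add: field_simps)
        then show "(k \<eta> (snd z - \<eta>))\<^sup>2 \<le> C * phase_weight (snd z) ?u"
          using C(2)[of \<eta> "snd z - \<eta>"] by (metis add_diff_cancel_left' add.commute diff_add_cancel)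
        show "(\<integral>\<^sup>+t. ennreal (jb (t - \<eta> ^ 5) powr (- (2 * p)) * jb (t - (fst z - (snd z - \<eta>) ^ 5)) powr (- (2 * p))) \<partial>lborel)
          \<le> ennreal (K * jb (phase (snd z) ?u - fst z) powr (- (2 * p)))"
          using K(2)[of "\<eta> ^ 5" "fst z - (snd z - \<eta>) ^ 5"] unfolding e .
      qed auto
      also have "\<dots> = ennreal (C * K) * ?h ?u"
        using C K phase_weight_nonneg[of "snd z" ?u] by (simp add: ennreal_mult[symmetric] mult_ac)
      finally show "ennreal ((k \<eta> (snd z - \<eta>))\<^sup>2) * (\<integral>\<^sup>+t. ennreal (jb (t - \<eta> ^ 5) powr (- (2 * p)) *
         jb (t - (fst z - (snd z - \<eta>) ^ 5)) powr (- (2 * p))) \<partial>lborel) \<le> ennreal (C * K) * ?h ?u" .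
    qed
    also have "\<dots> = ennreal (C * K) * (\<integral>\<^sup>+\<eta>. ?h (- (snd z / 2) + \<eta>) \<partial>lborel)"
      by (rule nn_integral_cmult) auto
    also have "(\<integral>\<^sup>+\<eta>. ?h (- (snd z / 2) + \<eta>) \<partial>lborel) = (\<integral>\<^sup>+u. ?h u \<partial>lborel)"
      by (rule nn_integral_shift) auto
    also have "ennreal (C * K) * \<dots> \<le> ennreal (C * K) * ennreal J"
      by (intro mult_left_mono J) auto
    finally show ?thesis using C K J by (simp add: ennreal_mult)
  qed
  then show ?thesis
    using C K J by (intro bdd_mult_square_integral[where C="C * K * J"]) auto
qed

text \<open>The fibre criterion with the first input fixed, for the case that its modulation was the
  large one and has been spent. The rotation sends this fibre to one with fixed output.\<close>

lemma bdd_mult_fibre_out1: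
  assumes [measurable]: "case_prod k \<in> borel_measurable (borel \<Otimes>\<^sub>M borel)"
    and "0 \<le> p" "0 \<le> q" "1 / 2 < p + q"
    and C: "0 \<le> C" "\<And>\<xi>. (\<integral>\<^sup>+\<eta>. ennreal ((k \<xi> \<eta>)\<^sup>2) \<partial>lborel) \<le> ennreal C"
  shows "bdd_mult (\<lambda>a c. k (snd a) (snd c) * md (a + c) powr (- p) * md c powr (- q))"
proof (rule bdd_mult_rotate)
  have *: "(\<integral>\<^sup>+\<eta>. ennreal ((k \<xi> (\<eta> - \<xi>))\<^sup>2) \<partial>lborel) \<le> ennreal C" for \<xi>
    using C(2)[of \<xi>] nn_integral_shift[of "\<lambda>\<eta>. ennreal ((k \<xi> \<eta>)\<^sup>2)" "- \<xi>"] by simp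
  have "bdd_mult (\<lambda>a c. k (snd a + snd c) (- snd c) * md a powr (- p) * md c powr (- q))"
    using assms(2-5) * by (intro bdd_mult_fibre[where k="\<lambda>x y. k (x + y) (- y)" and C=C]) auto
  then show "bdd_mult (\<lambda>a c. k (snd (a + c)) (snd (- c)) * md (a + c + - c) powr (- p) * md (- c) powr (- q))"
    by simp
qed simp

text \<open>With \<open>x1\<close> fixed, the two running frequencies are \<open>x1 + x2\<close> and
  \<open>- x2\<close>, with sum \<open>x1\<close>; half of their difference is
  \<open>x2 + x1 / 2\<close>, the centred variable of the phase.\<close>

lemma bdd_mult_phase_out1:
  assumes [measurable]: "case_prod k \<in> borel_measurable (borel \<Otimes>\<^sub>M borel)"
    and p: "1 / 2 < p"
    and C: "0 \<le> C" "\<And>x1 x2. (k x1 x2)\<^sup>2 \<le> C * phase_weight x1 (x2 + x1 / 2)"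
  shows "bdd_mult (\<lambda>a c. k (snd a) (snd c) * md (a + c) powr (- p) * md c powr (- p))"
proof (rule bdd_mult_rotate)
  have "(k (x1 + x2) (- x2))\<^sup>2 \<le> C * phase_weight (x1 + x2) ((x1 - x2) / 2)" for x1 x2
    using C(2)[of "x1 + x2" "- x2"] by (simp add: field_simps)
  then have "bdd_mult (\<lambda>a c. k (snd a + snd c) (- snd c) * md a powr (- p) * md c powr (- p))"
    using p C by (intro bdd_mult_phase[where k="\<lambda>x y. k (x + y) (- y)" and C=C]) auto
  then show "bdd_mult (\<lambda>a c. k (snd (a + c)) (snd (- c)) * md (a + c + - c) powr (- p) * md (- c) powr (- p))"
    by simp
qed simp

lemma bdd_mult_fibre_out2:
  assumes [measurable]: "case_prod k \<in> borel_measurable (borel \<Otimes>\<^sub>M borel)"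
    and "0 \<le> p" "0 \<le> q" "1 / 2 < p + q"
    and C: "0 \<le> C" "\<And>\<xi>. (\<integral>\<^sup>+\<eta>. ennreal ((k \<eta> \<xi>)\<^sup>2) \<partial>lborel) \<le> ennreal C"
  shows "bdd_mult (\<lambda>a c. k (snd a) (snd c) * md (a + c) powr (- p) * md a powr (- q))"
  using bdd_mult_swap[OF bdd_mult_fibre_out1[of "\<lambda>x y. k y x" p q C]] assms by (simp add: add.commute)

lemma bdd_mult_phase_out2:
  assumes [measurable]: "case_prod k \<in> borel_measurable (borel \<Otimes>\<^sub>M borel)"
    and p: "1 / 2 < p"
    and C: "0 \<le> C" "\<And>x1 x2. (k x1 x2)\<^sup>2 \<le> C * phase_weight x2 (x1 + x2 / 2)"
  shows "bdd_mult (\<lambda>a c. k (snd a) (snd c) * md (a + c) powr (- p) * md a powr (- p))"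
  using bdd_mult_swap[OF bdd_mult_phase_out1[of "\<lambda>x y. k y x" p C]] assms by (simp add: add.commute)

section \<open>Weights and resonance\<close>

text \<open>Reciprocal of the weight controlled by the input norm, up to constants. At low
  frequencies the bracket of \<open>\<tau>\<close> in \<open>D_norm\<close> is replaced by the
  modulation, which is comparable there because \<xi>^5 is bounded.\<close>

definition winv :: "real \<Rightarrow> real \<Rightarrow> real \<Rightarrow> real \<times> real \<Rightarrow> real" where
  "winv s b \<alpha> z = (if \<bar>snd z\<bar> \<le> 1 then md z powr (- \<alpha>) else jb (snd z) powr (- s) * md z powr (- b))"

definition kawahara_mult :: "real \<Rightarrow> real \<Rightarrow> real \<Rightarrow> real \<times> real \<Rightarrow> real \<times> real \<Rightarrow> real" where
  "kawahara_mult s b \<alpha> a c = \<bar>snd a + snd c\<bar> * jb (fst a + fst c) powr (s / 5) * md (a + c) powr (- b) *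
     winv s b \<alpha> a * winv s b \<alpha> c"

lemma winv_nonneg [simp]: "0 \<le> winv s b \<alpha> z" by (simp add: winv_def)
lemma kawahara_mult_nonneg: "0 \<le> kawahara_mult s b \<alpha> a c" by (simp add: kawahara_mult_def)
lemma kawahara_mult_commute: "kawahara_mult s b \<alpha> a c = kawahara_mult s b \<alpha> c a"
  by (simp add: kawahara_mult_def add.commute mult_ac)
lemma winv_measurable [measurable]: "winv s b \<alpha> \<in> borel_measurable borel"
  unfolding winv_def by measurable
lemma kawahara_mult_measurable [measurable]: "case_prod (kawahara_mult s b \<alpha>) \<in> borel_measurable (borel \<Otimes>\<^sub>M borel)"
  unfolding kawahara_mult_def by measurable

lemma bdd_mult_symmetrize:
  assumes sym: "\<And>a c. m a c = m c a" and [measurable]: "case_prod m \<in> borel_measurable (borel \<Otimes>\<^sub>M borel)"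
    and nonneg: "\<And>a c. 0 \<le> m a c"
    and b: "bdd_mult (\<lambda>a c. if \<bar>snd c\<bar> \<le> \<bar>snd a\<bar> then m a c else 0)"
  shows "bdd_mult m"
proof (rule bdd_mult_mono[OF bdd_mult_add[OF b bdd_mult_swap[OF b]]])
  show "m a c \<le> (if \<bar>snd c\<bar> \<le> \<bar>snd a\<bar> then m a c else 0) + (if \<bar>snd a\<bar> \<le> \<bar>snd c\<bar> then m c a else 0)" for a c
    using sym[of a c] nonneg[of a c] by auto
qed simp

text \<open>The resonance identity
  \<open>\<xi>\<^sup>5 - \<xi>\<^sub>1\<^sup>5 - \<xi>\<^sub>2\<^sup>5 = (5/2) \<xi> \<xi>\<^sub>1 \<xi>\<^sub>2 (\<xi>\<^sup>2 + \<xi>\<^sub>1\<^sup>2 + \<xi>\<^sub>2\<^sup>2)\<close> with \<open>\<xi> = \<xi>\<^sub>1 + \<xi>\<^sub>2\<close>.\<close>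

lemma resonance:
  fixes a c :: "real \<times> real"
  defines "Q \<equiv> \<bar>snd a + snd c\<bar> * \<bar>snd a\<bar> ^ 3 * \<bar>snd c\<bar> / 2"
  shows "Q \<le> md (a + c) \<or> Q \<le> md a \<or> Q \<le> md c"
proof (rule ccontr)
  assume neg: "\<not> ?thesis"
  define x1 x2 where "x1 = snd a" and "x2 = snd c"
  let ?x = "x1 + x2"
  let ?H = "5 / 2 * (?x * x1 * x2) * (?x\<^sup>2 + x1\<^sup>2 + x2\<^sup>2)"
  \<comment> \<open>The time frequencies cancel in the combination of the three modulations, which
    leaves the resonance function.\<close>
  have id: "?H = (fst a - x1 ^ 5) + (fst c - x2 ^ 5) - (fst a + fst c - ?x ^ 5)"
    by (simp add: field_simps eval_nat_numeral)
  have "\<bar>?H\<bar> \<le> \<bar>fst a - x1 ^ 5\<bar> + \<bar>fst c - x2 ^ 5\<bar> + \<bar>fst a + fst c - ?x ^ 5\<bar>"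
    unfolding id by linarith
  also have "\<dots> \<le> md a + md c + md (a + c)"
    unfolding md_def x1_def x2_def by (intro add_mono order_trans[OF _ abs_le_jb]) auto
  also have "\<dots> < 3 * Q" using neg by auto
  finally have 1: "\<bar>?H\<bar> < 3 * Q" .
  have "\<bar>?H\<bar> = 5 / 2 * (\<bar>?x\<bar> * \<bar>x1\<bar> * \<bar>x2\<bar>) * (?x\<^sup>2 + x1\<^sup>2 + x2\<^sup>2)"
    by (simp add: abs_mult)
  \<comment> \<open>Of the sum of squares only the square of \<open>x1\<close> is kept, since
    \<open>x1\<close> will be the larger input frequency. The result
    \<open>5 * Q \<le> \<bar>?H\<bar>\<close> contradicts
    \<open>\<bar>?H\<bar> < 3 * Q\<close>.\<close>
  also have "\<dots> \<ge> 5 / 2 * (\<bar>?x\<bar> * \<bar>x1\<bar> * \<bar>x2\<bar>) * x1\<^sup>2"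
    by (intro mult_left_mono) auto
  also have "5 / 2 * (\<bar>?x\<bar> * \<bar>x1\<bar> * \<bar>x2\<bar>) * x1\<^sup>2 = 5 * Q"
    by (simp add: Q_def x1_def x2_def power3_eq_cube power2_eq_square)
  finally have "5 * Q \<le> \<bar>?H\<bar>" .
  moreover have "0 \<le> Q" by (simp add: Q_def)
  ultimately show False using 1 by linarith
qed

text \<open>The dominant modulation is traded for \<open>Q\<close>, and the other two remain, in the
  form which the criteria accept. Adding the three outcomes avoids a partition of the plane. The
  gain exponent \<open>u\<close> may be smaller than \<open>b\<close>: for \<open>b > 1/2\<close>
  the value 1/2 is used.\<close>

lemma dominant_split:
  fixes L L1 L2 :: real
  assumes "1 \<le> L" "1 \<le> L1" "1 \<le> L2" "0 < Q" "0 \<le> A" "A * Q powr (- u) \<le> k" "0 \<le> u" "u \<le> b"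
    and dom: "Q \<le> L \<or> Q \<le> L1 \<or> Q \<le> L2"
  shows "A * L powr (- b) * L1 powr (- b) * L2 powr (- b) \<le>
    k * L1 powr (- b) * L2 powr (- b) + k * L powr (- b) * L2 powr (- b) + k * L powr (- b) * L1 powr (- b)"
proof -
  have *: "A * M powr (- b) \<le> k" if "Q \<le> M" "1 \<le> M" for M
  proof -
    have "M powr (- b) \<le> M powr (- u)" using that assms by (intro powr_mono) auto
    also have "\<dots> \<le> Q powr (- u)" using that assms by (intro powr_neg_antimono) auto
    finally have "A * M powr (- b) \<le> A * Q powr (- u)" using assms by (intro mult_left_mono) auto
    with assms show ?thesis by linarith
  qed
  have k: "0 \<le> k" using assms(4-6) by (meson mult_nonneg_nonneg order_trans powr_ge_zero)
  then have nn: "0 \<le> k * L1 powr (- b) * L2 powr (- b)" "0 \<le> k * L powr (- b) * L2 powr (- b)" "0 \<le> k * L powr (- b) * L1 powr (- b)"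
    by auto
  from dom show ?thesis
  proof (elim disjE)
    assume "Q \<le> L"
    with *[of L] assms have "A * L powr (- b) * (L1 powr (- b) * L2 powr (- b)) \<le> k * (L1 powr (- b) * L2 powr (- b))"
      by (intro mult_right_mono) auto
    with nn show ?thesis by (simp add: mult_ac)
  next
    assume "Q \<le> L1"
    with *[of L1] assms have "A * L1 powr (- b) * (L powr (- b) * L2 powr (- b)) \<le> k * (L powr (- b) * L2 powr (- b))"
      by (intro mult_right_mono) auto
    with nn show ?thesis by (simp add: mult_ac)
  next
    assume "Q \<le> L2"
    with *[of L2] assms have "A * L2 powr (- b) * (L powr (- b) * L1 powr (- b)) \<le> k * (L powr (- b) * L1 powr (- b))"
      by (intro mult_right_mono) auto
    with nn show ?thesis by (simp add: mult_ac)
  qed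
qed

text \<open>\<open>X\<close> is the output frequency and \<open>Y\<close> the larger input
  frequency. The factor \<open>X\<close> of the derivative meets X to the power -u from the
  resonance; as \<open>u \<le> 1\<close>, the rest has a nonnegative exponent and can be absorbed by
  \<open>X \<le> 2 * Y\<close>.\<close>

lemma resonance_gain:
  fixes X Y Z u :: real
  assumes "0 < X" "0 < Y" "0 < Z" "X \<le> 2 * Y" "0 \<le> u" "u \<le> 1"
  shows "X * (X * Y ^ 3 * Z / 2) powr (- u) \<le> 2 * Y powr (1 - 4 * u) * Z powr (- u)"
proof -
  have Y3: "Y ^ 3 = Y powr 3" using powr_realpow[of Y 3] assms by simp
  have X: "X * X powr (- u) = X powr (1 - u)" using assms powr_add[of X 1 "- u"] by simp
  have "X * (X * Y ^ 3 * Z / 2) powr (- u) = 2 powr u * (X * X powr (- u)) * (Y powr (- (3 * u)) * Z powr (- u))"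
  proof -
    have "(Y ^ 3) powr (- u) = Y powr (- (3 * u))"
      unfolding Y3 by (simp add: powr_powr del: powr_numeral)
    moreover have "(X * Y ^ 3 * Z / 2) powr (- u) = X powr (- u) * (Y ^ 3) powr (- u) * Z powr (- u) * 2 powr u"
      using assms by (simp only: powr_mult powr_divide powr_minus) (simp add: field_simps)
    ultimately show ?thesis by (simp add: mult_ac)
  qed
  also have "\<dots> = 2 powr u * X powr (1 - u) * (Y powr (- (3 * u)) * Z powr (- u))"
    unfolding X ..
  also have "\<dots> \<le> 2 powr u * (2 * Y) powr (1 - u) * (Y powr (- (3 * u)) * Z powr (- u))"
    using assms by (intro mult_right_mono mult_left_mono powr_mono2) auto
  also have "\<dots> = 2 * Y powr (1 - 4 * u) * Z powr (- u)"
  proof -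
    have "2 powr u * (2 * Y) powr (1 - u) = 2 * Y powr (1 - u)"
      using assms powr_add[of 2 u "1 - u"] by (simp add: powr_mult)
    moreover have "Y powr (1 - u) * Y powr (- (3 * u)) = Y powr (1 - 4 * u)"
      by (simp add: powr_add[symmetric])
    ultimately show ?thesis by (metis mult.assoc)
  qed
  finally show ?thesis .
qed

lemma jb_square_integral:
  assumes "1 / 2 < u"
  shows "\<exists>C\<ge>0. (\<integral>\<^sup>+\<eta>. ennreal ((jb \<eta> powr (- u))\<^sup>2) \<partial>lborel) \<le> ennreal C"
proof -
  have "(jb \<eta> powr (- u))\<^sup>2 = jb \<eta> powr (- (2 * u))" for \<eta>
    by (simp add: power2_eq_square powr_add[symmetric])
  then show ?thesis using jb_powr_integral_finite[of "2 * u"] assms by simp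
qed

text \<open>The singularity that the resonance bound leaves at zero frequency;
  \<open>b < 1/2\<close> is exactly what makes it square integrable.\<close>

lemma abs_powr_square_integral:
  fixes b :: real
  assumes "b < 1 / 2"
  shows "\<exists>C\<ge>0. (\<integral>\<^sup>+\<eta>. ennreal ((if \<bar>\<eta>\<bar> \<le> 1 then \<bar>\<eta>\<bar> powr (- b) else 0)\<^sup>2) \<partial>lborel) \<le> ennreal C"
proof -
  let ?h = "\<lambda>x::real. indicator {0..1} x * ennreal (x powr (- (2 * b)))"
  have "((\<lambda>x. x powr (- (2 * b))) has_integral (1 powr (- (2 * b) + 1) / (- (2 * b) + 1))) {0..1}"
    using assms by (intro has_integral_powr_from_0) auto
  then have "(\<integral>\<^sup>+x. ennreal (indicator {0..1} x * x powr (- (2 * b))) \<partial>lborel) = ennreal (1 / (1 - 2 * b))"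
    using nn_integral_has_integral_lebesgue[of "{0..1}" "\<lambda>x. x powr (- (2 * b))" "1 / (1 - 2 * b)"]
    by (simp add: nn_integral_completion)
  then have h: "(\<integral>\<^sup>+x. ?h x \<partial>lborel) = ennreal (1 / (1 - 2 * b))"
    by (simp add: ennreal_mult' ennreal_indicator)
  have "(\<integral>\<^sup>+\<eta>. ennreal ((if \<bar>\<eta>\<bar> \<le> 1 then \<bar>\<eta>\<bar> powr (- b) else 0)\<^sup>2) \<partial>lborel)
     \<le> (\<integral>\<^sup>+\<eta>. ?h \<eta> + ?h (- \<eta>) \<partial>lborel)"
    by (intro nn_integral_mono) (auto simp: power2_eq_square powr_add[symmetric] abs_if split: split_indicator)
  also have "\<dots> = (\<integral>\<^sup>+\<eta>. ?h \<eta> \<partial>lborel) + (\<integral>\<^sup>+\<eta>. ?h (- \<eta>) \<partial>lborel)"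
    by (rule nn_integral_add) auto
  also have "(\<integral>\<^sup>+\<eta>. ?h (- \<eta>) \<partial>lborel) = (\<integral>\<^sup>+\<eta>. ?h \<eta> \<partial>lborel)"
    by (rule nn_integral_reflect) auto
  also have "(\<integral>\<^sup>+\<eta>. ?h \<eta> \<partial>lborel) + (\<integral>\<^sup>+\<eta>. ?h \<eta> \<partial>lborel) = ennreal (1 / (1 - 2 * b) + 1 / (1 - 2 * b))"
    unfolding h using assms by (simp add: ennreal_plus[symmetric] del: ennreal_plus)
  finally show ?thesis using assms by (intro exI[of _ "1 / (1 - 2 * b) + 1 / (1 - 2 * b)"]) auto
qed

section \<open>Interaction with a low frequency\<close>

text \<open>What is left for a high and a low input after the frequency weight of the high input has
  been cancelled against the output weight. It serves both endpoints.\<close>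

definition low_mult :: "real \<Rightarrow> real \<Rightarrow> real \<times> real \<Rightarrow> real \<times> real \<Rightarrow> real" where
  "low_mult b \<alpha> a c = (if \<bar>snd c\<bar> \<le> 1 \<and> 1 < \<bar>snd a\<bar> then \<bar>snd a + snd c\<bar> else 0) *
     md (a + c) powr (- b) * md a powr (- b) * md c powr (- \<alpha>)"

lemma low_mult_nonneg: "0 \<le> low_mult b \<alpha> a c" by (simp add: low_mult_def)

text \<open>The resonance bounds the derivative by |x1| to the power 1 - 4b times |x2| to the power
  -b. The first factor is at most 1 because \<open>4 * b > 1\<close> and |x1| > 1, the second is
  square integrable over |x2| at most 1 because \<open>b < 1/2\<close>.\<close>

lemma bdd_mult_low:
  assumes b: "1 / 4 < b" "b < 1 / 2" and \<alpha>: "1 / 2 < \<alpha>"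
  shows "bdd_mult (low_mult b \<alpha>)"
proof -
  define k :: "real \<Rightarrow> real \<Rightarrow> real" where "k x1 x2 = (if \<bar>x2\<bar> \<le> 1 then \<bar>x2\<bar> powr (- b) else 0)" for x1 x2
  have [measurable]: "case_prod k \<in> borel_measurable (borel \<Otimes>\<^sub>M borel)"
    unfolding k_def by measurable
  obtain C where C: "C \<ge> 0" "(\<integral>\<^sup>+\<eta>. ennreal ((if \<bar>\<eta>\<bar> \<le> 1 then \<bar>\<eta>\<bar> powr (- b) else 0)\<^sup>2) \<partial>lborel) \<le> ennreal C"
    using abs_powr_square_integral[OF b(2)] by auto
  have k1: "(\<integral>\<^sup>+\<eta>. ennreal ((k \<eta> (\<xi> - \<eta>))\<^sup>2) \<partial>lborel) \<le> ennreal C" for \<xi>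
  proof -
    let ?f = "\<lambda>\<eta>. ennreal ((if \<bar>\<eta>\<bar> \<le> 1 then \<bar>\<eta>\<bar> powr (- b) else 0)\<^sup>2)"
    have "(\<integral>\<^sup>+\<eta>. ennreal ((k \<eta> (\<xi> - \<eta>))\<^sup>2) \<partial>lborel) = (\<integral>\<^sup>+\<eta>. ?f (- (- \<xi> + \<eta>)) \<partial>lborel)"
      by (intro nn_integral_cong) (simp add: k_def)
    also have "\<dots> = (\<integral>\<^sup>+\<eta>. ?f (- \<eta>) \<partial>lborel)"
      by (rule nn_integral_shift) auto
    also have "\<dots> \<le> ennreal C" using C by (simp only: abs_minus_cancel)
    finally show ?thesis .
  qed
  have k2: "(\<integral>\<^sup>+\<eta>. ennreal ((k \<xi> \<eta>)\<^sup>2) \<partial>lborel) \<le> ennreal C" for \<xi>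
    using C by (simp add: k_def)
  have k0: "0 \<le> k x1 x2" for x1 x2 by (simp add: k_def)
  have B1: "bdd_mult (\<lambda>a c. k (snd a) (snd c) * md a powr (- b) * md c powr (- \<alpha>))"
    using b \<alpha> C k1 by (intro bdd_mult_fibre) auto
  have B2: "bdd_mult (\<lambda>a c. k (snd a) (snd c) * md (a + c) powr (- b) * md c powr (- \<alpha>))"
    using b \<alpha> C k2 by (intro bdd_mult_fibre_out1) auto
  \<comment> \<open>For a dominant modulation of the low input: it pays b out of \<alpha>, the
    output modulation is dropped, and the remaining exponents b and \<alpha> - b add up to \<alpha>
    > 1/2.\<close>
  have B3: "bdd_mult (\<lambda>a c. k (snd a) (snd c) * md a powr (- b) * md c powr (- (\<alpha> - b)))"
    using b \<alpha> C k1 by (intro bdd_mult_fibre) auto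
  show ?thesis
  proof (rule bdd_mult_mono[OF bdd_mult_cmult[OF bdd_mult_add[OF B1 bdd_mult_add[OF B2 B3]], of 2]])
    show "case_prod (low_mult b \<alpha>) \<in> borel_measurable (borel \<Otimes>\<^sub>M borel)"
      unfolding low_mult_def by measurable
    fix a c :: "real \<times> real"
    assume nz: "snd a \<noteq> 0" "snd c \<noteq> 0"
    let ?K = "k (snd a) (snd c)"
    have nn: "0 \<le> ?K * md a powr (- b) * md c powr (- \<alpha>)" "0 \<le> ?K * md (a + c) powr (- b) * md c powr (- \<alpha>)"
      "0 \<le> ?K * md a powr (- b) * md c powr (- (\<alpha> - b))" using k0 by auto
    show "low_mult b \<alpha> a c \<le> 2 * (?K * md a powr (- b) * md c powr (- \<alpha>) +
      (?K * md (a + c) powr (- b) * md c powr (- \<alpha>) + ?K * md a powr (- b) * md c powr (- (\<alpha> - b))))"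
    proof (cases "\<bar>snd c\<bar> \<le> 1 \<and> 1 < \<bar>snd a\<bar> \<and> snd a + snd c \<noteq> 0")
      case False
      then have "low_mult b \<alpha> a c = 0" by (auto simp: low_mult_def)
      then show ?thesis using nn by simp
    next
      case True
      let ?X = "\<bar>snd a + snd c\<bar>"
      let ?Q = "?X * \<bar>snd a\<bar> ^ 3 * \<bar>snd c\<bar> / 2"
      have Q: "0 < ?Q" using True nz by auto
      have "?X * ?Q powr (- b) \<le> 2 * \<bar>snd a\<bar> powr (1 - 4 * b) * \<bar>snd c\<bar> powr (- b)"
        using True nz b by (intro resonance_gain) auto
      also have "\<dots> \<le> 2 * 1 * \<bar>snd c\<bar> powr (- b)"
      proof (intro mult_right_mono mult_left_mono)
        have "\<bar>snd a\<bar> powr (1 - 4 * b) \<le> \<bar>snd a\<bar> powr 0"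
          by (rule powr_mono) (use True b in auto)
        then show "\<bar>snd a\<bar> powr (1 - 4 * b) \<le> 1" using nz by simp
      qed auto
      finally have XQ: "?X * ?Q powr (- b) \<le> 2 * ?K" using True by (simp add: k_def)
      have gain: "?X * M powr (- b) \<le> 2 * ?K" if "?Q \<le> M" for M
      proof -
        have "?X * M powr (- b) \<le> ?X * ?Q powr (- b)"
          using that b Q by (intro mult_left_mono powr_neg_antimono) auto
        with XQ show ?thesis by linarith
      qed
      have low: "low_mult b \<alpha> a c = ?X * md (a + c) powr (- b) * md a powr (- b) * md c powr (- \<alpha>)"
        using True by (simp add: low_mult_def)
      from resonance[of a c] show ?thesis
      proof (elim disjE)
        assume "?Q \<le> md (a + c)"
        from gain[OF this] have "?X * md (a + c) powr (- b) * (md a powr (- b) * md c powr (- \<alpha>)) \<le> 2 * ?K * (md a powr (- b) * md c powr (- \<alpha>))"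
          by (intro mult_right_mono) auto
        then have "low_mult b \<alpha> a c \<le> 2 * (?K * md a powr (- b) * md c powr (- \<alpha>))"
          unfolding low by (simp only: mult_ac)
        with nn show ?thesis unfolding distrib_left by linarith
      next
        assume "?Q \<le> md a"
        from gain[OF this] have "?X * md a powr (- b) * (md (a + c) powr (- b) * md c powr (- \<alpha>)) \<le> 2 * ?K * (md (a + c) powr (- b) * md c powr (- \<alpha>))"
          by (intro mult_right_mono) auto
        then have "low_mult b \<alpha> a c \<le> 2 * (?K * md (a + c) powr (- b) * md c powr (- \<alpha>))"
          unfolding low by (simp only: mult_ac)
        with nn show ?thesis unfolding distrib_left by linarith
      next
        assume "?Q \<le> md c"
        from gain[OF this] have *: "?X * md c powr (- b) * (md a powr (- b) * md c powr (- (\<alpha> - b))) \<le> 2 * ?K * (md a powr (- b) * md c powr (- (\<alpha> - b)))"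
          by (intro mult_right_mono) auto
        have "md (a + c) powr (- b) \<le> 1" using b md_ge_1[of "a + c"] powr_mono[of "- b" 0 "md (a + c)"] by simp
        then have "low_mult b \<alpha> a c \<le> ?X * 1 * md a powr (- b) * md c powr (- \<alpha>)"
          unfolding low by (intro mult_right_mono mult_left_mono) auto
        also have "md c powr (- \<alpha>) = md c powr (- b) * md c powr (- (\<alpha> - b))"
          by (simp add: powr_add[symmetric])
        finally have "low_mult b \<alpha> a c \<le> ?X * md c powr (- b) * (md a powr (- b) * md c powr (- (\<alpha> - b)))"
          by (simp only: mult_1_right mult_ac)
        with * have "low_mult b \<alpha> a c \<le> 2 * ?K * (md a powr (- b) * md c powr (- (\<alpha> - b)))"
          by linarith
        then have "low_mult b \<alpha> a c \<le> 2 * (?K * md a powr (- b) * md c powr (- (\<alpha> - b)))"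
          by (simp only: mult.assoc)
        with nn show ?thesis unfolding distrib_left by linarith
      qed
    qed
  qed simp
qed

section \<open>The endpoint \<open>s = 5 b\<close>, \<open>b < 1/2\<close>\<close>

lemma jb_le_2abs: "1 \<le> \<bar>x\<bar> \<Longrightarrow> jb x \<le> 2 * \<bar>x\<bar>"
  using jb_le[of x] by linarith

lemma two_powr_5b_le: "b < 1 / 2 \<Longrightarrow> 2 powr (5 * b) \<le> (8 :: real)"
  using powr_mono[of "5 * b" 3 2] by (simp add: powr_realpow[of 2 3, simplified])

lemma bdd_mult_upper_endpoint:
  assumes b: "3 / 8 < b" "b < 1 / 2" and \<alpha>: "1 / 2 < \<alpha>"
  shows "bdd_mult (kawahara_mult (5 * b) b \<alpha>)"
proof (rule bdd_mult_symmetrize)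
  \<comment> \<open>\<open>k1\<close> belongs to the part where the output modulation pays for the
    whole output weight; the derivative takes one power from the input weights. \<open>k2\<close> is
    the outcome of the resonance for two high inputs: its 4 is the 2 of
    \<open>resonance_gain\<close> times the cost of passing from |x1| to its bracket.\<close>
  define k1 :: "real \<Rightarrow> real \<Rightarrow> real" where "k1 x1 x2 = jb x1 powr (- (5 * b - 1)) * jb x2 powr (- (5 * b - 1))" for x1 x2
  define k2 :: "real \<Rightarrow> real \<Rightarrow> real" where "k2 x1 x2 = 4 * jb x1 powr (- (4 * b - 1)) * jb x2 powr (- (5 * b))" for x1 x2
  have [measurable]: "case_prod k1 \<in> borel_measurable (borel \<Otimes>\<^sub>M borel)" unfolding k1_def by measurable
  have [measurable]: "case_prod k2 \<in> borel_measurable (borel \<Otimes>\<^sub>M borel)" unfolding k2_def by measurable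
  have k1: "0 \<le> k1 x1 x2" "0 \<le> k2 x1 x2" for x1 x2 by (auto simp: k1_def k2_def)
  obtain C1 where C1: "C1 \<ge> 0" "(\<integral>\<^sup>+\<eta>. ennreal ((jb \<eta> powr (- (5 * b - 1)))\<^sup>2) \<partial>lborel) \<le> ennreal C1"
    using jb_square_integral[of "5 * b - 1"] b by auto
  obtain C2 where C2: "C2 \<ge> 0" "(\<integral>\<^sup>+\<eta>. ennreal ((jb \<eta> powr (- (5 * b)))\<^sup>2) \<partial>lborel) \<le> ennreal C2"
    using jb_square_integral[of "5 * b"] b by auto
  obtain C3 where C3: "C3 \<ge> 0" "(\<integral>\<^sup>+\<eta>. ennreal ((jb \<eta> powr (- (4 * b - 1)))\<^sup>2) \<partial>lborel) \<le> ennreal C3"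
    using jb_square_integral[of "4 * b - 1"] b by (cases "1 / 2 < 4 * b - 1") auto
  have i1: "(\<integral>\<^sup>+\<eta>. ennreal ((k1 \<eta> (\<xi> - \<eta>))\<^sup>2) \<partial>lborel) \<le> ennreal C1" for \<xi>
  proof -
    have "(k1 \<eta> (\<xi> - \<eta>))\<^sup>2 \<le> (jb \<eta> powr (- (5 * b - 1)))\<^sup>2" for \<eta>
      unfolding k1_def using b jb_powr_neg_le_1[of "5 * b - 1" "\<xi> - \<eta>"]
      by (intro power_mono) (auto intro: mult_left_le)
    then show ?thesis by (intro order_trans[OF nn_integral_mono C1(2)] ennreal_leI)
  qed
  have k2le: "(k2 x1 x2)\<^sup>2 \<le> 16 * (jb x2 powr (- (5 * b)))\<^sup>2" "(k2 x1 x2)\<^sup>2 \<le> 16 * (jb x1 powr (- (4 * b - 1)))\<^sup>2" for x1 x2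
  proof -
    have "k2 x1 x2 \<le> 4 * 1 * jb x2 powr (- (5 * b))"
      unfolding k2_def using b jb_powr_neg_le_1[of "4 * b - 1" x1] by (intro mult_right_mono mult_left_mono) auto
    then have "(k2 x1 x2)\<^sup>2 \<le> (4 * 1 * jb x2 powr (- (5 * b)))\<^sup>2" by (rule power_mono) (rule k1)
    then show "(k2 x1 x2)\<^sup>2 \<le> 16 * (jb x2 powr (- (5 * b)))\<^sup>2" by (simp add: power_mult_distrib)
    have "k2 x1 x2 \<le> 4 * jb x1 powr (- (4 * b - 1)) * 1"
      unfolding k2_def using b jb_powr_neg_le_1[of "5 * b" x2] by (intro mult_left_mono) auto
    then have "(k2 x1 x2)\<^sup>2 \<le> (4 * jb x1 powr (- (4 * b - 1)) * 1)\<^sup>2" by (rule power_mono) (rule k1)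
    then show "(k2 x1 x2)\<^sup>2 \<le> 16 * (jb x1 powr (- (4 * b - 1)))\<^sup>2" by (simp add: power_mult_distrib)
  qed
  have e16: "ennreal u \<le> ennreal 16 * ennreal v" if "u \<le> 16 * v" "0 \<le> v" for u v
    using that by (subst ennreal_mult[symmetric]) (auto intro: ennreal_leI)
  have i2: "(\<integral>\<^sup>+\<eta>. ennreal ((k2 \<xi> \<eta>)\<^sup>2) \<partial>lborel) \<le> ennreal (16 * C2)" for \<xi>
  proof -
    have "(\<integral>\<^sup>+\<eta>. ennreal ((k2 \<xi> \<eta>)\<^sup>2) \<partial>lborel) \<le> (\<integral>\<^sup>+\<eta>. ennreal 16 * ennreal ((jb \<eta> powr (- (5 * b)))\<^sup>2) \<partial>lborel)"
      by (intro nn_integral_mono e16 k2le) auto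
    also have "\<dots> = ennreal 16 * (\<integral>\<^sup>+\<eta>. ennreal ((jb \<eta> powr (- (5 * b)))\<^sup>2) \<partial>lborel)" by (rule nn_integral_cmult) auto
    also have "\<dots> \<le> ennreal 16 * ennreal C2" by (intro mult_left_mono C2) auto
    finally show ?thesis using C2 by (simp add: ennreal_mult)
  qed
  have i2': "(\<integral>\<^sup>+\<eta>. ennreal ((k2 \<eta> (\<xi> - \<eta>))\<^sup>2) \<partial>lborel) \<le> ennreal (16 * C3)"
    "(\<integral>\<^sup>+\<eta>. ennreal ((k2 \<eta> \<xi>)\<^sup>2) \<partial>lborel) \<le> ennreal (16 * C3)" for \<xi>
  proof -
    have *: "(\<integral>\<^sup>+\<eta>. ennreal 16 * ennreal ((jb \<eta> powr (- (4 * b - 1)))\<^sup>2) \<partial>lborel) \<le> ennreal (16 * C3)"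
    proof -
      have "(\<integral>\<^sup>+\<eta>. ennreal 16 * ennreal ((jb \<eta> powr (- (4 * b - 1)))\<^sup>2) \<partial>lborel) = ennreal 16 * (\<integral>\<^sup>+\<eta>. ennreal ((jb \<eta> powr (- (4 * b - 1)))\<^sup>2) \<partial>lborel)"
        by (rule nn_integral_cmult) auto
      also have "\<dots> \<le> ennreal 16 * ennreal C3" by (intro mult_left_mono C3) auto
      finally show ?thesis using C3 by (simp add: ennreal_mult)
    qed
    show "(\<integral>\<^sup>+\<eta>. ennreal ((k2 \<eta> (\<xi> - \<eta>))\<^sup>2) \<partial>lborel) \<le> ennreal (16 * C3)"
      "(\<integral>\<^sup>+\<eta>. ennreal ((k2 \<eta> \<xi>)\<^sup>2) \<partial>lborel) \<le> ennreal (16 * C3)"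
      by (intro order_trans[OF nn_integral_mono *] e16 k2le, simp)+
  qed
  have B1: "bdd_mult (\<lambda>a c. k1 (snd a) (snd c) * md a powr (- b) * md c powr (- b))"
    using b C1 i1 by (intro bdd_mult_fibre) auto
  have B2: "bdd_mult (\<lambda>a c. k2 (snd a) (snd c) * md a powr (- b) * md c powr (- b))"
    using b C3 i2' by (intro bdd_mult_fibre[where C="16 * C3"]) auto
  have B3: "bdd_mult (\<lambda>a c. k2 (snd a) (snd c) * md (a + c) powr (- b) * md c powr (- b))"
    using b C2 i2 by (intro bdd_mult_fibre_out1[where C="16 * C2"]) auto
  have B4: "bdd_mult (\<lambda>a c. k2 (snd a) (snd c) * md (a + c) powr (- b) * md a powr (- b))"
    using b C3 i2' by (intro bdd_mult_fibre_out2[where C="16 * C3"]) auto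
  have B5: "bdd_mult (low_mult b \<alpha>)"
    using b \<alpha> by (intro bdd_mult_low) auto
  let ?k1 = "\<lambda>a c. k1 (snd a) (snd c)" and ?k2 = "\<lambda>a c. k2 (snd a) (snd c)"
  show "bdd_mult (\<lambda>a c. if \<bar>snd c\<bar> \<le> \<bar>snd a\<bar> then kawahara_mult (5 * b) b \<alpha> a c else 0)"
  \<comment> \<open>The bounds \<open>kaw\<close>, \<open>T1\<close> and \<open>T2\<close> below
    give 2 * 128 + 2 * 1024 = 2304 for \<open>P1\<close> and 16 for each other term; 3000 covers
    them all.\<close>
  proof (rule bdd_mult_mono[OF bdd_mult_cmult[OF bdd_mult_add[OF B1 bdd_mult_add[OF B2 bdd_mult_add[OF B3 bdd_mult_add[OF B4 B5]]]], of 3000]])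
    show "(\<lambda>(a, c). if \<bar>snd c\<bar> \<le> \<bar>snd a\<bar> then kawahara_mult (5 * b) b \<alpha> a c else 0) \<in> borel_measurable (borel \<Otimes>\<^sub>M borel)"
      by measurable
    fix a c :: "real \<times> real"
    assume nz: "snd a \<noteq> 0" "snd c \<noteq> 0"
    define x1 x2 where "x1 = snd a" and "x2 = snd c"
    define L L1 L2 where "L = md (a + c)" and "L1 = md a" and "L2 = md c"
    define X where "X = \<bar>x1 + x2\<bar>"
    have L: "1 \<le> L" "1 \<le> L1" "1 \<le> L2" unfolding L_def L1_def L2_def by (rule md_ge_1)+
    have L1_le: "L powr (- b) \<le> 1" using L b powr_mono[of "- b" 0 L] by simp
    have x: "snd a = x1" "snd c = x2" "snd a + snd c = x1 + x2" by (simp_all add: x1_def x2_def)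
    define P1 where "P1 = k1 x1 x2 * L1 powr (- b) * L2 powr (- b)"
    define P2 where "P2 = k2 x1 x2 * L1 powr (- b) * L2 powr (- b)"
    define P3 where "P3 = k2 x1 x2 * L powr (- b) * L2 powr (- b)"
    define P4 where "P4 = k2 x1 x2 * L powr (- b) * L1 powr (- b)"
    have nn: "0 \<le> P1" "0 \<le> P2" "0 \<le> P3" "0 \<le> P4" "0 \<le> low_mult b \<alpha> a c"
      using k1 low_mult_nonneg by (auto simp: P1_def P2_def P3_def P4_def)
    show "(if \<bar>snd c\<bar> \<le> \<bar>snd a\<bar> then kawahara_mult (5 * b) b \<alpha> a c else 0) \<le>
       3000 * (?k1 a c * md a powr (- b) * md c powr (- b) + (?k2 a c * md a powr (- b) * md c powr (- b) +
         (?k2 a c * md (a + c) powr (- b) * md c powr (- b) + (?k2 a c * md (a + c) powr (- b) * md a powr (- b) + low_mult b \<alpha> a c))))"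
      unfolding x L_def[symmetric] L1_def[symmetric] L2_def[symmetric] P1_def[symmetric] P2_def[symmetric] P3_def[symmetric] P4_def[symmetric]
    proof (cases "\<bar>x2\<bar> \<le> \<bar>x1\<bar>")
      case False
      then show "(if \<bar>x2\<bar> \<le> \<bar>x1\<bar> then kawahara_mult (5 * b) b \<alpha> a c else 0) \<le> 3000 * (P1 + (P2 + (P3 + (P4 + low_mult b \<alpha> a c))))"
        using nn by simp
    next
      case le: True
      let ?W = "winv (5 * b) b \<alpha> a * winv (5 * b) b \<alpha> c"
      have W: "0 \<le> ?W" by simp
      have X2: "X \<le> 2 * \<bar>x1\<bar>" unfolding X_def using le by linarith
      have X0: "0 \<le> X" by (simp add: X_def)
      \<comment> \<open>At low frequencies too the weight of the high ones may be used, at the cost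
        of a constant: brackets are at most 2 there, and \<alpha> exceeds b.\<close>
      have w_le: "winv (5 * b) b \<alpha> z \<le> 8 * (jb (snd z) powr (- (5 * b)) * md z powr (- b))" for z
      proof (cases "\<bar>snd z\<bar> \<le> 1")
        case True
        then have "jb (snd z) \<le> 2" using jb_le[of "snd z"] by linarith
        then have "jb (snd z) powr (5 * b) \<le> 2 powr (5 * b)" using b by (intro powr_mono2) auto
        also have "\<dots> \<le> 8" using two_powr_5b_le b by blast
        finally have "1 \<le> 8 / jb (snd z) powr (5 * b)" by (subst pos_le_divide_eq) auto
        then have "1 \<le> 8 * jb (snd z) powr (- (5 * b))" by (simp only: powr_minus divide_inverse)
        moreover have "md z powr (- \<alpha>) \<le> md z powr (- b)" using b \<alpha> md_ge_1[of z] by (intro powr_mono) auto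
        ultimately have "1 * md z powr (- \<alpha>) \<le> 8 * jb (snd z) powr (- (5 * b)) * md z powr (- b)"
          by (intro mult_mono) auto
        then show ?thesis using True by (simp add: winv_def)
      qed (auto simp: winv_def)
      have T1: "X * ?W \<le> 128 * P1"
      proof -
        have "X \<le> 2 * jb x1 * jb x2"
        proof -
          have "X \<le> 1 * jb x1 + jb x2 * 1" unfolding X_def using abs_le_jb[of x1] abs_le_jb[of x2] by linarith
          also have "\<dots> \<le> jb x2 * jb x1 + jb x2 * jb x1" by (intro add_mono mult_mono jb_ge_1) auto
          finally show ?thesis by simp
        qed
        moreover have "?W \<le> (8 * (jb x1 powr (- (5 * b)) * L1 powr (- b))) * (8 * (jb x2 powr (- (5 * b)) * L2 powr (- b)))"
          using w_le[of a] w_le[of c] unfolding x L1_def L2_def by (intro mult_mono) auto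
        ultimately have "X * ?W \<le> (2 * jb x1 * jb x2) * ((8 * (jb x1 powr (- (5 * b)) * L1 powr (- b))) * (8 * (jb x2 powr (- (5 * b)) * L2 powr (- b))))"
          by (rule mult_mono) (use X0 in auto)
        also have "\<dots> = 128 * ((jb x1 * jb x1 powr (- (5 * b))) * (jb x2 * jb x2 powr (- (5 * b))) * L1 powr (- b) * L2 powr (- b))"
          by (simp add: mult_ac)
        also have "\<dots> = 128 * P1"
        proof -
          have "jb y * jb y powr (- (5 * b)) = jb y powr (- (5 * b - 1))" for y
            using powr_add[of "jb y" 1 "- (5 * b)"] by (simp add: less_imp_neq[symmetric])
          then show ?thesis by (simp add: P1_def k1_def)
        qed
        finally show ?thesis .
      qed
      \<comment> \<open>Here \<open>s = 5 b\<close> enters: \<tau> is the sum of the modulation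
        argument and \<xi>^5, and the b-th power of the first is cancelled exactly by the output
        modulation factor.\<close>
      have tau: "jb (fst a + fst c) powr b * L powr (- b) \<le> 2 * (1 + X powr (5 * b) * L powr (- b))"
      proof -
        let ?M = "max L (X ^ 5)"
        have "jb (fst a + fst c) \<le> L + \<bar>(x1 + x2) ^ 5\<bar>"
          using jb_add_abs[of "fst a + fst c - (x1 + x2) ^ 5" "(x1 + x2) ^ 5"] by (simp add: L_def md_def x1_def x2_def)
        also have "\<dots> \<le> 2 * ?M" by (simp add: X_def power_abs)
        finally have "jb (fst a + fst c) powr b \<le> (2 * ?M) powr b" using b by (intro powr_mono2) auto
        also have "\<dots> = 2 powr b * ?M powr b" using L by (simp add: powr_mult)
        also have "\<dots> \<le> 2 * (L powr b + X powr (5 * b))"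
        proof (rule mult_mono)
          show "2 powr b \<le> (2::real)" using b powr_mono[of b 1 2] by simp
          have "(X ^ 5) powr b = X powr (5 * b)"
            using X0 powr_realpow[of X 5] by (cases "X = 0") (auto simp: powr_powr simp del: powr_numeral simp flip: powr_numeral)
          then show "?M powr b \<le> L powr b + X powr (5 * b)" by (auto simp: max_def)
        qed auto
        finally have "jb (fst a + fst c) powr b * L powr (- b) \<le> 2 * (L powr b + X powr (5 * b)) * L powr (- b)"
          by (rule mult_right_mono) auto
        also have "\<dots> = 2 * (L powr b * L powr (- b) + X powr (5 * b) * L powr (- b))" by (simp add: algebra_simps)
        also have "L powr b * L powr (- b) = 1" using L by (simp add: powr_minus)
        finally show ?thesis .
      qed
      have kaw: "kawahara_mult (5 * b) b \<alpha> a c \<le> 2 * (X * ?W) + 2 * (X powr (5 * b) * L powr (- b) * (X * ?W))"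
      proof -
        have "kawahara_mult (5 * b) b \<alpha> a c = (X * ?W) * (jb (fst a + fst c) powr b * L powr (- b))"
          by (simp add: kawahara_mult_def X_def L_def x1_def x2_def mult_ac)
        also have "\<dots> \<le> (X * ?W) * (2 * (1 + X powr (5 * b) * L powr (- b)))"
          using X0 W by (intro mult_left_mono tau) auto
        finally show ?thesis by (simp add: algebra_simps)
      qed
      have T2: "X powr (5 * b) * L powr (- b) * (X * ?W) \<le> 1024 * P1 + 8 * low_mult b \<alpha> a c + 8 * (P2 + P3 + P4)"
      proof (cases "\<bar>x1\<bar> \<le> 1 \<or> X = 0")
        case True
        then have "X powr (5 * b) \<le> 8"
        proof
          assume "\<bar>x1\<bar> \<le> 1"
          then have "X powr (5 * b) \<le> 2 powr (5 * b)" using X2 X0 b by (intro powr_mono2) auto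
          with two_powr_5b_le[OF b(2)] show ?thesis by linarith
        qed simp
        then have "X powr (5 * b) * L powr (- b) * (X * ?W) \<le> 8 * 1 * (X * ?W)"
          using L1_le X0 W by (intro mult_right_mono mult_mono) auto
        with T1 nn show ?thesis by simp
      next
        \<comment> \<open>The output weight is at most a multiple of that of the larger input, so
          the two cancel. The smaller input then decides: a low frequency gives
          \<open>low_mult\<close>, a high one goes through the resonance.\<close>
        case False
        then have x1: "1 < \<bar>x1\<bar>" and Xpos: "0 < X" using X0 by auto
        have "X powr (5 * b) \<le> (2 * \<bar>x1\<bar>) powr (5 * b)" using X2 X0 b by (intro powr_mono2) auto
        also have "\<dots> = 2 powr (5 * b) * \<bar>x1\<bar> powr (5 * b)" by (simp add: powr_mult)
        also have "\<dots> \<le> 8 * jb x1 powr (5 * b)"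
          using two_powr_5b_le[OF b(2)] b by (intro mult_mono powr_mono2 abs_le_jb) auto
        finally have "X powr (5 * b) * winv (5 * b) b \<alpha> a \<le> 8 * jb x1 powr (5 * b) * (jb x1 powr (- (5 * b)) * L1 powr (- b))"
          using x1 by (simp add: winv_def x L1_def)
        also have "\<dots> = 8 * L1 powr (- b)" by (simp add: powr_minus)
        finally have "(X powr (5 * b) * winv (5 * b) b \<alpha> a) * (L powr (- b) * X * winv (5 * b) b \<alpha> c) \<le> 8 * L1 powr (- b) * (L powr (- b) * X * winv (5 * b) b \<alpha> c)"
          using X0 by (intro mult_right_mono) auto
        then have main: "X powr (5 * b) * L powr (- b) * (X * ?W) \<le> 8 * (X * L powr (- b) * L1 powr (- b) * winv (5 * b) b \<alpha> c)"
          by (simp add: mult_ac)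
        show ?thesis
        proof (cases "\<bar>x2\<bar> \<le> 1")
          case True
          then have "X * L powr (- b) * L1 powr (- b) * winv (5 * b) b \<alpha> c = low_mult b \<alpha> a c"
            using x1 by (simp add: low_mult_def winv_def x X_def L_def L1_def L2_def)
          with main nn show ?thesis by simp
        next
          case False
          have e: "X * L powr (- b) * L1 powr (- b) * winv (5 * b) b \<alpha> c = (X * jb x2 powr (- (5 * b))) * L powr (- b) * L1 powr (- b) * L2 powr (- b)"
            using False by (simp add: winv_def x L2_def mult_ac)
          let ?Q = "X * \<bar>x1\<bar> ^ 3 * \<bar>x2\<bar> / 2"
          have "(X * jb x2 powr (- (5 * b))) * L powr (- b) * L1 powr (- b) * L2 powr (- b) \<le>
             k2 x1 x2 * L1 powr (- b) * L2 powr (- b) + k2 x1 x2 * L powr (- b) * L2 powr (- b) + k2 x1 x2 * L powr (- b) * L1 powr (- b)"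
          proof (rule dominant_split[OF L, where Q="?Q" and u=b])
            show "0 < ?Q" using Xpos x1 False by auto
            have "X * ?Q powr (- b) \<le> 2 * \<bar>x1\<bar> powr (1 - 4 * b) * \<bar>x2\<bar> powr (- b)"
              using Xpos x1 False X2 b by (intro resonance_gain) auto
            also have "\<dots> \<le> 2 * (2 * jb x1 powr (- (4 * b - 1))) * 1"
            proof (intro mult_mono order_refl)
              have "\<bar>x1\<bar> powr (- (4 * b - 1)) \<le> (jb x1 / 2) powr (- (4 * b - 1))"
                using b x1 jb_le_2abs[of x1] by (intro powr_neg_antimono) auto
              also have "\<dots> = 2 powr (4 * b - 1) * jb x1 powr (- (4 * b - 1))"
                using b by (simp only: powr_divide powr_minus jb_nonneg) (simp add: field_simps)
              also have "\<dots> \<le> 2 * jb x1 powr (- (4 * b - 1))"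
                using b powr_mono[of "4 * b - 1" 1 2] by (intro mult_right_mono) auto
              finally show "\<bar>x1\<bar> powr (1 - 4 * b) \<le> 2 * jb x1 powr (- (4 * b - 1))" by simp
              show "\<bar>x2\<bar> powr (- b) \<le> 1" using False b powr_mono[of "- b" 0 "\<bar>x2\<bar>"] by (auto split: if_splits)
            qed auto
            finally have "X * ?Q powr (- b) * jb x2 powr (- (5 * b)) \<le> 2 * (2 * jb x1 powr (- (4 * b - 1))) * 1 * jb x2 powr (- (5 * b))"
              by (rule mult_right_mono) auto
            then show "X * jb x2 powr (- (5 * b)) * ?Q powr (- b) \<le> k2 x1 x2"
              by (simp add: k2_def mult_ac)
            show "?Q \<le> L \<or> ?Q \<le> L1 \<or> ?Q \<le> L2"
              using resonance[of a c] by (simp add: X_def x L_def L1_def L2_def)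
          qed (use X0 b in auto)
          with main nn show ?thesis unfolding e by (simp add: P2_def P3_def P4_def)
        qed
      qed
      show "(if \<bar>x2\<bar> \<le> \<bar>x1\<bar> then kawahara_mult (5 * b) b \<alpha> a c else 0) \<le> 3000 * (P1 + (P2 + (P3 + (P4 + low_mult b \<alpha> a c))))"
        using le kaw T1 T2 nn by simp
    qed
  qed simp
qed (auto intro: kawahara_mult_commute kawahara_mult_nonneg)

section \<open>The endpoint \<open>s = - 7/4\<close>, \<open>b > 1/2\<close>\<close>

text \<open>All three terms of the phase have the sign of \<open>\<xi>\<close>, so nothing cancels
  and the value at \<open>z = 0\<close> is the least in modulus.\<close>

lemma phase_ge: "\<bar>\<xi>\<bar> ^ 5 / 16 \<le> \<bar>phase \<xi> z\<bar>"
proof -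
  define G where "G = \<xi> ^ 4 / 16 + 5 / 2 * \<xi>\<^sup>2 * z\<^sup>2 + 5 * z ^ 4"
  have "phase \<xi> z = \<xi> * G"
    by (simp add: phase_def G_def eval_nat_numeral field_simps)
  moreover have G: "\<xi> ^ 4 / 16 \<le> G" "0 \<le> G" by (simp_all add: G_def)
  ultimately have "\<bar>\<xi>\<bar> * (\<xi> ^ 4 / 16) \<le> \<bar>phase \<xi> z\<bar>"
    by (simp only: abs_mult abs_of_nonneg mult_left_mono abs_ge_zero)
  moreover have "\<bar>\<xi>\<bar> * (\<xi> ^ 4 / 16) = \<bar>\<xi>\<bar> ^ 5 / 16"
    by (simp add: eval_nat_numeral abs_mult[symmetric])
  ultimately show ?thesis by simp
qed

text \<open>A small \<tau> makes two modulations large at once. That of the output is then close to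
  X^5; the modulation arguments of the inputs add up to \<tau> minus the phase, and the phase is at
  least X^5 / 16 in modulus.\<close>

lemma small_tau_modulations:
  fixes a c :: "real \<times> real"
  defines "X \<equiv> \<bar>snd a + snd c\<bar>"
  assumes "jb (fst a + fst c) < X ^ 5 / 32"
  shows "X ^ 5 / 64 \<le> md (a + c)" "X ^ 5 / 64 \<le> md a \<or> X ^ 5 / 64 \<le> md c"
proof -
  have t: "\<bar>fst a + fst c\<bar> < X ^ 5 / 32" using abs_le_jb[of "fst a + fst c"] assms(2) by linarith
  have X5: "\<bar>(snd a + snd c) ^ 5\<bar> = X ^ 5" by (simp add: X_def power_abs)
  have "X ^ 5 - \<bar>fst a + fst c\<bar> \<le> \<bar>fst a + fst c - (snd a + snd c) ^ 5\<bar>" unfolding X5[symmetric] by linarith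
  also have "\<dots> \<le> md (a + c)" using abs_le_jb[of "fst a + fst c - (snd a + snd c) ^ 5"] by (simp add: md_def)
  finally show "X ^ 5 / 64 \<le> md (a + c)" using t by linarith
  have "(snd a) ^ 5 + (snd c) ^ 5 = phase (snd a + snd c) (snd a - (snd a + snd c) / 2)"
    using phase_eq[of "snd a" "snd a + snd c"] by simp
  then have "X ^ 5 / 16 \<le> \<bar>(snd a) ^ 5 + (snd c) ^ 5\<bar>" unfolding X_def using phase_ge by simp
  also have "\<dots> \<le> \<bar>fst a + fst c\<bar> + (\<bar>fst a - snd a ^ 5\<bar> + \<bar>fst c - snd c ^ 5\<bar>)" by linarith
  also have "\<dots> \<le> \<bar>fst a + fst c\<bar> + (md a + md c)"
    unfolding md_def by (intro add_left_mono add_mono abs_le_jb)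
  \<comment> \<open>The inputs share at least 1/16 - 1/32 = 1/32 of X^5, so one of them has
    1/64.\<close>
  finally show "X ^ 5 / 64 \<le> md a \<or> X ^ 5 / 64 \<le> md c" using t by linarith
qed

lemma powr_half_gain:
  fixes X M u :: real
  assumes "0 < X" "X ^ 5 / 64 \<le> M" "1 \<le> M" "1 / 2 \<le> u"
  shows "M powr (- u) \<le> 8 * X powr (- 5 / 2)"
proof -
  have X5: "X ^ 5 = X powr 5" using powr_realpow[of X 5] assms by simp
  have "M powr (- u) \<le> M powr (- (1 / 2))" using assms by (intro powr_mono) auto
  also have "\<dots> \<le> (X ^ 5 / 64) powr (- (1 / 2))" using assms by (intro powr_neg_antimono) auto
  also have "\<dots> = (X powr 5) powr (- (1 / 2)) * 64 powr (1 / 2)"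
    unfolding X5[symmetric] using assms by (simp only: powr_divide powr_minus) (simp add: field_simps)
  also have "(X powr 5) powr (- (1 / 2)) = X powr (- 5 / 2)" by (simp add: powr_powr del: powr_numeral)
  also have "64 powr (1 / 2) = (8::real)" by (simp add: powr_half_sqrt real_sqrt_eq_iff[of 64 "8^2", simplified])
  finally show ?thesis by simp
qed

text \<open>7/20 is \<open>- s / 5\<close> at \<open>s = - 7/4\<close>: for negative
  \<open>s\<close> the output weight is a gain, and when \<tau> is at least of order X^5 it
  compensates one input weight at frequency X.\<close>

lemma tau_gain:
  fixes X T :: real
  assumes "0 < X" "X ^ 5 / 32 \<le> T"
  shows "T powr (- 7 / 20) \<le> 4 * X powr (- 7 / 4)"
proof -
  have X5: "X ^ 5 = X powr 5" using powr_realpow[of X 5] assms by simp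
  have "T powr (- (7 / 20)) \<le> (X ^ 5 / 32) powr (- (7 / 20))" using assms by (intro powr_neg_antimono) auto
  also have "\<dots> = (X powr 5) powr (- (7 / 20)) * 32 powr (7 / 20)"
    unfolding X5[symmetric] using assms by (simp only: powr_divide powr_minus) (simp add: field_simps)
  also have "(X powr 5) powr (- (7 / 20)) = X powr (- 7 / 4)" by (simp add: powr_powr del: powr_numeral)
  finally have 1: "T powr (- (7 / 20)) \<le> X powr (- 7 / 4) * 32 powr (7 / 20)" .
  have "32 powr (7 / 20) \<le> (4::real)"
  proof -
    have "32 powr (7 / 20) = (2 powr 5) powr (7 / 20 :: real)" by (rule arg_cong[where f="\<lambda>y. y powr (7 / 20)"]) simp
    also have "\<dots> = 2 powr (7 / 4)" by (simp only: powr_powr) simp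
    also have "\<dots> \<le> 2 powr 2" by (rule powr_mono) auto
    finally show ?thesis by (simp add: powr_realpow[of 2 2, simplified])
  qed
  then have "X powr (- 7 / 4) * 32 powr (7 / 20) \<le> X powr (- 7 / 4) * 4" by (rule mult_left_mono) auto
  with 1 show ?thesis by simp
qed

lemma powr_le_const:
  fixes y Y c C p :: real
  assumes "0 \<le> y" "y \<le> c * Y" "0 \<le> c" "0 \<le> p" "c powr p \<le> C"
  shows "y powr p \<le> C * Y powr p"
proof (cases "0 \<le> Y")
  case True
  have "y powr p \<le> (c * Y) powr p" using assms by (intro powr_mono2) auto
  also have "\<dots> = c powr p * Y powr p" using assms True by (simp add: powr_mult)
  also have "\<dots> \<le> C * Y powr p" using assms by (intro mult_right_mono) auto
  finally show ?thesis .
next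
  case False
  then have "c * Y \<le> 0" using assms by (simp add: mult_nonneg_nonpos)
  then have "y = 0" using assms by linarith
  moreover have "0 \<le> C" using assms by (meson order_trans powr_ge_zero)
  ultimately show ?thesis by simp
qed

lemma powr_7_4_bounds: "2 powr (7 / 4) \<le> (4 :: real)" "3 powr (7 / 4) \<le> (9 :: real)" "4 powr (7 / 4) \<le> (16 :: real)" "5 powr (7 / 4) \<le> (25 :: real)"
  using powr_mono[of "7 / 4" 2 "2::real"] powr_mono[of "7 / 4" 2 "3::real"] powr_mono[of "7 / 4" 2 "4::real"] powr_mono[of "7 / 4" 2 "5::real"]
  by (simp_all add: power2_eq_square)

text \<open>At this endpoint \<open>b\<close> exceeds 1/2 and \<alpha> may lie on either side of it;
  the minimum is a common exponent which is still above 1/2.\<close>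

lemma winv_lower_le:
  assumes "\<bar>snd z\<bar> \<le> 2"
  shows "winv (- 7 / 4) b \<alpha> z \<le> 9 * md z powr (- min b \<alpha>)"
proof (cases "\<bar>snd z\<bar> \<le> 1")
  case True
  have "md z powr (- \<alpha>) \<le> md z powr (- min b \<alpha>)" using md_ge_1[of z] by (intro powr_mono) auto
  with True show ?thesis using powr_ge_zero[of "md z" "- min b \<alpha>"] unfolding winv_def by (simp, linarith)
next
  case False
  have "jb (snd z) powr (7 / 4) \<le> 9 * 1 powr (7 / 4)"
    using jb_le[of "snd z"] assms powr_7_4_bounds by (intro powr_le_const[where c=3]) auto
  moreover have "md z powr (- b) \<le> md z powr (- min b \<alpha>)" using md_ge_1[of z] by (intro powr_mono) auto
  ultimately have "jb (snd z) powr (7 / 4) * md z powr (- b) \<le> 9 * md z powr (- min b \<alpha>)"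
    by (intro mult_mono) auto
  with False show ?thesis by (simp add: winv_def)
qed

text \<open>\<open>hhl\<close> and \<open>hlh\<close> are what remains of the multiplier, after the gain from the resonance, for inputs of high
  frequencies with an output of low frequency, respectively for the other interactions of two high frequencies. In
  \<open>hhl\<close> the gain is exactly compensated by the derivative of the phase, whence the bound \<open>- 7/4\<close>.\<close>

definition hhl :: "real \<Rightarrow> real \<Rightarrow> real" where
  "hhl x1 x2 = (if \<bar>x2\<bar> \<le> \<bar>x1\<bar> \<and> 4 * \<bar>x1 + x2\<bar> < \<bar>x2\<bar> then 2 * sqrt (\<bar>x1 + x2\<bar> * \<bar>x1\<bar> ^ 3) else 0)"

definition hlh :: "real \<Rightarrow> real \<Rightarrow> real" where
  "hlh x1 x2 = (if 1 < \<bar>x2\<bar> \<and> \<bar>x2\<bar> \<le> \<bar>x1\<bar> \<and> \<bar>x2\<bar> \<le> 4 * \<bar>x1 + x2\<bar> then 2 * \<bar>x1\<bar> powr (- 1) * \<bar>x2\<bar> powr (5 / 4) else 0)"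

lemma hhl_square: "(hhl x1 x2)\<^sup>2 = (if \<bar>x2\<bar> \<le> \<bar>x1\<bar> \<and> 4 * \<bar>x1 + x2\<bar> < \<bar>x2\<bar> then 4 * (\<bar>x1 + x2\<bar> * \<bar>x1\<bar> ^ 3) else 0)"
  by (simp add: hhl_def power_mult_distrib)

lemma phase_weight_ge: "\<bar>\<xi>\<bar> ^ 3 * \<bar>z\<bar> \<le> phase_weight \<xi> z" "\<bar>\<xi>\<bar> * \<bar>z\<bar> ^ 3 \<le> phase_weight \<xi> z"
  "1 / 4 \<le> \<bar>\<xi>\<bar> \<Longrightarrow> sqrt \<bar>\<xi>\<bar> \<le> phase_weight \<xi> z"
  by (auto simp: phase_weight_def)

text \<open>In this region \<open>x1\<close> is close to \<open>- x2\<close>, and the same quantity,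
  output frequency times |x1|^3, is below the derivative of the phase on all three fibres. With the
  output fixed, the term cubic in \<open>z\<close> is used, as |z| is of size |x1|; with an input
  fixed, the term linear in \<open>z\<close>, as |z| is at least the output frequency.\<close>

lemma hhl_phase:
  "(hhl x1 x2)\<^sup>2 \<le> 64 * phase_weight (x1 + x2) ((x1 - x2) / 2)"
  "(hhl x1 x2)\<^sup>2 \<le> 64 * phase_weight x1 (x2 + x1 / 2)"
  "(hhl x1 x2)\<^sup>2 \<le> 64 * phase_weight x2 (x1 + x2 / 2)"
proof -
  define X where "X = \<bar>x1 + x2\<bar>"
  have *: "(hhl x1 x2)\<^sup>2 \<le> 64 * phase_weight \<xi> z" if "\<bar>x2\<bar> \<le> \<bar>x1\<bar> \<Longrightarrow> 4 * X < \<bar>x2\<bar> \<Longrightarrow> 4 * (X * \<bar>x1\<bar> ^ 3) \<le> 64 * phase_weight \<xi> z" for \<xi> z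
    using that phase_weight_nonneg[of \<xi> z] unfolding hhl_square X_def by auto
  show "(hhl x1 x2)\<^sup>2 \<le> 64 * phase_weight (x1 + x2) ((x1 - x2) / 2)"
  proof (rule *)
    assume h: "\<bar>x2\<bar> \<le> \<bar>x1\<bar>" "4 * X < \<bar>x2\<bar>"
    then have "\<bar>x1\<bar> / 2 \<le> \<bar>(x1 - x2) / 2\<bar>" unfolding X_def by (auto simp: abs_if split: if_splits)
    then have "(\<bar>x1\<bar> / 2) ^ 3 \<le> \<bar>(x1 - x2) / 2\<bar> ^ 3" by (rule power_mono) auto
    then have "X * (\<bar>x1\<bar> / 2) ^ 3 \<le> X * \<bar>(x1 - x2) / 2\<bar> ^ 3" by (rule mult_left_mono) (simp add: X_def)
    also have "\<dots> \<le> phase_weight (x1 + x2) ((x1 - x2) / 2)"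
      unfolding X_def by (rule phase_weight_ge)
    finally show "4 * (X * \<bar>x1\<bar> ^ 3) \<le> 64 * phase_weight (x1 + x2) ((x1 - x2) / 2)"
      using phase_weight_nonneg[of "x1 + x2" "(x1 - x2) / 2"] by (simp add: power_divide)
  qed
  show "(hhl x1 x2)\<^sup>2 \<le> 64 * phase_weight x1 (x2 + x1 / 2)"
  proof (rule *)
    assume h: "\<bar>x2\<bar> \<le> \<bar>x1\<bar>" "4 * X < \<bar>x2\<bar>"
    then have "X \<le> \<bar>x2 + x1 / 2\<bar>" unfolding X_def by (auto simp: abs_if split: if_splits)
    then have "\<bar>x1\<bar> ^ 3 * X \<le> \<bar>x1\<bar> ^ 3 * \<bar>x2 + x1 / 2\<bar>" by (rule mult_left_mono) simp
    also have "\<dots> \<le> phase_weight x1 (x2 + x1 / 2)" by (rule phase_weight_ge)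
    finally show "4 * (X * \<bar>x1\<bar> ^ 3) \<le> 64 * phase_weight x1 (x2 + x1 / 2)"
      using phase_weight_nonneg[of x1 "x2 + x1 / 2"] by (simp add: mult.commute)
  qed
  show "(hhl x1 x2)\<^sup>2 \<le> 64 * phase_weight x2 (x1 + x2 / 2)"
  proof (rule *)
    assume h: "\<bar>x2\<bar> \<le> \<bar>x1\<bar>" "4 * X < \<bar>x2\<bar>"
    then have X: "X \<le> \<bar>x1 + x2 / 2\<bar>" and "\<bar>x1\<bar> \<le> 2 * \<bar>x2\<bar>" unfolding X_def by (auto simp: abs_if split: if_splits)
    then have "\<bar>x1\<bar> ^ 3 \<le> (2 * \<bar>x2\<bar>) ^ 3" by (intro power_mono) auto
    then have "\<bar>x1\<bar> ^ 3 * X \<le> (2 * \<bar>x2\<bar>) ^ 3 * \<bar>x1 + x2 / 2\<bar>" using X by (intro mult_mono) (auto simp: X_def)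
    also have "\<dots> = 8 * (\<bar>x2\<bar> ^ 3 * \<bar>x1 + x2 / 2\<bar>)" by (simp add: power_mult_distrib)
    also have "\<dots> \<le> 8 * phase_weight x2 (x1 + x2 / 2)" by (intro mult_left_mono phase_weight_ge) simp
    finally show "4 * (X * \<bar>x1\<bar> ^ 3) \<le> 64 * phase_weight x2 (x1 + x2 / 2)"
      using phase_weight_nonneg[of x2 "x1 + x2 / 2"] by (simp add: mult.commute)
  qed
qed

text \<open>On the fibres used here the centred variable may vanish, so the square root term of the
  weight is needed. The square of \<open>hlh\<close> is at most
  \<open>4 * sqrt \<bar>x2\<bar>\<close>, and in its support each of the three frequencies is at
  least |x2| / 4; with |x2| > 1 this explains the threshold 1/4 in
  \<open>phase_weight\<close>.\<close>

lemma hlh_phase: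
  "(hlh x1 x2)\<^sup>2 \<le> 64 * phase_weight (x1 + x2) ((x1 - x2) / 2)"
  "(hlh x1 x2)\<^sup>2 \<le> 64 * phase_weight x1 (x2 + x1 / 2)"
  "(hlh x1 x2)\<^sup>2 \<le> 64 * phase_weight x2 (x1 + x2 / 2)"
proof -
  have *: "(hlh x1 x2)\<^sup>2 \<le> 64 * phase_weight \<xi> z"
    if "1 < \<bar>x2\<bar> \<Longrightarrow> \<bar>x2\<bar> \<le> \<bar>x1\<bar> \<Longrightarrow> \<bar>x2\<bar> \<le> 4 * \<bar>x1 + x2\<bar> \<Longrightarrow> 1 / 4 \<le> \<bar>\<xi>\<bar> \<and> \<bar>x2\<bar> \<le> 5 * \<bar>\<xi>\<bar>" for \<xi> z
  proof (cases "1 < \<bar>x2\<bar> \<and> \<bar>x2\<bar> \<le> \<bar>x1\<bar> \<and> \<bar>x2\<bar> \<le> 4 * \<bar>x1 + x2\<bar>")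
    case False
    then have "hlh x1 x2 = 0" by (auto simp: hlh_def)
    then show ?thesis using phase_weight_nonneg[of \<xi> z] by simp
  next
    case True
    then have \<xi>: "1 / 4 \<le> \<bar>\<xi>\<bar>" "\<bar>x2\<bar> \<le> 5 * \<bar>\<xi>\<bar>" using that by auto
    have "hlh x1 x2 = 2 * \<bar>x1\<bar> powr (- 1) * \<bar>x2\<bar> powr (5 / 4)" using True by (auto simp: hlh_def)
    also have "\<dots> \<le> 2 * \<bar>x2\<bar> powr (- 1) * \<bar>x2\<bar> powr (5 / 4)"
      using True by (intro mult_right_mono mult_left_mono powr_neg_antimono) auto
    also have "\<dots> = 2 * \<bar>x2\<bar> powr (1 / 4)" using powr_add[of "\<bar>x2\<bar>" "- 1" "5 / 4"] by simp
    finally have "hlh x1 x2 \<le> 2 * \<bar>x2\<bar> powr (1 / 4)" .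
    then have "(hlh x1 x2)\<^sup>2 \<le> (2 * \<bar>x2\<bar> powr (1 / 4))\<^sup>2"
      by (rule power_mono) (simp add: hlh_def)
    also have "\<dots> = 4 * sqrt \<bar>x2\<bar>"
      by (simp add: power2_eq_square powr_add[symmetric] powr_half_sqrt)
    also have "\<dots> \<le> 4 * sqrt (25 * \<bar>\<xi>\<bar>)" using \<xi> by (intro mult_left_mono real_sqrt_le_mono) auto
    also have "\<dots> = 20 * sqrt \<bar>\<xi>\<bar>" by (simp add: real_sqrt_mult real_sqrt_eq_iff[of 25 "5^2", simplified])
    also have "\<dots> \<le> 64 * sqrt \<bar>\<xi>\<bar>" by simp
    also have "\<dots> \<le> 64 * phase_weight \<xi> z" using \<xi> by (intro mult_left_mono phase_weight_ge) auto
    finally show ?thesis .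
  qed
  show "(hlh x1 x2)\<^sup>2 \<le> 64 * phase_weight (x1 + x2) ((x1 - x2) / 2)"
    by (rule *; auto simp: abs_if split: if_splits)
  show "(hlh x1 x2)\<^sup>2 \<le> 64 * phase_weight x1 (x2 + x1 / 2)"
    by (rule *; auto simp: abs_if split: if_splits)
  show "(hlh x1 x2)\<^sup>2 \<le> 64 * phase_weight x2 (x1 + x2 / 2)"
    by (rule *; auto simp: abs_if split: if_splits)
qed

lemma nn_integral_indicator_abs:
  fixes r :: real
  assumes "0 \<le> r"
  shows "(\<integral>\<^sup>+\<eta>. ennreal ((if \<bar>\<eta> - c\<bar> \<le> r then k else 0)\<^sup>2) \<partial>lborel) = ennreal (k\<^sup>2 * (2 * r))"
proof -
  have "(\<integral>\<^sup>+\<eta>. ennreal ((if \<bar>\<eta> - c\<bar> \<le> r then k else 0)\<^sup>2) \<partial>lborel) = (\<integral>\<^sup>+\<eta>. ennreal (k\<^sup>2) * indicator {c - r..c + r} \<eta> \<partial>lborel)"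
    by (intro nn_integral_cong) (auto split: split_indicator)
  also have "\<dots> = ennreal (k\<^sup>2) * ennreal (2 * r)"
    using assms by (simp add: nn_integral_cmult_indicator)
  finally show ?thesis using assms by (simp add: ennreal_mult)
qed

text \<open>The input weights grow and must be paid for. If \<tau> is at least of order X^5, the
  output weight compensates one of them; otherwise two modulations are large. For nearly opposite
  high inputs the output weight is of no help, and the resonance with the phase weight must pay for
  everything.\<close>

lemma bdd_mult_lower_endpoint:
  assumes b: "1 / 2 < b" and \<alpha>: "1 / 2 < \<alpha>"
  shows "bdd_mult (kawahara_mult (- 7 / 4) b \<alpha>)"
proof (rule bdd_mult_symmetrize)
  define \<gamma> where "\<gamma> = min b \<alpha>"
  have \<gamma>: "1 / 2 < \<gamma>" "\<gamma> \<le> b" "\<gamma> \<le> \<alpha>" using b \<alpha> by (auto simp: \<gamma>_def)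
  \<comment> \<open>\<open>k1\<close> is for bounded frequencies. \<open>k3\<close> and
    \<open>k5\<close> take the cases where two modulations have been spent and a single one is left:
    \<open>k3\<close> for a low second input, \<open>k5\<close> for comparable frequencies, where
    the power -1/2 balances the length of the fibre.\<close>
  define k1 :: "real \<Rightarrow> real \<Rightarrow> real" where "k1 x1 x2 = (if \<bar>x1 - 0\<bar> \<le> 2 then 1 else 0)" for x1 x2
  define k3 :: "real \<Rightarrow> real \<Rightarrow> real" where "k3 x1 x2 = (if \<bar>x2\<bar> \<le> 1 then 1 else 0)" for x1 x2
  define k5 :: "real \<Rightarrow> real \<Rightarrow> real" where "k5 x1 x2 = (if \<bar>x1 - 0\<bar> \<le> 5 * \<bar>x1 + x2\<bar> then \<bar>x1 + x2\<bar> powr (- 1 / 2) else 0)" for x1 x2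
  have [measurable]: "case_prod k1 \<in> borel_measurable (borel \<Otimes>\<^sub>M borel)" unfolding k1_def by measurable
  have [measurable]: "case_prod k3 \<in> borel_measurable (borel \<Otimes>\<^sub>M borel)" unfolding k3_def by measurable
  have [measurable]: "case_prod k5 \<in> borel_measurable (borel \<Otimes>\<^sub>M borel)" unfolding k5_def by measurable
  have [measurable]: "case_prod hhl \<in> borel_measurable (borel \<Otimes>\<^sub>M borel)" unfolding hhl_def by measurable
  have [measurable]: "case_prod hlh \<in> borel_measurable (borel \<Otimes>\<^sub>M borel)" unfolding hlh_def by measurable
  have i1: "(\<integral>\<^sup>+\<eta>. ennreal ((k1 \<eta> (\<xi> - \<eta>))\<^sup>2) \<partial>lborel) \<le> ennreal 4" for \<xi>
    unfolding k1_def by (subst nn_integral_indicator_abs) auto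
  have i3: "(\<integral>\<^sup>+\<eta>. ennreal ((k3 \<eta> (\<xi> - \<eta>))\<^sup>2) \<partial>lborel) \<le> ennreal 2" for \<xi>
    unfolding k3_def abs_minus_commute[of \<xi>] by (subst nn_integral_indicator_abs) auto
  have i5: "(\<integral>\<^sup>+\<eta>. ennreal ((k5 \<eta> (\<xi> - \<eta>))\<^sup>2) \<partial>lborel) \<le> ennreal 10" for \<xi>
  proof -
    have "(\<bar>\<xi>\<bar> powr (- 1 / 2))\<^sup>2 * (2 * (5 * \<bar>\<xi>\<bar>)) \<le> 10"
    proof (cases "\<xi> = 0")
      case False
      have "(\<bar>\<xi>\<bar> powr (- 1 / 2))\<^sup>2 = \<bar>\<xi>\<bar> powr (- 1)" unfolding power2_eq_square powr_add[symmetric] by simp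
      then show ?thesis using False by (simp add: powr_minus field_simps)
    qed simp
    then show ?thesis
      unfolding k5_def add_diff_cancel_left' add.commute[of _ "\<xi> - _"] diff_add_cancel
      by (subst nn_integral_indicator_abs, simp) (rule ennreal_leI)
  qed
  have B1: "bdd_mult (\<lambda>a c. k1 (snd a) (snd c) * md a powr (- \<gamma>) * md c powr (- \<gamma>))"
    using \<gamma> i1 by (intro bdd_mult_fibre[where C=4]) auto
  \<comment> \<open>With the present \<open>b > 1/2\<close> the singularity at low frequency would
    not be square integrable. As modulations are at least 1, the exponent may be lowered; 2/5 is one
    choice between 1/4 and 1/2.\<close>
  have B2: "bdd_mult (low_mult (2 / 5) \<alpha>)"
    using \<alpha> by (intro bdd_mult_low) auto
  have B3: "bdd_mult (\<lambda>a c. k3 (snd a) (snd c) * md a powr (- \<gamma>))"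
    using \<gamma> i3 bdd_mult_fibre[of k3 \<gamma> 0 2] by simp
  have B4: "bdd_mult (\<lambda>a c. k3 (snd a) (snd c) * md c powr (- \<gamma>))"
    using \<gamma> i3 bdd_mult_fibre[of k3 0 \<gamma> 2] by simp
  have B5: "bdd_mult (\<lambda>a c. hhl (snd a) (snd c) * md a powr (- b) * md c powr (- b))"
    using b hhl_phase by (intro bdd_mult_phase[where C=64]) auto
  have B6: "bdd_mult (\<lambda>a c. hhl (snd a) (snd c) * md (a + c) powr (- b) * md c powr (- b))"
    using b hhl_phase by (intro bdd_mult_phase_out1[where C=64]) auto
  have B7: "bdd_mult (\<lambda>a c. hhl (snd a) (snd c) * md (a + c) powr (- b) * md a powr (- b))"
    using b hhl_phase by (intro bdd_mult_phase_out2[where C=64]) auto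
  have B8: "bdd_mult (\<lambda>a c. k5 (snd a) (snd c) * md a powr (- b))"
    using b i5 bdd_mult_fibre[of k5 b 0 10] by simp
  have B9: "bdd_mult (\<lambda>a c. k5 (snd a) (snd c) * md c powr (- b))"
    using b i5 bdd_mult_fibre[of k5 0 b 10] by simp
  have B10: "bdd_mult (\<lambda>a c. hlh (snd a) (snd c) * md a powr (- b) * md c powr (- b))"
    using b hlh_phase by (intro bdd_mult_phase[where C=64]) auto
  have B11: "bdd_mult (\<lambda>a c. hlh (snd a) (snd c) * md (a + c) powr (- b) * md c powr (- b))"
    using b hlh_phase by (intro bdd_mult_phase_out1[where C=64]) auto
  have B12: "bdd_mult (\<lambda>a c. hlh (snd a) (snd c) * md (a + c) powr (- b) * md a powr (- b))"
    using b hlh_phase by (intro bdd_mult_phase_out2[where C=64]) auto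
  \<comment> \<open>640000 is the largest constant of the cases below: 80000 * 8, from comparable
    frequencies with small \<tau>.\<close>
  note B = bdd_mult_cmult[OF bdd_mult_add[OF B1 bdd_mult_add[OF B2 bdd_mult_add[OF B3 bdd_mult_add[OF B4
    bdd_mult_add[OF B5 bdd_mult_add[OF B6 bdd_mult_add[OF B7 bdd_mult_add[OF B8 bdd_mult_add[OF B9
    bdd_mult_add[OF B10 bdd_mult_add[OF B11 B12]]]]]]]]]]], of 640000]
  show "bdd_mult (\<lambda>a c. if \<bar>snd c\<bar> \<le> \<bar>snd a\<bar> then kawahara_mult (- 7 / 4) b \<alpha> a c else 0)"
  proof (rule bdd_mult_mono[OF B], simp)
    show "(\<lambda>(a, c). if \<bar>snd c\<bar> \<le> \<bar>snd a\<bar> then kawahara_mult (- 7 / 4) b \<alpha> a c else 0) \<in> borel_measurable (borel \<Otimes>\<^sub>M borel)"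
      by measurable
    fix a c :: "real \<times> real"
    assume nz: "snd a \<noteq> 0" "snd c \<noteq> 0"
    define x1 x2 where "x1 = snd a" and "x2 = snd c"
    define L L1 L2 where "L = md (a + c)" and "L1 = md a" and "L2 = md c"
    define T where "T = jb (fst a + fst c)"
    define X where "X = \<bar>x1 + x2\<bar>"
    have L: "1 \<le> L" "1 \<le> L1" "1 \<le> L2" unfolding L_def L1_def L2_def by (rule md_ge_1)+
    have T: "1 \<le> T" unfolding T_def by (rule jb_ge_1)
    have T1: "T powr (- 7 / 20) \<le> 1" unfolding T_def using jb_powr_neg_le_1[of "7 / 20" "fst a + fst c"] by simp
    have Lb: "L powr (- b) \<le> 1" using L b powr_mono[of "- b" 0 L] by simp
    have x: "snd a = x1" "snd c = x2" "snd a + snd c = x1 + x2" by (simp_all add: x1_def x2_def)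
    have X0: "0 \<le> X" by (simp add: X_def)
    define P1 where "P1 = k1 x1 x2 * L1 powr (- \<gamma>) * L2 powr (- \<gamma>)"
    define P2 where "P2 = low_mult (2 / 5) \<alpha> a c"
    define P3 where "P3 = k3 x1 x2 * L1 powr (- \<gamma>)"
    define P4 where "P4 = k3 x1 x2 * L2 powr (- \<gamma>)"
    define P5 where "P5 = hhl x1 x2 * L1 powr (- b) * L2 powr (- b)"
    define P6 where "P6 = hhl x1 x2 * L powr (- b) * L2 powr (- b)"
    define P7 where "P7 = hhl x1 x2 * L powr (- b) * L1 powr (- b)"
    define P8 where "P8 = k5 x1 x2 * L1 powr (- b)"
    define P9 where "P9 = k5 x1 x2 * L2 powr (- b)"
    define P10 where "P10 = hlh x1 x2 * L1 powr (- b) * L2 powr (- b)"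
    define P11 where "P11 = hlh x1 x2 * L powr (- b) * L2 powr (- b)"
    define P12 where "P12 = hlh x1 x2 * L powr (- b) * L1 powr (- b)"
    have knn: "0 \<le> k1 x1 x2" "0 \<le> k3 x1 x2" "0 \<le> k5 x1 x2" "0 \<le> hhl x1 x2" "0 \<le> hlh x1 x2"
      by (auto simp: k1_def k3_def k5_def hhl_def hlh_def)
    have nn: "0 \<le> P1" "0 \<le> P2" "0 \<le> P3" "0 \<le> P4" "0 \<le> P5" "0 \<le> P6" "0 \<le> P7" "0 \<le> P8" "0 \<le> P9" "0 \<le> P10" "0 \<le> P11" "0 \<le> P12"
      unfolding P1_def P2_def P3_def P4_def P5_def P6_def P7_def P8_def P9_def P10_def P11_def P12_def
      using knn low_mult_nonneg by auto
    define W1 W2 where "W1 = winv (- 7 / 4) b \<alpha> a" and "W2 = winv (- 7 / 4) b \<alpha> c"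
    have W: "0 \<le> W1" "0 \<le> W2" by (auto simp: W1_def W2_def)
    have kaw: "kawahara_mult (- 7 / 4) b \<alpha> a c = X * T powr (- 7 / 20) * L powr (- b) * W1 * W2"
      by (simp add: kawahara_mult_def X_def T_def L_def x1_def x2_def W1_def W2_def)
    have tau_small: "L powr (- b) \<le> 8 * X powr (- 5 / 2)" "X ^ 5 / 64 \<le> L1 \<or> X ^ 5 / 64 \<le> L2" if "T < X ^ 5 / 32" "0 < X"
    proof -
      have st: "X ^ 5 / 64 \<le> L" "X ^ 5 / 64 \<le> L1 \<or> X ^ 5 / 64 \<le> L2"
        using small_tau_modulations[of a c] that(1) unfolding T_def X_def x1_def x2_def L_def L1_def L2_def by blast+
      then show "X ^ 5 / 64 \<le> L1 \<or> X ^ 5 / 64 \<le> L2" by simp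
      show "L powr (- b) \<le> 8 * X powr (- 5 / 2)"
        using b by (intro powr_half_gain[OF that(2) st(1) L(1)]) simp
    qed
    have tau_large: "T powr (- 7 / 20) \<le> 4 * X powr (- 7 / 4)" if "\<not> T < X ^ 5 / 32" "0 < X"
      using that by (intro tau_gain) auto
    have goal: "kawahara_mult (- 7 / 4) b \<alpha> a c \<le> 640000 * (P1 + (P2 + (P3 + (P4 + (P5 + (P6 + (P7 + (P8 + (P9 + (P10 + (P11 + P12)))))))))))"
      if le: "\<bar>x2\<bar> \<le> \<bar>x1\<bar>"
    proof -
      consider "X = 0" | "\<bar>x1\<bar> \<le> 2" | "0 < X" "2 < \<bar>x1\<bar>" "\<bar>x2\<bar> \<le> 1" | "0 < X" "1 < \<bar>x2\<bar>"
        using X0 by linarith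
      then show ?thesis
      proof cases
        case 1
        then have "kawahara_mult (- 7 / 4) b \<alpha> a c = 0" unfolding kaw by simp
        then show ?thesis using nn by simp
      next
        case 2
        have "X \<le> 4" unfolding X_def using 2 le by linarith
        moreover have "W1 \<le> 9 * L1 powr (- \<gamma>)" unfolding W1_def L1_def \<gamma>_def using 2 by (intro winv_lower_le) (simp add: x)
        moreover have "W2 \<le> 9 * L2 powr (- \<gamma>)" unfolding W2_def L2_def \<gamma>_def using 2 le by (intro winv_lower_le) (simp add: x)
        ultimately have "X * T powr (- 7 / 20) * L powr (- b) * W1 * W2 \<le> 4 * 1 * 1 * (9 * L1 powr (- \<gamma>)) * (9 * L2 powr (- \<gamma>))"
          using T1 Lb W X0 by (intro mult_mono mult_nonneg_nonneg) auto
        also have "\<dots> = 324 * P1" using 2 by (simp add: P1_def k1_def)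
        finally show ?thesis unfolding kaw using nn by simp
      next
        \<comment> \<open>High-low interaction: the output frequency \<open>X\<close> is comparable
          to |x1| and at least 1.\<close>
        case 3
        have W1: "W1 = jb x1 powr (7 / 4) * L1 powr (- b)" using 3 by (simp add: W1_def winv_def x L1_def)
        have W2: "W2 = L2 powr (- \<alpha>)" using 3 by (simp add: W2_def winv_def x L2_def)
        have X1: "1 \<le> X" and Xx: "\<bar>x1\<bar> \<le> 2 * X" unfolding X_def using 3 by (auto simp: abs_if split: if_splits)
        have "jb x1 \<le> 4 * X" using jb_le_2abs[of x1] 3 Xx by linarith
        then have j: "jb x1 powr (7 / 4) \<le> 16 * X powr (7 / 4)"
          using powr_7_4_bounds by (intro powr_le_const[where c=4]) auto
        show ?thesis
        proof (cases "T < X ^ 5 / 32")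
          \<comment> \<open>The gain from \<tau> cancels the weight of the high input, both being of
            size X to the power 7/4, and \<open>low_mult\<close> remains.\<close>
          case False
          have "kawahara_mult (- 7 / 4) b \<alpha> a c = X * T powr (- 7 / 20) * L powr (- b) * (jb x1 powr (7 / 4) * L1 powr (- b)) * L2 powr (- \<alpha>)"
            unfolding kaw W1 W2 ..
          also have "\<dots> \<le> X * (4 * X powr (- 7 / 4)) * L powr (- (2 / 5)) * ((16 * X powr (7 / 4)) * L1 powr (- (2 / 5))) * L2 powr (- \<alpha>)"
            using tau_large[OF False] 3 j L b X0
            by (intro mult_mono mult_nonneg_nonneg order_refl powr_mono) auto
          also have "\<dots> = 64 * (X powr (- 7 / 4) * X powr (7 / 4)) * P2"
            using 3 by (simp add: P2_def low_mult_def x X_def[symmetric] L_def L1_def L2_def mult_ac)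
          also have "X powr (- 7 / 4) * X powr (7 / 4) = 1" using 3 by (simp add: powr_add[symmetric])
          finally show ?thesis using nn by simp
        next
          \<comment> \<open>Two large modulations give X to the power -5/2 each. Together with the
            derivative and the weight of the high input the exponent is 1 + 7/4 - 5/2 - 5/2 = -9/4,
            and \<open>X\<close> is at least 1.\<close>
          case True
          have E: "X * T powr (- 7 / 20) * L powr (- b) * jb x1 powr (7 / 4) \<le> 128 * X powr (1 / 4)"
          proof -
            have "X * T powr (- 7 / 20) * L powr (- b) * jb x1 powr (7 / 4) \<le> X * 1 * (8 * X powr (- 5 / 2)) * (16 * X powr (7 / 4))"
              using tau_small(1)[OF True] 3 j T1 X0 by (intro mult_mono mult_nonneg_nonneg order_refl) auto
            also have "\<dots> = 128 * (X powr 1 * X powr (- 5 / 2) * X powr (7 / 4))" using X0 by simp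
            also have "X powr 1 * X powr (- 5 / 2) * X powr (7 / 4) = X powr (1 / 4)"
              unfolding powr_add[symmetric] by simp
            finally show ?thesis .
          qed
          have small: "128 * X powr (1 / 4) * (8 * X powr (- 5 / 2)) \<le> 1024"
          proof -
            have "X powr (1 / 4) * X powr (- 5 / 2) = X powr (- (9 / 4))" unfolding powr_add[symmetric] by simp
            also have "\<dots> \<le> 1" using X1 powr_mono[of "- (9 / 4)" 0 X] by simp
            finally show ?thesis by simp
          qed
          have k: "kawahara_mult (- 7 / 4) b \<alpha> a c = (X * T powr (- 7 / 20) * L powr (- b) * jb x1 powr (7 / 4)) * L1 powr (- b) * L2 powr (- \<alpha>)"
            unfolding kaw W1 W2 by (simp add: mult_ac)
          have k3: "k3 x1 x2 = 1" using 3 by (simp add: k3_def)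
          from tau_small(2)[OF True 3(1)] show ?thesis
          proof
            assume h: "X ^ 5 / 64 \<le> L1"
            have "kawahara_mult (- 7 / 4) b \<alpha> a c \<le> (128 * X powr (1 / 4)) * (8 * X powr (- 5 / 2)) * L2 powr (- \<gamma>)"
              unfolding k using E 3 h L b X0 \<gamma>
              by (intro mult_mono[OF mult_mono] mult_nonneg_nonneg powr_half_gain powr_mono) auto
            also have "\<dots> \<le> 1024 * L2 powr (- \<gamma>)" by (rule mult_right_mono[OF small]) auto
            also have "\<dots> = 1024 * P4" by (simp add: P4_def k3)
            finally show ?thesis using nn by simp
          next
            assume h: "X ^ 5 / 64 \<le> L2"
            have "kawahara_mult (- 7 / 4) b \<alpha> a c \<le> (128 * X powr (1 / 4)) * L1 powr (- \<gamma>) * (8 * X powr (- 5 / 2))"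
              unfolding k using E 3 h L b X0 \<gamma> \<alpha>
              by (intro mult_mono[OF mult_mono] mult_nonneg_nonneg powr_half_gain powr_mono) auto
            also have "\<dots> = (128 * X powr (1 / 4)) * (8 * X powr (- 5 / 2)) * L1 powr (- \<gamma>)" by (simp only: mult_ac)
            also have "\<dots> \<le> 1024 * L1 powr (- \<gamma>)" by (rule mult_right_mono[OF small]) auto
            also have "\<dots> = 1024 * P3" by (simp add: P3_def k3)
            finally show ?thesis using nn by simp
          qed
        qed
      next
        case 4
        then have x1: "1 < \<bar>x1\<bar>" using le by linarith
        have W1: "W1 = jb x1 powr (7 / 4) * L1 powr (- b)" using x1 by (simp add: W1_def winv_def x L1_def)
        have W2: "W2 = jb x2 powr (7 / 4) * L2 powr (- b)" using 4 by (simp add: W2_def winv_def x L2_def)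
        have j1: "jb x1 powr (7 / 4) \<le> 4 * \<bar>x1\<bar> powr (7 / 4)"
          using jb_le_2abs[of x1] x1 powr_7_4_bounds by (intro powr_le_const[where c=2]) auto
        have j2: "jb x2 powr (7 / 4) \<le> 4 * \<bar>x2\<bar> powr (7 / 4)"
          using jb_le_2abs[of x2] 4 powr_7_4_bounds by (intro powr_le_const[where c=2]) auto
        let ?Q = "X * \<bar>x1\<bar> ^ 3 * \<bar>x2\<bar> / 2"
        have Q: "0 < ?Q" using 4 x1 by auto
        have dom: "?Q \<le> L \<or> ?Q \<le> L1 \<or> ?Q \<le> L2"
          using resonance[of a c] by (simp add: X_def x L_def L1_def L2_def)
        have k: "kawahara_mult (- 7 / 4) b \<alpha> a c = (X * T powr (- 7 / 20) * jb x1 powr (7 / 4) * jb x2 powr (7 / 4)) * L powr (- b) * L1 powr (- b) * L2 powr (- b)"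
          unfolding kaw W1 W2 by (simp add: mult_ac)
        show ?thesis
        proof (cases "4 * X < \<bar>x2\<bar>")
          \<comment> \<open>Nearly opposite high inputs. The output weight is merely bounded by 1,
            so both input weights are left, which gives the exponent 7/2 in
            \<open>?A\<close>.\<close>
          case True
          then have x12: "\<bar>x1\<bar> \<le> 2 * \<bar>x2\<bar>" unfolding X_def by (auto simp: abs_if split: if_splits)
          let ?A = "X * \<bar>x1\<bar> powr (7 / 2)"
          have "X * T powr (- 7 / 20) * jb x1 powr (7 / 4) * jb x2 powr (7 / 4) \<le> X * 1 * (4 * \<bar>x1\<bar> powr (7 / 4)) * (4 * \<bar>x1\<bar> powr (7 / 4))"
            using T1 j1 order_trans[OF j2 mult_left_mono[OF powr_mono2[of "7 / 4" "\<bar>x2\<bar>" "\<bar>x1\<bar>"]]] le X0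
            by (intro mult_mono mult_nonneg_nonneg order_refl) auto
          also have "\<dots> = 16 * (X * (\<bar>x1\<bar> powr (7 / 4) * \<bar>x1\<bar> powr (7 / 4)))" by simp
          also have "\<bar>x1\<bar> powr (7 / 4) * \<bar>x1\<bar> powr (7 / 4) = \<bar>x1\<bar> powr (7 / 2)" unfolding powr_add[symmetric] by simp
          finally have "kawahara_mult (- 7 / 4) b \<alpha> a c \<le> 16 * ?A * L powr (- b) * L1 powr (- b) * L2 powr (- b)"
            unfolding k by (intro mult_right_mono) auto
          also have "\<dots> = 16 * (?A * L powr (- b) * L1 powr (- b) * L2 powr (- b))" by (simp only: mult_ac)
          also have "\<dots> \<le> 16 * (hhl x1 x2 * L1 powr (- b) * L2 powr (- b) + hhl x1 x2 * L powr (- b) * L2 powr (- b) + hhl x1 x2 * L powr (- b) * L1 powr (- b))"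
          proof (intro mult_left_mono dominant_split[OF L Q, where u="1 / 2"] dom)
            let ?Y = "\<bar>x1\<bar>"
            have Y4: "?Y ^ 4 = ?Y powr 4" and Y3: "?Y ^ 3 = ?Y powr 3"
              using powr_realpow[of ?Y 4] powr_realpow[of ?Y 3] x1 by simp_all
            \<comment> \<open>As |x2| is comparable to |x1|, \<open>?Q\<close> is at least X *
              |x1|^4 / 4. Its square root reduces \<open>?A\<close> to twice X to the power 1/2
              times |x1| to the power 3/2, which is \<open>hhl\<close>: this balance determines
              -7/4.\<close>
            have "X * ?Y ^ 3 * ?Y \<le> X * ?Y ^ 3 * (2 * \<bar>x2\<bar>)" using x12 X0 by (intro mult_left_mono) auto
            then have "X * ?Y ^ 4 / 4 \<le> ?Q" by (simp add: eval_nat_numeral mult_ac)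
            then have "?Q powr (- (1 / 2)) \<le> (X * ?Y ^ 4 / 4) powr (- (1 / 2))"
              using 4 x1 by (intro powr_neg_antimono) auto
            also have "\<dots> = X powr (- (1 / 2)) * (?Y powr 4) powr (- (1 / 2)) * 4 powr (1 / 2)"
              unfolding Y4 using 4 x1 by (simp only: powr_divide powr_mult powr_minus) (simp add: field_simps)
            also have "(?Y powr 4) powr (- (1 / 2)) = ?Y powr (- 2)" by (simp only: powr_powr) simp
            also have "4 powr (1 / 2) = (2::real)" by (simp add: powr_half_sqrt)
            finally have "?A * ?Q powr (- (1 / 2)) \<le> ?A * (X powr (- (1 / 2)) * ?Y powr (- 2) * 2)"
              using X0 by (intro mult_left_mono) auto
            also have "\<dots> = 2 * ((X powr 1 * X powr (- (1 / 2))) * (?Y powr (7 / 2) * ?Y powr (- 2)))"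
              using X0 by (simp add: mult_ac)
            also have "\<dots> = 2 * (X powr (1 / 2) * ?Y powr (3 / 2))"
              unfolding powr_add[symmetric] by simp
            also have "?Y powr (3 / 2) = (?Y ^ 3) powr (1 / 2)" unfolding Y3 by (simp only: powr_powr) simp
            also have "2 * (X powr (1 / 2) * (?Y ^ 3) powr (1 / 2)) = hhl x1 x2"
              using True le X0 by (simp add: hhl_def X_def[symmetric] powr_half_sqrt real_sqrt_mult)
            finally show "?A * ?Q powr (- (1 / 2)) \<le> hhl x1 x2" .
          qed (use b X0 in auto)
          finally show ?thesis using nn unfolding P5_def P6_def P7_def by simp
        next
          case False
          have Xx: "\<bar>x1\<bar> \<le> 5 * X" using False unfolding X_def by (auto simp: abs_if split: if_splits)
          have "\<bar>x1\<bar> powr (7 / 4) \<le> 25 * X powr (7 / 4)"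
            using Xx powr_7_4_bounds by (intro powr_le_const[where c=5]) auto
          then have j1': "jb x1 powr (7 / 4) \<le> 100 * X powr (7 / 4)" using j1 by linarith
          show ?thesis
          proof (cases "T < X ^ 5 / 32")
            \<comment> \<open>All frequencies are bounded by multiples of \<open>X\<close>:
              derivative, two weights and the output modulation give 1 + 7/4 + 7/4 - 5/2 = 2, and
              the large input modulation lowers this to -1/2, the exponent of
              \<open>k5\<close>.\<close>
            case True
            have "\<bar>x2\<bar> powr (7 / 4) \<le> 25 * X powr (7 / 4)"
              using Xx le powr_7_4_bounds by (intro powr_le_const[where c=5]) auto
            then have j2': "jb x2 powr (7 / 4) \<le> 100 * X powr (7 / 4)" using j2 by linarith
            have E: "X * T powr (- 7 / 20) * jb x1 powr (7 / 4) * jb x2 powr (7 / 4) * L powr (- b) \<le> 80000 * X powr 2"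
            proof -
              have "X * T powr (- 7 / 20) * jb x1 powr (7 / 4) * jb x2 powr (7 / 4) * L powr (- b) \<le>
                 X * 1 * (100 * X powr (7 / 4)) * (100 * X powr (7 / 4)) * (8 * X powr (- 5 / 2))"
                using tau_small(1)[OF True 4(1)] j1' j2' T1 X0 by (intro mult_mono mult_nonneg_nonneg order_refl) auto
              also have "\<dots> = 80000 * (X powr 1 * X powr (7 / 4) * X powr (7 / 4) * X powr (- 5 / 2))" using X0 by simp
              also have "X powr 1 * X powr (7 / 4) * X powr (7 / 4) * X powr (- 5 / 2) = X powr 2"
                unfolding powr_add[symmetric] by simp
              finally show ?thesis .
            qed
            have small: "80000 * X powr 2 * (8 * X powr (- 5 / 2)) = 640000 * k5 x1 x2"
            proof -
              have "X powr 2 * X powr (- 5 / 2) = X powr (- 1 / 2)" unfolding powr_add[symmetric] by simp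
              moreover have "k5 x1 x2 = X powr (- 1 / 2)" using Xx by (simp add: k5_def X_def)
              ultimately show ?thesis by (simp add: mult_ac)
            qed
            have k': "kawahara_mult (- 7 / 4) b \<alpha> a c = (X * T powr (- 7 / 20) * jb x1 powr (7 / 4) * jb x2 powr (7 / 4) * L powr (- b)) * L1 powr (- b) * L2 powr (- b)"
              unfolding k ..
            from tau_small(2)[OF True 4(1)] show ?thesis
            proof
              assume h: "X ^ 5 / 64 \<le> L1"
              have "kawahara_mult (- 7 / 4) b \<alpha> a c \<le> (80000 * X powr 2) * (8 * X powr (- 5 / 2)) * L2 powr (- b)"
                unfolding k' using E 4 h L b X0
                by (intro mult_mono[OF mult_mono] mult_nonneg_nonneg powr_half_gain order_refl) auto
              also have "\<dots> = 640000 * P9" unfolding small P9_def by simp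
              finally show ?thesis using nn by simp
            next
              assume h: "X ^ 5 / 64 \<le> L2"
              have "kawahara_mult (- 7 / 4) b \<alpha> a c \<le> (80000 * X powr 2) * L1 powr (- b) * (8 * X powr (- 5 / 2))"
                unfolding k' using E 4 h L b X0
                by (intro mult_mono[OF mult_mono] mult_nonneg_nonneg powr_half_gain order_refl) auto
              also have "\<dots> = (80000 * X powr 2 * (8 * X powr (- 5 / 2))) * L1 powr (- b)" by (simp only: mult_ac)
              also have "\<dots> = 640000 * P8" unfolding small P8_def by simp
              finally show ?thesis using nn by simp
            qed
          next
            \<comment> \<open>The output weight cancels that of the larger input; half a power of
              the resonance then turns the remaining \<open>?A\<close> into
              \<open>hlh\<close>.\<close>
            case tl: False
            let ?A = "X * \<bar>x2\<bar> powr (7 / 4)"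
            have "X * T powr (- 7 / 20) * jb x1 powr (7 / 4) * jb x2 powr (7 / 4) \<le> X * (4 * X powr (- 7 / 4)) * (100 * X powr (7 / 4)) * (4 * \<bar>x2\<bar> powr (7 / 4))"
              using tau_large[OF tl 4(1)] j1' j2 X0 by (intro mult_mono mult_nonneg_nonneg order_refl) auto
            also have "\<dots> = 1600 * ?A * (X powr (- 7 / 4) * X powr (7 / 4))" by simp
            also have "X powr (- 7 / 4) * X powr (7 / 4) = 1" using 4 by (simp add: powr_add[symmetric])
            finally have "kawahara_mult (- 7 / 4) b \<alpha> a c \<le> 1600 * ?A * 1 * L powr (- b) * L1 powr (- b) * L2 powr (- b)"
              unfolding k by (intro mult_right_mono) auto
            also have "\<dots> = 1600 * (?A * L powr (- b) * L1 powr (- b) * L2 powr (- b))" by simp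
            also have "\<dots> \<le> 1600 * (hlh x1 x2 * L1 powr (- b) * L2 powr (- b) + hlh x1 x2 * L powr (- b) * L2 powr (- b) + hlh x1 x2 * L powr (- b) * L1 powr (- b))"
            proof (intro mult_left_mono dominant_split[OF L Q, where u="1 / 2"] dom)
              have "X * ?Q powr (- (1 / 2)) \<le> 2 * \<bar>x1\<bar> powr (1 - 4 * (1 / 2)) * \<bar>x2\<bar> powr (- (1 / 2))"
                using 4 x1 le by (intro resonance_gain) (auto simp: X_def)
              then have "X * ?Q powr (- (1 / 2)) * \<bar>x2\<bar> powr (7 / 4) \<le> 2 * \<bar>x1\<bar> powr (1 - 4 * (1 / 2)) * \<bar>x2\<bar> powr (- (1 / 2)) * \<bar>x2\<bar> powr (7 / 4)"
                by (rule mult_right_mono) auto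
              also have "\<dots> = 2 * \<bar>x1\<bar> powr (- 1) * (\<bar>x2\<bar> powr (- (1 / 2)) * \<bar>x2\<bar> powr (7 / 4))"
                by (simp only: mult.assoc) simp
              also have "\<bar>x2\<bar> powr (- (1 / 2)) * \<bar>x2\<bar> powr (7 / 4) = \<bar>x2\<bar> powr (5 / 4)"
                unfolding powr_add[symmetric] by simp
              also have "2 * \<bar>x1\<bar> powr (- 1) * \<bar>x2\<bar> powr (5 / 4) = hlh x1 x2"
                using False 4 le unfolding X_def by (auto simp: hlh_def)
              finally show "?A * ?Q powr (- (1 / 2)) \<le> hlh x1 x2" by (simp only: mult_ac)
            qed (use b X0 in auto)
            finally show ?thesis using nn unfolding P10_def P11_def P12_def by simp
          qed
        qed
      qed
    qed
    show "(if \<bar>snd c\<bar> \<le> \<bar>snd a\<bar> then kawahara_mult (- 7 / 4) b \<alpha> a c else 0) \<le>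
      640000 * (k1 (snd a) (snd c) * md a powr (- \<gamma>) * md c powr (- \<gamma>) + (low_mult (2 / 5) \<alpha> a c +
        (k3 (snd a) (snd c) * md a powr (- \<gamma>) + (k3 (snd a) (snd c) * md c powr (- \<gamma>) +
        (hhl (snd a) (snd c) * md a powr (- b) * md c powr (- b) + (hhl (snd a) (snd c) * md (a + c) powr (- b) * md c powr (- b) +
        (hhl (snd a) (snd c) * md (a + c) powr (- b) * md a powr (- b) + (k5 (snd a) (snd c) * md a powr (- b) +
        (k5 (snd a) (snd c) * md c powr (- b) + (hlh (snd a) (snd c) * md a powr (- b) * md c powr (- b) +
        (hlh (snd a) (snd c) * md (a + c) powr (- b) * md c powr (- b) + hlh (snd a) (snd c) * md (a + c) powr (- b) * md a powr (- b))))))))))))"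
      unfolding x L_def[symmetric] L1_def[symmetric] L2_def[symmetric] P1_def[symmetric] P2_def[symmetric] P3_def[symmetric]
        P4_def[symmetric] P5_def[symmetric] P6_def[symmetric] P7_def[symmetric] P8_def[symmetric] P9_def[symmetric]
        P10_def[symmetric] P11_def[symmetric] P12_def[symmetric]
      using goal nn by (cases "\<bar>x2\<bar> \<le> \<bar>x1\<bar>") (simp_all only: if_True if_False, simp)
  qed
qed (auto intro: kawahara_mult_commute kawahara_mult_nonneg)

section \<open>Interpolation\<close>

text \<open>The weights are log-linear in \<open>(s, b)\<close> and a geometric mean is at most the corresponding arithmetic mean,
  so the range of \<open>s\<close> is filled by interpolating between the endpoints; this also lowers \<open>b\<close> below \<open>1/2\<close>.\<close>

lemma weighted_amgm:
  fixes x y \<theta> :: real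
  assumes "0 \<le> x" "0 \<le> y" "0 < \<theta>" "\<theta> < 1"
  shows "x powr (1 - \<theta>) * y powr \<theta> \<le> x + y"
proof -
  let ?m = "max x y"
  have "x powr (1 - \<theta>) * y powr \<theta> \<le> ?m powr (1 - \<theta>) * ?m powr \<theta>"
    using assms by (intro mult_mono powr_mono2) auto
  also have "\<dots> = ?m powr 1" unfolding powr_add[symmetric] by simp
  also have "\<dots> \<le> x + y" using assms by (auto simp: max_def)
  finally show ?thesis .
qed

text \<open>Both endpoints have the same \<alpha>, so in the low region the exponents 1 - \<theta>
  and \<theta> recombine to it.\<close>

lemma winv_interpolate:
  assumes "0 < \<theta>" "\<theta> < 1"
  shows "winv ((1 - \<theta>) * s0 + \<theta> * s1) ((1 - \<theta>) * b0 + \<theta> * b1) \<alpha> z = winv s0 b0 \<alpha> z powr (1 - \<theta>) * winv s1 b1 \<alpha> z powr \<theta>"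
  by (simp add: winv_def powr_mult powr_powr powr_add[symmetric] mult_ac)
     (simp add: powr_add[symmetric] algebra_simps)

lemma bdd_mult_interpolate:
  assumes "bdd_mult (kawahara_mult s0 b0 \<alpha>)" "bdd_mult (kawahara_mult s1 b1 \<alpha>)" and \<theta>: "0 < \<theta>" "\<theta> < 1"
  shows "bdd_mult (kawahara_mult ((1 - \<theta>) * s0 + \<theta> * s1) ((1 - \<theta>) * b0 + \<theta> * b1) \<alpha>)"
proof (rule bdd_mult_mono[OF bdd_mult_add[OF assms(1,2)]])
  fix a c :: "real \<times> real"
  let ?s = "(1 - \<theta>) * s0 + \<theta> * s1" and ?b = "(1 - \<theta>) * b0 + \<theta> * b1"
  let ?X = "\<bar>snd a + snd c\<bar>" and ?T = "jb (fst a + fst c)" and ?L = "md (a + c)"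
  have e1: "?X = ?X powr (1 - \<theta>) * ?X powr \<theta>" unfolding powr_add[symmetric] by simp
  have e2: "?T powr (?s / 5) = (?T powr (s0 / 5)) powr (1 - \<theta>) * (?T powr (s1 / 5)) powr \<theta>"
    unfolding powr_powr powr_add[symmetric] by (simp add: field_simps)
  have e3: "?L powr (- ?b) = (?L powr (- b0)) powr (1 - \<theta>) * (?L powr (- b1)) powr \<theta>"
    unfolding powr_powr powr_add[symmetric] by (simp add: field_simps)
  have "kawahara_mult ?s ?b \<alpha> a c = (?X powr (1 - \<theta>) * ?X powr \<theta>) * ?T powr (?s / 5) * ?L powr (- ?b) * winv ?s ?b \<alpha> a * winv ?s ?b \<alpha> c"
    unfolding kawahara_mult_def e1[symmetric] ..
  also have "\<dots> = kawahara_mult s0 b0 \<alpha> a c powr (1 - \<theta>) * kawahara_mult s1 b1 \<alpha> a c powr \<theta>"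
    unfolding e2 e3 winv_interpolate[OF \<theta>] kawahara_mult_def by (simp add: powr_mult mult_ac)
  also have "\<dots> \<le> kawahara_mult s0 b0 \<alpha> a c + kawahara_mult s1 b1 \<alpha> a c"
    using \<theta> by (intro weighted_amgm kawahara_mult_nonneg) auto
  finally show "kawahara_mult ?s ?b \<alpha> a c \<le> kawahara_mult s0 b0 \<alpha> a c + kawahara_mult s1 b1 \<alpha> a c" .
qed simp

lemma kawahara_mult_bounded:
  fixes s :: real
  assumes "- 7 / 4 < s" "s < 5 / 2"
  shows "\<exists>b < 1 / 2. \<forall>\<alpha> > 1 / 2. bdd_mult (kawahara_mult s b \<alpha>)"
proof -
  \<comment> \<open>The midpoint of \<open>max (s / 5) (3 / 8)\<close> and 1/2 meets the conditions
    of the upper endpoint and satisfies \<open>s < 5 * b1\<close>; \<open>\<theta>\<close> then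
    solves the interpolation equation for \<open>s\<close>.\<close>
  define b1 where "b1 = (max (s / 5) (3 / 8) + 1 / 2) / 2"
  have b1: "3 / 8 < b1" "b1 < 1 / 2" "s < 5 * b1" using assms by (auto simp: b1_def max_def field_simps)
  define \<theta> where "\<theta> = (s + 7 / 4) / (5 * b1 + 7 / 4)"
  have \<theta>: "0 < \<theta>" "\<theta> < 1" using assms b1 by (auto simp: \<theta>_def field_simps)
  \<comment> \<open>With \<delta> = \<theta> * (1/2 - b1), \<open>b1\<close> lowers the mean by
    \<delta>, while \<open>b0\<close> exceeds 1/2 by \<delta>/2 only, so the mean stays below 1/2.
    None of these numbers involves \<alpha>.\<close>
  define b0 where "b0 = 1 / 2 + \<theta> * (1 / 2 - b1) / 2"
  have s: "s = (1 - \<theta>) * (- 7 / 4) + \<theta> * (5 * b1)"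
  proof -
    have "\<theta> * (5 * b1 + 7 / 4) = s + 7 / 4" using b1 by (simp add: \<theta>_def)
    then show ?thesis by (simp add: field_simps)
  qed
  have pos: "0 < \<theta> * (1 / 2 - b1)" using \<theta> b1 by simp
  then have b0: "1 / 2 < b0" by (simp add: b0_def)
  have "(1 - \<theta>) * b0 + \<theta> * b1 < 1 / 2"
  proof -
    have "(1 - \<theta>) * b0 + \<theta> * b1 = 1 / 2 + (1 - \<theta>) * (\<theta> * (1 / 2 - b1)) / 2 - \<theta> * (1 / 2 - b1)"
      by (simp add: b0_def field_simps)
    moreover have "(1 - \<theta>) * (\<theta> * (1 / 2 - b1)) \<le> 1 * (\<theta> * (1 / 2 - b1))"
      using \<theta> pos by (intro mult_right_mono) auto
    ultimately show ?thesis using pos by linarith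
  qed
  moreover have "bdd_mult (kawahara_mult s ((1 - \<theta>) * b0 + \<theta> * b1) \<alpha>)" if "1 / 2 < \<alpha>" for \<alpha>
    by (subst s) (intro bdd_mult_interpolate bdd_mult_lower_endpoint bdd_mult_upper_endpoint b0 b1 \<theta> that)
  ultimately show ?thesis by blast
qed

section \<open>Rapidly decreasing functions and their Fourier transforms\<close>

text \<open>Quadratic decay in each variable separately gives integrability in the plane and on
  every slice, as needed to integrate by parts in one variable inside an iterated integral.\<close>

definition decaying :: "plane_fun \<Rightarrow> bool" where
  "decaying f \<longleftrightarrow> continuous_on UNIV f \<and>
     (\<exists>C. \<forall>z. cmod (f z) \<le> C * (jb (fst z) powr (- 2) * jb (snd z) powr (- 2)))"

lemma jb_powr2_integrable: "integrable lborel (\<lambda>x. jb x powr (- 2))"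
  by (rule integrableI_bounded)
     (use jb_powr_integral_finite[of 2] in \<open>auto simp: top.extremum_strict intro: le_less_trans\<close>)

lemma jb_square: "jb x powr 2 = 1 + x\<^sup>2" "jb x ^ 2 = 1 + x\<^sup>2"
  by (simp_all add: jb_def)

lemma plane_weight_integrable:
  "integrable lborel (\<lambda>z::real \<times> real. jb (fst z) powr (- 2) * jb (snd z) powr (- 2))"
proof -
  have "integrable (lborel \<Otimes>\<^sub>M lborel) (\<lambda>(x::real, y::real). jb x powr (- 2) * jb y powr (- 2))"
    by (rule lborel_pair.Fubini_integrable)
       (auto intro!: jb_powr2_integrable)
  then show ?thesis by (simp add: lborel_prod case_prod_unfold)
qed

lemma decaying_measurable: "decaying f \<Longrightarrow> f \<in> borel_measurable borel"
  by (simp add: decaying_def borel_measurable_continuous_onI)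

lemma decayingE:
  assumes "decaying f"
  obtains C where "0 \<le> C" "\<And>z. cmod (f z) \<le> C * (jb (fst z) powr (- 2) * jb (snd z) powr (- 2))"
proof -
  obtain C where C: "\<And>z. cmod (f z) \<le> C * (jb (fst z) powr (- 2) * jb (snd z) powr (- 2))"
    using assms unfolding decaying_def by blast
  have "cmod (f z) \<le> \<bar>C\<bar> * (jb (fst z) powr (- 2) * jb (snd z) powr (- 2))" for z
    by (rule order_trans[OF C]) (intro mult_right_mono, auto)
  then show ?thesis by (intro that[of "\<bar>C\<bar>"]) auto
qed

lemma decaying_integrable:
  assumes "decaying f"
  shows "integrable lborel f"
proof -
  obtain C where C: "\<And>z. cmod (f z) \<le> C * (jb (fst z) powr (- 2) * jb (snd z) powr (- 2))"
    using assms by (rule decayingE) blast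
  show ?thesis
    by (rule Bochner_Integration.integrable_bound[OF integrable_mult_right[OF plane_weight_integrable, of C]])
       (use decaying_measurable[OF assms] in \<open>simp, simp only: real_norm_def, intro AE_I2 order_trans[OF C abs_ge_self]\<close>)
qed

lemma decaying_bounded:
  assumes "decaying f"
  obtains C where "0 \<le> C" "\<And>z. cmod (f z) \<le> C"
proof -
  obtain C where C: "0 \<le> C" "\<And>z. cmod (f z) \<le> C * (jb (fst z) powr (- 2) * jb (snd z) powr (- 2))"
    using assms by (rule decayingE) blast
  have "cmod (f z) \<le> C * (1 * 1)" for z
    by (rule order_trans[OF C(2)], intro mult_left_mono mult_mono jb_powr_neg_le_1) (use C in auto)
  with C show ?thesis by (intro that[of C]) auto
qed

definition fker :: "real \<times> real \<Rightarrow> real \<times> real \<Rightarrow> complex" where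
  "fker \<zeta> z = exp (- (\<i> * complex_of_real (snd z * snd \<zeta>))) * exp (- (\<i> * complex_of_real (fst z * fst \<zeta>)))"

lemma fourier_eq: "fourier f \<zeta> = (\<integral>z. fker \<zeta> z * f z \<partial>lborel)"
  by (cases \<zeta>) (simp add: fourier_def fker_def case_prod_unfold)

lemma norm_fker [simp]: "cmod (fker \<zeta> z) = 1"
  by (simp add: fker_def norm_mult norm_exp_eq_Re)

lemma fker_measurable [measurable]:
  assumes [measurable]: "f \<in> borel_measurable M" "g \<in> borel_measurable M"
  shows "(\<lambda>x. fker (f x) (g x)) \<in> borel_measurable M"
proof -
  have [measurable]: "(exp :: complex \<Rightarrow> complex) \<in> borel_measurable borel"
    by (intro borel_measurable_continuous_onI continuous_intros)
  show ?thesis unfolding fker_def by measurable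
qed

lemma fker_shift: "fker \<zeta> z * cnj (fker \<eta> z) = fker (\<zeta> - \<eta>) z"
  by (simp add: fker_def exp_cnj exp_add[symmetric] algebra_simps)

lemma fker_integrable:
  assumes "integrable lborel f"
  shows "integrable lborel (\<lambda>z. fker \<zeta> z * f z)"
  using assms borel_measurable_integrable[OF assms]
  by (intro Bochner_Integration.integrable_bound[OF assms]) (auto simp: norm_mult)

lemma norm_fourier_le:
  assumes "integrable lborel f"
  shows "cmod (fourier f \<zeta>) \<le> (\<integral>z. cmod (f z) \<partial>lborel)"
  unfolding fourier_eq using integral_norm_bound[of lborel "\<lambda>z. fker \<zeta> z * f z"] by (simp add: norm_mult)

lemma fourier_measurable:
  assumes [measurable]: "f \<in> borel_measurable borel"
  shows "fourier f \<in> borel_measurable borel"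
proof -
  have "(\<lambda>\<zeta>. \<integral>z. fker \<zeta> z * f z \<partial>lborel) \<in> borel_measurable borel"
    by (rule lborel.borel_measurable_lebesgue_integral) measurable
  then show ?thesis by (simp add: fourier_eq[abs_def])
qed

lemma fourier_diff:
  assumes "integrable lborel f" "integrable lborel g"
  shows "fourier (\<lambda>z. f z - g z) \<zeta> = fourier f \<zeta> - fourier g \<zeta>"
  unfolding fourier_eq
  using Bochner_Integration.integral_diff[OF fker_integrable[OF assms(1)] fker_integrable[OF assms(2)]]
  by (simp add: right_diff_distrib)

lemma integral_derivative_vanishing:
  fixes G G' :: "real \<Rightarrow> complex"
  assumes deriv: "\<And>x. (G has_vector_derivative G' x) (at x)"
    and cont: "continuous_on UNIV G'" and int: "integrable lborel G'"
    and lim: "(G \<longlongrightarrow> 0) at_top" "(G \<longlongrightarrow> 0) at_bot"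
  shows "(\<integral>x. G' x \<partial>lborel) = 0"
proof -
  have "(LBINT x=-\<infinity>..\<infinity>. G' x) = 0 - 0"
  proof (rule interval_integral_FTC_integrable)
    show "(G has_vector_derivative G' x) (at x)" for x by (rule deriv)
    show "isCont G' x" for x using cont by (simp add: continuous_on_eq_continuous_at)
    show "set_integrable lborel (einterval (- \<infinity>) \<infinity>) G'"
      using int by (simp add: set_integrable_def)
    show "((G \<circ> real_of_ereal) \<longlongrightarrow> 0) (at_right (- \<infinity>))"
      using lim(2) by (simp add: ereal_tendsto_simps1)
    show "((G \<circ> real_of_ereal) \<longlongrightarrow> 0) (at_left \<infinity>)"
      using lim(1) by (simp add: ereal_tendsto_simps1)
  qed auto
  then show ?thesis
    by (simp add: interval_lebesgue_integral_def set_lebesgue_integral_def)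
qed

lemma jb_powr2_tendsto: "((\<lambda>x. jb x powr (- 2)) \<longlongrightarrow> 0) at_top" "((\<lambda>x. jb x powr (- 2)) \<longlongrightarrow> 0) at_bot"
proof -
  have *: "jb x powr (- 2) = inverse (1 + x\<^sup>2)" for x
    by (subst powr_minus) (simp only: jb_square)
  show "((\<lambda>x. jb x powr (- 2)) \<longlongrightarrow> 0) at_top" "((\<lambda>x. jb x powr (- 2)) \<longlongrightarrow> 0) at_bot"
    unfolding * by real_asymp+
qed

text \<open>The derivative of the product of the exponential and \<open>g\<close> has integral 0,
  since the product vanishes at both ends.\<close>

lemma one_dim_by_parts:
  fixes g g' :: "real \<Rightarrow> complex"
  assumes deriv: "\<And>x. (g has_vector_derivative g' x) (at x)"
    and cont: "continuous_on UNIV g'"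
    and bd: "\<And>x. cmod (g x) \<le> C * jb x powr (- 2)" "\<And>x. cmod (g' x) \<le> C * jb x powr (- 2)"
  shows "(\<integral>x. exp (- (\<i> * complex_of_real (x * \<xi>))) * g' x \<partial>lborel) =
    \<i> * \<xi> * (\<integral>x. exp (- (\<i> * complex_of_real (x * \<xi>))) * g x \<partial>lborel)"
proof -
  let ?e = "\<lambda>x. exp (- (\<i> * complex_of_real (x * \<xi>)))"
  have e: "cmod (?e x) = 1" for x by (simp add: norm_exp_eq_Re)
  have ce: "continuous_on UNIV ?e" by (intro continuous_intros)
  have cg: "continuous_on UNIV g"
    using deriv by (auto intro!: continuous_at_imp_continuous_on has_vector_derivative_continuous)
  have int: "integrable lborel (\<lambda>x. ?e x * h x)" if "continuous_on UNIV h" "\<And>x. cmod (h x) \<le> C * jb x powr (- 2)" for h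
  proof (rule Bochner_Integration.integrable_bound[OF integrable_mult_right[OF jb_powr2_integrable, of C]])
    show "(\<lambda>x. ?e x * h x) \<in> borel_measurable lborel"
      using continuous_on_mult[OF ce that(1)] by (simp add: borel_measurable_continuous_onI)
    show "AE x in lborel. norm (?e x * h x) \<le> norm (C * jb x powr (- 2))"
      using that(2) by (auto simp: norm_mult e intro!: order_trans[OF that(2)] abs_ge_self)
  qed
  have i1: "integrable lborel (\<lambda>x. ?e x * g' x)" and i2: "integrable lborel (\<lambda>x. ?e x * g x)"
    using int[OF cont bd(2)] int[OF cg bd(1)] by auto
  have "(\<integral>x. ?e x * g' x - \<i> * \<xi> * (?e x * g x) \<partial>lborel) = 0"
  proof (rule integral_derivative_vanishing[where G="\<lambda>x. ?e x * g x"])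
    fix x
    have "((\<lambda>x. - (\<i> * complex_of_real (x * \<xi>))) has_vector_derivative - (\<i> * \<xi>)) (at x)"
      by (auto intro!: derivative_eq_intros simp: has_vector_derivative_def scaleR_conv_of_real)
    from field_vector_diff_chain_at[OF this DERIV_exp]
    have "(?e has_vector_derivative (- (\<i> * \<xi>)) * ?e x) (at x)"
      by (simp add: o_def)
    from has_vector_derivative_mult[OF this deriv]
    show "((\<lambda>x. ?e x * g x) has_vector_derivative (?e x * g' x - \<i> * \<xi> * (?e x * g x))) (at x)"
      by (simp add: algebra_simps)
  next
    show "continuous_on UNIV (\<lambda>x. ?e x * g' x - \<i> * \<xi> * (?e x * g x))"
      by (intro continuous_intros cg cont)
    show "integrable lborel (\<lambda>x. ?e x * g' x - \<i> * \<xi> * (?e x * g x))"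
      by (intro Bochner_Integration.integrable_diff integrable_mult_right i1 i2)
    have le: "cmod (?e x * g x) \<le> C * jb x powr (- 2)" for x using bd(1) by (simp add: norm_mult e)
    show "((\<lambda>x. ?e x * g x) \<longlongrightarrow> 0) at_top"
      by (rule Lim_null_comparison[OF _ tendsto_mult_right_zero[OF jb_powr2_tendsto(1), of C]]) (rule always_eventually, rule allI, rule le)
    show "((\<lambda>x. ?e x * g x) \<longlongrightarrow> 0) at_bot"
      by (rule Lim_null_comparison[OF _ tendsto_mult_right_zero[OF jb_powr2_tendsto(2), of C]]) (rule always_eventually, rule allI, rule le)
  qed
  then show ?thesis
    unfolding Bochner_Integration.integral_diff[OF i1 integrable_mult_right[OF i2]] integral_mult_right_zero by simp
qed

lemma slice_continuous:
  assumes "continuous_on UNIV (f :: plane_fun)"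
  shows "continuous_on UNIV (\<lambda>x. f (t, x))" "continuous_on UNIV (\<lambda>t. f (t, x))"
  by (rule continuous_on_compose2[OF assms]; auto intro!: continuous_intros)+

lemma fourier_iterated:
  assumes "integrable lborel (f :: plane_fun)"
  shows "fourier f (\<tau>, \<xi>) = (\<integral>t. exp (- (\<i> * complex_of_real (t * \<tau>))) * (\<integral>x. exp (- (\<i> * complex_of_real (x * \<xi>))) * f (t, x) \<partial>lborel) \<partial>lborel)"
    "fourier f (\<tau>, \<xi>) = (\<integral>x. exp (- (\<i> * complex_of_real (x * \<xi>))) * (\<integral>t. exp (- (\<i> * complex_of_real (t * \<tau>))) * f (t, x) \<partial>lborel) \<partial>lborel)"
proof -
  have int: "integrable (lborel \<Otimes>\<^sub>M lborel) (\<lambda>(t, x). fker (\<tau>, \<xi>) (t, x) * f (t, x))"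
    using fker_integrable[OF assms, of "(\<tau>, \<xi>)"] by (simp add: lborel_prod case_prod_unfold)
  have e: "fourier f (\<tau>, \<xi>) = integral\<^sup>L (lborel \<Otimes>\<^sub>M lborel) (\<lambda>(t, x). fker (\<tau>, \<xi>) (t, x) * f (t, x))"
    by (simp add: fourier_eq lborel_prod case_prod_unfold)
  show "fourier f (\<tau>, \<xi>) = (\<integral>t. exp (- (\<i> * complex_of_real (t * \<tau>))) * (\<integral>x. exp (- (\<i> * complex_of_real (x * \<xi>))) * f (t, x) \<partial>lborel) \<partial>lborel)"
    unfolding e lborel_pair.integral_fst[OF int, symmetric] integral_mult_right_zero[symmetric]
    by (intro Bochner_Integration.integral_cong refl) (simp add: fker_def mult_ac)
  show "fourier f (\<tau>, \<xi>) = (\<integral>x. exp (- (\<i> * complex_of_real (x * \<xi>))) * (\<integral>t. exp (- (\<i> * complex_of_real (t * \<tau>))) * f (t, x) \<partial>lborel) \<partial>lborel)"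
    unfolding e lborel_pair.integral_snd[OF int, symmetric] integral_mult_right_zero[symmetric]
    by (intro Bochner_Integration.integral_cong refl) (simp add: fker_def mult_ac)
qed

lemma fourier_partial_x:
  assumes f: "decaying f" and f': "decaying f'"
    and deriv: "\<And>t x. ((\<lambda>y. f (t, y)) has_vector_derivative f' (t, x)) (at x)"
  shows "fourier f' (\<tau>, \<xi>) = \<i> * \<xi> * fourier f (\<tau>, \<xi>)"
proof -
  obtain C where C: "0 \<le> C" "\<And>z. cmod (f z) \<le> C * (jb (fst z) powr (- 2) * jb (snd z) powr (- 2))"
    using f by (rule decayingE) blast
  obtain C' where C': "0 \<le> C'" "\<And>z. cmod (f' z) \<le> C' * (jb (fst z) powr (- 2) * jb (snd z) powr (- 2))"
    using f' by (rule decayingE) blast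
  have "(\<integral>x. exp (- (\<i> * complex_of_real (x * \<xi>))) * f' (t, x) \<partial>lborel) =
      \<i> * \<xi> * (\<integral>x. exp (- (\<i> * complex_of_real (x * \<xi>))) * f (t, x) \<partial>lborel)" for t
  proof (rule one_dim_by_parts[where C="C + C'", OF deriv])
    show "continuous_on UNIV (\<lambda>x. f' (t, x))" using f' by (intro slice_continuous) (simp add: decaying_def)
    have "jb t powr (- 2) * jb x powr (- 2) \<le> jb x powr (- 2)" for x
      using jb_powr_neg_le_1[of 2 t] by (simp add: mult_left_le_one_le)
    then have *: "K * (jb t powr (- 2) * jb x powr (- 2)) \<le> (C + C') * jb x powr (- 2)" if "0 \<le> K" "K \<le> C + C'" for K x
      using that by (intro mult_mono) auto
    show "cmod (f (t, x)) \<le> (C + C') * jb x powr (- 2)" for x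
      by (rule order_trans[OF C(2)], simp only: fst_conv snd_conv, rule *) (use C C' in auto)
    show "cmod (f' (t, x)) \<le> (C + C') * jb x powr (- 2)" for x
      by (rule order_trans[OF C'(2)], simp only: fst_conv snd_conv, rule *) (use C C' in auto)
  qed
  note inner = this
  show ?thesis
    unfolding fourier_iterated(1)[OF decaying_integrable[OF f]] fourier_iterated(1)[OF decaying_integrable[OF f']] inner
    by (subst integral_mult_right_zero[symmetric]) (intro Bochner_Integration.integral_cong refl, simp only: mult_ac)
qed

lemma fourier_partial_t:
  assumes f: "decaying f" and f': "decaying f'"
    and deriv: "\<And>t x. ((\<lambda>r. f (r, x)) has_vector_derivative f' (t, x)) (at t)"
  shows "fourier f' (\<tau>, \<xi>) = \<i> * \<tau> * fourier f (\<tau>, \<xi>)"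
proof -
  obtain C where C: "0 \<le> C" "\<And>z. cmod (f z) \<le> C * (jb (fst z) powr (- 2) * jb (snd z) powr (- 2))"
    using f by (rule decayingE) blast
  obtain C' where C': "0 \<le> C'" "\<And>z. cmod (f' z) \<le> C' * (jb (fst z) powr (- 2) * jb (snd z) powr (- 2))"
    using f' by (rule decayingE) blast
  have "(\<integral>t. exp (- (\<i> * complex_of_real (t * \<tau>))) * f' (t, x) \<partial>lborel) =
      \<i> * \<tau> * (\<integral>t. exp (- (\<i> * complex_of_real (t * \<tau>))) * f (t, x) \<partial>lborel)" for x
  proof (rule one_dim_by_parts[where C="C + C'", OF deriv])
    show "continuous_on UNIV (\<lambda>t. f' (t, x))" using f' by (intro slice_continuous) (simp add: decaying_def)
    have "jb t powr (- 2) * jb x powr (- 2) \<le> jb t powr (- 2)" for t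
      using jb_powr_neg_le_1[of 2 x] by (simp add: mult_right_le_one_le)
    then have *: "K * (jb t powr (- 2) * jb x powr (- 2)) \<le> (C + C') * jb t powr (- 2)" if "0 \<le> K" "K \<le> C + C'" for K t
      using that by (intro mult_mono) auto
    show "cmod (f (t, x)) \<le> (C + C') * jb t powr (- 2)" for t
      by (rule order_trans[OF C(2)], simp only: fst_conv snd_conv, rule *) (use C C' in auto)
    show "cmod (f' (t, x)) \<le> (C + C') * jb t powr (- 2)" for t
      by (rule order_trans[OF C'(2)], simp only: fst_conv snd_conv, rule *) (use C C' in auto)
  qed
  note inner = this
  show ?thesis
    unfolding fourier_iterated(2)[OF decaying_integrable[OF f]] fourier_iterated(2)[OF decaying_integrable[OF f']] inner
    by (subst integral_mult_right_zero[symmetric]) (intro Bochner_Integration.integral_cong refl, simp only: mult_ac)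
qed

section \<open>Schwartz functions\<close>

definition rapid :: "plane_fun \<Rightarrow> bool" where
  "rapid f \<longleftrightarrow> (\<forall>k::nat. \<exists>C. \<forall>z. (1 + norm z) ^ k * cmod (f z) \<le> C)"

abbreviation part :: "nat \<Rightarrow> nat \<Rightarrow> plane_fun \<Rightarrow> plane_fun" where
  "part i j f \<equiv> (dt ^^ i) ((dx ^^ j) f)"

lemma schwartz_iff:
  "f \<in> schwartz \<longleftrightarrow> (\<forall>i j. (\<forall>z. part i j f differentiable (at z)) \<and> rapid (part i j f))"
proof -
  have "bounded (range (\<lambda>z. (1 + norm z) ^ k *\<^sub>R g z)) \<longleftrightarrow> (\<exists>C. \<forall>z. (1 + norm z) ^ k * cmod (g z) \<le> C)" for g :: plane_fun and k
    by (simp add: bounded_iff)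
  then show ?thesis by (simp add: schwartz_def rapid_def)
qed

lemma schwartz_part:
  assumes "f \<in> schwartz"
  shows "part i j f differentiable (at z)" "rapid (part i j f)"
  using assms unfolding schwartz_iff by blast+

lemma rapid_decaying:
  assumes "rapid f" "\<And>z. f differentiable (at z)"
  shows "decaying f"
  unfolding decaying_def
proof (intro conjI)
  show "continuous_on UNIV f"
    using assms(2) by (auto intro!: continuous_at_imp_continuous_on differentiable_imp_continuous_within)
  \<comment> \<open>Power 4 yields two powers for each coordinate.\<close>
  obtain C where C: "\<And>z. (1 + norm z) ^ 4 * cmod (f z) \<le> C" using assms(1) unfolding rapid_def by blast
  have "cmod (f z) \<le> C * (jb (fst z) powr (- 2) * jb (snd z) powr (- 2))" for z
  proof -
    have le: "1 + y\<^sup>2 \<le> (1 + norm z) ^ 2" if "\<bar>y\<bar> \<le> norm z" for y :: real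
    proof -
      have "y\<^sup>2 \<le> (norm z)\<^sup>2" using that by (metis abs_ge_zero power2_abs power_mono)
      then show ?thesis by (simp add: power2_sum add_increasing2)
    qed
    have "(1 + (fst z)\<^sup>2) * (1 + (snd z)\<^sup>2) \<le> (1 + norm z) ^ 2 * (1 + norm z) ^ 2"
      by (intro mult_mono le) (use norm_fst_le[of "fst z" "snd z"] norm_snd_le[of "snd z" "fst z"] in auto)
    also have "\<dots> = (1 + norm z) ^ 4" by (simp add: power_add[symmetric])
    finally have "(1 + (fst z)\<^sup>2) * (1 + (snd z)\<^sup>2) * cmod (f z) \<le> (1 + norm z) ^ 4 * cmod (f z)"
      by (rule mult_right_mono) auto
    with C[of z] have "((1 + (fst z)\<^sup>2) * (1 + (snd z)\<^sup>2)) * cmod (f z) \<le> C" by linarith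
    moreover have pos: "0 < (1 + (fst z)\<^sup>2) * (1 + (snd z)\<^sup>2)" by (intro mult_pos_pos add_pos_nonneg) auto
    ultimately have "cmod (f z) \<le> C / ((1 + (fst z)\<^sup>2) * (1 + (snd z)\<^sup>2))"
      by (subst pos_le_divide_eq) (auto simp: mult.commute)
    then show ?thesis by (simp add: powr_minus jb_square divide_inverse del: powr_numeral)
  qed
  then show "\<exists>C. \<forall>z. cmod (f z) \<le> C * (jb (fst z) powr (- 2) * jb (snd z) powr (- 2))" by blast
qed

lemma schwartz_decaying: "f \<in> schwartz \<Longrightarrow> decaying (part i j f)"
  by (rule rapid_decaying) (auto dest: schwartz_part)

lemma schwartz_decaying0: "f \<in> schwartz \<Longrightarrow> decaying f"
  using schwartz_decaying[of f 0 0] by simp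

lemma has_partial_x:
  assumes "\<And>z. f differentiable (at z)"
  shows "((\<lambda>y. f (t, y)) has_vector_derivative dx f (t, x)) (at x)"
proof -
  have "(f \<circ> Pair t) differentiable (at x)"
    by (rule differentiable_chain_at[OF _ assms]) (auto intro!: derivative_eq_intros simp: differentiable_def)
  then show ?thesis
    by (simp add: dx_def o_def vector_derivative_works[symmetric])
qed

lemma has_partial_t:
  assumes "\<And>z. f differentiable (at z)"
  shows "((\<lambda>r. f (r, x)) has_vector_derivative dt f (t, x)) (at t)"
proof -
  have "(f \<circ> (\<lambda>r. (r, x))) differentiable (at t)"
    by (rule differentiable_chain_at[OF _ assms]) (auto intro!: derivative_eq_intros simp: differentiable_def)
  then show ?thesis
    by (simp add: dt_def o_def vector_derivative_works[symmetric])
qed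

lemma fourier_part:
  assumes "f \<in> schwartz"
  shows "fourier (part i j f) (\<tau>, \<xi>) = (\<i> * \<tau>) ^ i * (\<i> * \<xi>) ^ j * fourier f (\<tau>, \<xi>)"
proof (induction i)
  case 0
  show ?case
  proof (induction j)
    case (Suc j)
    have "fourier (dx (part 0 j f)) (\<tau>, \<xi>) = \<i> * \<xi> * fourier (part 0 j f) (\<tau>, \<xi>)"
      by (rule fourier_partial_x) (use schwartz_decaying[OF assms, of 0] schwartz_decaying[OF assms, of 0 "Suc j"]
        has_partial_x[OF schwartz_part(1)[OF assms, of 0 j]] in auto)
    with Suc show ?case by simp
  qed simp
next
  case (Suc i)
  have "fourier (dt (part i j f)) (\<tau>, \<xi>) = \<i> * \<tau> * fourier (part i j f) (\<tau>, \<xi>)"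
    by (rule fourier_partial_t) (use schwartz_decaying[OF assms, of i] schwartz_decaying[OF assms, of "Suc i" j]
      has_partial_t[OF schwartz_part(1)[OF assms, of i j]] in auto)
  with Suc show ?case by simp
qed

text \<open>Multiplying the transform by powers of \<tau> and \<xi> gives the transform of a
  derivative, which is bounded by an integral. Only the orders 0 and \<open>N\<close> in each
  variable are used, as \<open>jb y\<close> to the power \<open>N\<close> is at most a multiple of 1
  + |y|^N.\<close>

lemma fourier_rapid:
  fixes N :: nat
  assumes "f \<in> schwartz"
  obtains C where "0 \<le> C" "\<And>\<zeta>. cmod (fourier f \<zeta>) \<le> C * (jb (fst \<zeta>) powr (- real N) * jb (snd \<zeta>) powr (- real N))"
proof -
  define B where "B i j = (\<integral>z. cmod (part i j f z) \<partial>lborel)" for i j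
  have B: "\<bar>\<tau>\<bar> ^ i * \<bar>\<xi>\<bar> ^ j * cmod (fourier f (\<tau>, \<xi>)) \<le> B i j" for \<tau> \<xi> i j
    using norm_fourier_le[OF decaying_integrable[OF schwartz_decaying[OF assms]], of i j "(\<tau>, \<xi>)"]
    unfolding fourier_part[OF assms] B_def by (simp add: norm_mult norm_power)
  have jbN: "jb y powr real N \<le> 2 ^ N * (1 + \<bar>y\<bar> ^ N)" for y
  proof -
    have "jb y ^ N \<le> (2 * max 1 \<bar>y\<bar>) ^ N"
      by (rule power_mono) (use jb_le[of y] in auto)
    also have "\<dots> = 2 ^ N * max 1 \<bar>y\<bar> ^ N" by (simp add: power_mult_distrib)
    also have "\<dots> \<le> 2 ^ N * (1 + \<bar>y\<bar> ^ N)" by (intro mult_left_mono) (auto simp: max_def)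
    finally show ?thesis by (simp add: powr_realpow)
  qed
  let ?C = "2 ^ N * 2 ^ N * (B 0 0 + B N 0 + B 0 N + B N N)"
  have "cmod (fourier f \<zeta>) \<le> ?C * (jb (fst \<zeta>) powr (- real N) * jb (snd \<zeta>) powr (- real N))" for \<zeta>
  proof -
    obtain \<tau> \<xi> where \<zeta>: "\<zeta> = (\<tau>, \<xi>)" by (cases \<zeta>)
    let ?F = "cmod (fourier f (\<tau>, \<xi>))"
    have "jb \<tau> powr real N * jb \<xi> powr real N * ?F \<le> (2 ^ N * (1 + \<bar>\<tau>\<bar> ^ N)) * (2 ^ N * (1 + \<bar>\<xi>\<bar> ^ N)) * ?F"
      by (intro mult_right_mono mult_mono jbN) auto
    also have "\<dots> = 2 ^ N * 2 ^ N * (?F + \<bar>\<tau>\<bar> ^ N * ?F + \<bar>\<xi>\<bar> ^ N * ?F + \<bar>\<tau>\<bar> ^ N * \<bar>\<xi>\<bar> ^ N * ?F)"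
      by (simp add: algebra_simps)
    also have "\<dots> \<le> ?C"
      using B[where ?i=0 and ?j=0] B[where ?i=N and ?j=0] B[where ?i=0 and ?j=N] B[where ?i=N and ?j=N]
      by (intro mult_left_mono add_mono) auto
    finally have "?F \<le> ?C / (jb \<tau> powr real N * jb \<xi> powr real N)"
      by (subst pos_le_divide_eq) (auto simp: mult_ac)
    then show ?thesis by (simp add: \<zeta> powr_minus divide_inverse)
  qed
  moreover have "0 \<le> ?C" by (intro mult_nonneg_nonneg add_nonneg_nonneg) (auto simp: B_def)
  ultimately show ?thesis by (rule that[rotated])
qed

section \<open>Closure properties of the Schwartz space\<close>

lemma dx_schwartz: "f \<in> schwartz \<Longrightarrow> dx f \<in> schwartz"
  unfolding schwartz_iff by (metis comp_apply funpow_Suc_right)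

lemma fourier_dx: "f \<in> schwartz \<Longrightarrow> fourier (dx f) (\<tau>, \<xi>) = \<i> * \<xi> * fourier f (\<tau>, \<xi>)"
  using fourier_part[of f 0 1] by simp

lemma rapid_diff: "rapid f \<Longrightarrow> rapid g \<Longrightarrow> rapid (\<lambda>z. f z - g z)"
  unfolding rapid_def
proof
  fix k
  assume "\<forall>k. \<exists>C. \<forall>z. (1 + norm z) ^ k * cmod (f z) \<le> C" "\<forall>k. \<exists>C. \<forall>z. (1 + norm z) ^ k * cmod (g z) \<le> C"
  then obtain C C' where C: "\<And>z. (1 + norm z) ^ k * cmod (f z) \<le> C" "\<And>z. (1 + norm z) ^ k * cmod (g z) \<le> C'" by metis
  have "(1 + norm z) ^ k * cmod (f z - g z) \<le> C + C'" for z
  proof -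
    have "(1 + norm z) ^ k * cmod (f z - g z) \<le> (1 + norm z) ^ k * (cmod (f z) + cmod (g z))"
      by (intro mult_left_mono norm_triangle_ineq4) auto
    with C[of z] show ?thesis by (simp add: distrib_left)
  qed
  then show "\<exists>C. \<forall>z. (1 + norm z) ^ k * cmod (f z - g z) \<le> C" by blast
qed

lemma rapid_add_mult:
  assumes "rapid F" "rapid p" "rapid q"
  shows "rapid (\<lambda>z. F z + p z * q z)"
  unfolding rapid_def
proof
  fix k
  obtain C where C: "\<And>z. (1 + norm z) ^ k * cmod (F z) \<le> C" using assms(1) unfolding rapid_def by metis
  obtain C1 where C1: "\<And>z. (1 + norm z) ^ k * cmod (p z) \<le> C1" using assms(2) unfolding rapid_def by metis
  obtain C2 where C2: "\<And>z. (1 + norm z) ^ 0 * cmod (q z) \<le> C2" using assms(3) unfolding rapid_def by metis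
  have "(1 + norm z) ^ k * cmod (F z + p z * q z) \<le> C + C1 * C2" for z
  proof -
    have "(1 + norm z) ^ k * cmod (F z + p z * q z) \<le> (1 + norm z) ^ k * (cmod (F z) + cmod (p z) * cmod (q z))"
      using norm_triangle_ineq[of "F z" "p z * q z"] by (intro mult_left_mono) (auto simp: norm_mult)
    also have "\<dots> = (1 + norm z) ^ k * cmod (F z) + ((1 + norm z) ^ k * cmod (p z)) * cmod (q z)"
      by (simp add: algebra_simps)
    also have "\<dots> \<le> C + C1 * C2"
    proof (intro add_mono mult_mono C C1)
      show "cmod (q z) \<le> C2" using C2[of z] by simp
      show "0 \<le> C1" using order_trans[OF _ C1[of z]] by auto
    qed auto
    finally show ?thesis .
  qed
  then show "\<exists>C. \<forall>z. (1 + norm z) ^ k * cmod (F z + p z * q z) \<le> C" by blast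
qed

lemma partial_diff:
  assumes "\<And>z. f differentiable (at z)" "\<And>z. g differentiable (at z)"
  shows "dx (\<lambda>z. f z - g z) = (\<lambda>z. dx f z - dx g z)" "dt (\<lambda>z. f z - g z) = (\<lambda>z. dt f z - dt g z)"
proof -
  show "dx (\<lambda>z. f z - g z) = (\<lambda>z. dx f z - dx g z)"
    using vector_derivative_at[OF has_vector_derivative_diff[OF has_partial_x[OF assms(1)] has_partial_x[OF assms(2)]]]
    by (auto simp: dx_def[of "\<lambda>z. f z - g z"])
  show "dt (\<lambda>z. f z - g z) = (\<lambda>z. dt f z - dt g z)"
    using vector_derivative_at[OF has_vector_derivative_diff[OF has_partial_t[OF assms(1)] has_partial_t[OF assms(2)]]]
    by (auto simp: dt_def[of "\<lambda>z. f z - g z"])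
qed

lemma diff_schwartz:
  assumes "f \<in> schwartz" "g \<in> schwartz"
  shows "(\<lambda>z. f z - g z) \<in> schwartz"
proof -
  have x: "(dx ^^ j) (\<lambda>z. f z - g z) = (\<lambda>z. (dx ^^ j) f z - (dx ^^ j) g z)" for j
    by (induction j) (use partial_diff(1) schwartz_part(1)[OF assms(1), of 0] schwartz_part(1)[OF assms(2), of 0] in auto)
  have "part i j (\<lambda>z. f z - g z) = (\<lambda>z. part i j f z - part i j g z)" for i j
    by (induction i) (use x partial_diff(2) schwartz_part(1)[OF assms(1)] schwartz_part(1)[OF assms(2)] in auto)
  then show ?thesis
    using assms by (auto simp: schwartz_iff intro!: rapid_diff differentiable_diff)
qed

text \<open>Finite sums of products of a function in \<open>A\<close> and one in \<open>B\<close>.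
  The Leibniz rule keeps derivatives of a product in such a set, so that no binomial formula has to
  be carried along.\<close>

inductive_set prods :: "plane_fun set \<Rightarrow> plane_fun set \<Rightarrow> plane_fun set" for A B where
  zero: "(\<lambda>z. 0) \<in> prods A B"
| add: "F \<in> prods A B \<Longrightarrow> p \<in> A \<Longrightarrow> q \<in> B \<Longrightarrow> (\<lambda>z. F z + p z * q z) \<in> prods A B"

lemma prods_mono: "F \<in> prods A B \<Longrightarrow> A \<subseteq> A' \<Longrightarrow> B \<subseteq> B' \<Longrightarrow> F \<in> prods A' B'"
  by (induction rule: prods.induct) (auto intro: prods.intros)

lemma prods_differentiable:
  assumes "F \<in> prods A B" "\<And>p z. p \<in> A \<union> B \<Longrightarrow> p differentiable (at z)"
  shows "F differentiable (at z)"
  using assms by (induction rule: prods.induct) (auto intro!: differentiable_add differentiable_mult)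

lemma prods_rapid:
  assumes "F \<in> prods A B" "\<And>p. p \<in> A \<union> B \<Longrightarrow> rapid p"
  shows "rapid F"
  using assms by (induction rule: prods.induct) (auto intro!: rapid_add_mult simp: rapid_def[of "\<lambda>z. 0"])

lemma prods_partial:
  assumes "F \<in> prods A B" and d: "\<And>p z. p \<in> A \<union> B \<Longrightarrow> p differentiable (at z)"
  shows "(\<And>p. p \<in> A \<Longrightarrow> dx p \<in> A) \<Longrightarrow> (\<And>p. p \<in> B \<Longrightarrow> dx p \<in> B) \<Longrightarrow> dx F \<in> prods A B"
    and "(\<And>p. p \<in> A \<Longrightarrow> dt p \<in> A) \<Longrightarrow> (\<And>p. p \<in> B \<Longrightarrow> dt p \<in> B) \<Longrightarrow> dt F \<in> prods A B"
  using assms(1)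
proof (induction rule: prods.induct)
  case zero
  { case 1 show ?case using prods.zero by (simp add: dx_def case_prod_unfold) }
  { case 2 show ?case using prods.zero by (simp add: dt_def case_prod_unfold) }
next
  case (add F p q)
  have dF: "\<And>z. F differentiable (at z)" using prods_differentiable[OF add.hyps(1) d] .
  have dp: "\<And>z. p differentiable (at z)" "\<And>z. q differentiable (at z)" using d add.hyps by auto
  { case 1
    have "dx (\<lambda>z. F z + p z * q z) = (\<lambda>z. (dx F z + p z * dx q z) + dx p z * q z)"
      using vector_derivative_at[OF has_vector_derivative_add[OF has_partial_x[OF dF] has_vector_derivative_mult[OF has_partial_x[OF dp(1)] has_partial_x[OF dp(2)]]]]
      by (auto simp: dx_def[of "\<lambda>z. F z + p z * q z"] add.assoc)
    with add 1 show ?case by (auto intro!: prods.add) }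
  { case 2
    have "dt (\<lambda>z. F z + p z * q z) = (\<lambda>z. (dt F z + p z * dt q z) + dt p z * q z)"
      using vector_derivative_at[OF has_vector_derivative_add[OF has_partial_t[OF dF] has_vector_derivative_mult[OF has_partial_t[OF dp(1)] has_partial_t[OF dp(2)]]]]
      by (auto simp: dt_def[of "\<lambda>z. F z + p z * q z"] add.assoc)
    with add 2 show ?case by (auto intro!: prods.add) }
qed

text \<open>Two stages, in the order in which \<open>part\<close> applies the derivatives:
  \<open>Dx\<close> is closed under \<open>dx\<close>, and the larger \<open>Dtx\<close> under
  \<open>dt\<close>. Thus mixed derivatives never have to be commuted.\<close>

lemma mult_schwartz:
  assumes "u \<in> schwartz" "v \<in> schwartz"
  shows "(\<lambda>z. u z * v z) \<in> schwartz"
proof -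
  define Dx :: "plane_fun \<Rightarrow> plane_fun set" where "Dx f = {(dx ^^ j) f | j. True}" for f
  define Dtx :: "plane_fun \<Rightarrow> plane_fun set" where "Dtx f = {part i j f | i j. True}" for f
  have d: "p differentiable (at z)" "rapid p" if "p \<in> Dtx u \<union> Dtx v" for p z
  proof -
    from that obtain i j f where "p = part i j f" "f \<in> schwartz" using assms unfolding Dtx_def by blast
    then show "p differentiable (at z)" "rapid p" using schwartz_part by blast+
  qed
  have sub: "Dx f \<subseteq> Dtx f" for f
  proof
    fix p assume "p \<in> Dx f"
    then obtain j where "p = part 0 j f" by (auto simp: Dx_def)
    then show "p \<in> Dtx f" unfolding Dtx_def by blast
  qed
  have d0: "p differentiable (at z)" if "p \<in> Dx u \<union> Dx v" for p z
    using that sub by (intro d(1)) blast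
  have Dx: "dx p \<in> Dx f" if mem: "p \<in> Dx f" for p f
  proof -
    obtain j where "p = (dx ^^ j) f" using mem by (auto simp: Dx_def)
    then have "dx p = (dx ^^ Suc j) f" by simp
    then show ?thesis unfolding Dx_def by blast
  qed
  have Dtx: "dt p \<in> Dtx f" if mem: "p \<in> Dtx f" for p f
  proof -
    obtain i j where "p = part i j f" using mem by (auto simp: Dtx_def)
    then have "dt p = part (Suc i) j f" by simp
    then show ?thesis unfolding Dtx_def by blast
  qed
  have x: "(dx ^^ j) (\<lambda>z. u z * v z) \<in> prods (Dx u) (Dx v)" for j
  proof (induction j)
    case 0
    have "f \<in> Dx f" for f by (auto simp: Dx_def intro: exI[of _ 0])
    then have "(\<lambda>z. 0 + u z * v z) \<in> prods (Dx u) (Dx v)"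
      by (intro prods.intros)
    then show ?case by simp
  next
    case (Suc j)
    have "dx ((dx ^^ j) (\<lambda>z. u z * v z)) \<in> prods (Dx u) (Dx v)"
      by (rule prods_partial(1)[OF Suc d0 Dx Dx])
    then show ?case by simp
  qed
  have tx: "part i j (\<lambda>z. u z * v z) \<in> prods (Dtx u) (Dtx v)" for i j
  proof (induction i)
    case 0
    then show ?case using prods_mono[OF x sub sub] by simp
  next
    case (Suc i)
    have "dt (part i j (\<lambda>z. u z * v z)) \<in> prods (Dtx u) (Dtx v)"
      by (rule prods_partial(2)[OF Suc d(1) Dtx Dtx])
    then show ?case by simp
  qed
  show ?thesis
    unfolding schwartz_iff
    by (intro allI conjI prods_differentiable[OF tx d(1)] prods_rapid[OF tx d(2)])
qed

section \<open>The Fourier transform of a product\<close>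

definition gauss :: "real \<times> real \<Rightarrow> real" where
  "gauss z = std_normal_density (fst z) * std_normal_density (snd z)"

lemma gauss_nonneg [simp]: "0 \<le> gauss z" by (simp add: gauss_def)

lemma gauss_le_1: "gauss z \<le> 1"
proof -
  have "std_normal_density x \<le> 1" for x
  proof -
    have "1 \<le> sqrt (2 * pi)" using pi_gt3 by simp
    then have "1 / sqrt (2 * pi) * exp (- x\<^sup>2 / 2) \<le> 1 * 1"
      by (intro mult_mono) (auto simp: divide_le_eq)
    then show ?thesis by (simp add: std_normal_density_def)
  qed
  then have "gauss z \<le> 1 * 1" unfolding gauss_def by (intro mult_mono) auto
  then show ?thesis by simp
qed

lemma gauss_measurable [measurable]: "gauss \<in> borel_measurable borel"
  unfolding gauss_def by measurable

lemma integral_plane_product: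
  fixes f g :: "real \<Rightarrow> complex"
  assumes "integrable lborel f" "integrable lborel g"
  shows "integrable lborel (\<lambda>z::real \<times> real. f (fst z) * g (snd z))"
    "(\<integral>z. f (fst z) * g (snd z) \<partial>lborel) = (\<integral>x. f x \<partial>lborel) * (\<integral>x. g x \<partial>lborel)"
proof -
  note [measurable] = borel_measurable_integrable[OF assms(1)] borel_measurable_integrable[OF assms(2)]
  have int: "integrable (lborel \<Otimes>\<^sub>M lborel) (\<lambda>(x, y). f x * g y)"
    by (rule lborel_pair.Fubini_integrable) (use assms in \<open>auto simp: norm_mult\<close>)
  then show "integrable lborel (\<lambda>z::real \<times> real. f (fst z) * g (snd z))"
    by (simp add: lborel_prod case_prod_unfold)
  show "(\<integral>z. f (fst z) * g (snd z) \<partial>lborel) = (\<integral>x. f x \<partial>lborel) * (\<integral>x. g x \<partial>lborel)"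
    using lborel_pair.integral_fst[OF int] by (simp add: lborel_prod case_prod_unfold)
qed

lemma std_normal_fourier:
  "(\<integral>x. iexp (t * x) * complex_of_real (std_normal_density x) \<partial>lborel) = sqrt (2 * pi) * std_normal_density t"
proof -
  have "(\<integral>x. iexp (t * x) * complex_of_real (std_normal_density x) \<partial>lborel) = char std_normal_distribution t"
    unfolding char_def
    by (subst integral_density) (auto simp: scaleR_conv_of_real mult.commute)
  also have "\<dots> = complex_of_real (exp (- (t\<^sup>2) / 2))" by (simp add: char_std_normal_distribution)
  also have "exp (- (t\<^sup>2) / 2) = sqrt (2 * pi) * std_normal_density t"
    by (simp add: std_normal_density_def)
  finally show ?thesis by simp
qed

lemma std_normal_integrable: "integrable lborel (\<lambda>x. complex_of_real (std_normal_density x))"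
  using integrable_std_normal_moment[of 0] by simp

lemma std_normal_fker_integrable: "integrable lborel (\<lambda>x. iexp (t * x) * complex_of_real (std_normal_density x))"
proof (rule Bochner_Integration.integrable_bound[OF std_normal_integrable])
  have "continuous_on UNIV (\<lambda>x. iexp (t * x))" by (intro continuous_intros)
  then have [measurable]: "(\<lambda>x. iexp (t * x)) \<in> borel_measurable borel" by (rule borel_measurable_continuous_onI)
  show "(\<lambda>x. iexp (t * x) * complex_of_real (std_normal_density x)) \<in> borel_measurable lborel" by measurable
qed (auto simp: norm_mult)

lemma gauss_integrable: "integrable lborel (\<lambda>z. complex_of_real (gauss z))"
  using integral_plane_product(1)[OF std_normal_integrable std_normal_integrable] by (simp add: gauss_def)

text \<open>The standard Gaussian reproduces itself up to \<open>sqrt (2 * pi)\<close> per variable;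
  the minus sign turns the kernel into the one of the characteristic function.\<close>

lemma gauss_fourier: "(\<integral>\<theta>. fker (- y) \<theta> * complex_of_real (gauss \<theta>) \<partial>lborel) = 2 * pi * gauss y"
proof -
  have "fker (- y) \<theta> * complex_of_real (gauss \<theta>) = (iexp (fst y * fst \<theta>) * complex_of_real (std_normal_density (fst \<theta>))) *
     (iexp (snd y * snd \<theta>) * complex_of_real (std_normal_density (snd \<theta>)))" for \<theta>
    by (simp add: fker_def gauss_def mult_ac)
  then have "(\<integral>\<theta>. fker (- y) \<theta> * complex_of_real (gauss \<theta>) \<partial>lborel) = (\<integral>\<theta>. (iexp (fst y * fst \<theta>) * complex_of_real (std_normal_density (fst \<theta>))) *
     (iexp (snd y * snd \<theta>) * complex_of_real (std_normal_density (snd \<theta>))) \<partial>lborel)" by simp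
  also have "\<dots> = (sqrt (2 * pi) * std_normal_density (fst y)) * (sqrt (2 * pi) * std_normal_density (snd y))"
    by (subst integral_plane_product(2)[OF std_normal_fker_integrable std_normal_fker_integrable])
       (simp only: std_normal_fourier, simp)
  also have "\<dots> = complex_of_real ((sqrt (2 * pi) * sqrt (2 * pi)) * gauss y)"
    by (simp add: gauss_def mult_ac)
  also have "sqrt (2 * pi) * sqrt (2 * pi) = 2 * pi" by simp
  finally show ?thesis by simp
qed

lemma gauss_integral: "(\<integral>z. gauss z \<partial>lborel) = 1"
proof -
  have "(\<integral>x. complex_of_real (std_normal_density x) \<partial>lborel) = 1"
    using integral_std_normal_moment_even[of 0] by simp
  then have "(\<integral>z. complex_of_real (gauss z) \<partial>lborel) = 1"
    using integral_plane_product(2)[OF std_normal_integrable std_normal_integrable] by (simp add: gauss_def)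
  then have "complex_of_real (\<integral>z. gauss z \<partial>lborel) = 1" by simp
  then show ?thesis using of_real_eq_1_iff by blast
qed

lemma plane_affine_integral:
  fixes f :: "real \<times> real \<Rightarrow> complex"
  assumes [measurable]: "f \<in> borel_measurable borel" and "c \<noteq> 0"
  shows "(\<integral>z. f z \<partial>lborel) = c\<^sup>2 *\<^sub>R (\<integral>z. f (a + c *\<^sub>R z) \<partial>lborel)"
proof -
  have "(lborel :: (real \<times> real) measure) = density (distr lborel borel (\<lambda>x. a + c *\<^sub>R x)) (\<lambda>_. ennreal (c\<^sup>2))"
    using lborel_affine[OF assms(2), of a] by (simp add: power2_eq_square)
  then have "(\<integral>z. f z \<partial>lborel) = (\<integral>z. f z \<partial>density (distr lborel borel (\<lambda>x. a + c *\<^sub>R x)) (\<lambda>_. ennreal (c\<^sup>2)))"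
    by simp
  also have "\<dots> = (\<integral>z. c\<^sup>2 *\<^sub>R f z \<partial>distr lborel borel (\<lambda>x. a + c *\<^sub>R x))"
    by (rule integral_density) auto
  also have "\<dots> = (\<integral>z. c\<^sup>2 *\<^sub>R f (a + c *\<^sub>R z) \<partial>lborel)"
    by (rule integral_distr) auto
  finally show ?thesis by simp
qed

lemma plane_affine_integrable:
  fixes f :: "real \<times> real \<Rightarrow> complex"
  assumes f: "integrable lborel f" and c: "c \<noteq> 0"
  shows "integrable lborel (\<lambda>z. f (a + c *\<^sub>R z))"
proof (rule integrableI_bounded)
  note [measurable] = borel_measurable_integrable[OF f]
  show "(\<lambda>z. f (a + c *\<^sub>R z)) \<in> borel_measurable lborel" by simp
  have "(lborel :: (real \<times> real) measure) = density (distr lborel borel (\<lambda>x. a + c *\<^sub>R x)) (\<lambda>_. ennreal (c\<^sup>2))"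
    using lborel_affine[OF c, of a] by (simp add: power2_eq_square)
  then have "(\<integral>\<^sup>+z. ennreal (norm (f z)) \<partial>lborel) = (\<integral>\<^sup>+z. ennreal (norm (f z)) \<partial>density (distr lborel borel (\<lambda>x. a + c *\<^sub>R x)) (\<lambda>_. ennreal (c\<^sup>2)))"
    by simp
  also have "\<dots> = ennreal (c\<^sup>2) * (\<integral>\<^sup>+z. ennreal (norm (f (a + c *\<^sub>R z))) \<partial>lborel)"
    by (simp add: nn_integral_density nn_integral_distr nn_integral_cmult)
  finally have "ennreal (c\<^sup>2) * (\<integral>\<^sup>+z. ennreal (norm (f (a + c *\<^sub>R z))) \<partial>lborel) < \<infinity>"
    using f by (simp add: integrable_iff_bounded)
  then show "(\<integral>\<^sup>+z. ennreal (norm (f (a + c *\<^sub>R z))) \<partial>lborel) < \<infinity>"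
    using c by (auto simp: ennreal_mult_less_top)
qed

lemma product_integrable:
  fixes f g :: "real \<times> real \<Rightarrow> complex"
  assumes "integrable lborel f" "integrable lborel g"
    and [measurable]: "case_prod k \<in> borel_measurable (borel \<Otimes>\<^sub>M borel)" and k: "\<And>x y. cmod (k x y) \<le> 1"
  shows "integrable (lborel \<Otimes>\<^sub>M lborel) (\<lambda>(x, y). k x y * (f x * g y))"
proof -
  note [measurable] = borel_measurable_integrable[OF assms(1)] borel_measurable_integrable[OF assms(2)]
  have "integrable (lborel \<Otimes>\<^sub>M lborel) (\<lambda>(x, y). f x * g y)"
    by (rule lborel_pair.Fubini_integrable) (use assms in \<open>auto simp: norm_mult\<close>)
  then show ?thesis
  proof (rule Bochner_Integration.integrable_bound)
    show "AE z in lborel \<Otimes>\<^sub>M lborel. cmod (case z of (x, y) \<Rightarrow> k x y * (f x * g y)) \<le> cmod (case z of (x, y) \<Rightarrow> f x * g y)"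
      using k by (auto simp: norm_mult intro!: AE_I2 mult_left_le_one_le)
  qed simp
qed

text \<open>The mean of \<open>u\<close> under a Gaussian of width \<open>\<epsilon>\<close>. It can
  be written through the transform of \<open>u\<close> with an integrable cutoff, and tends to
  \<open>u\<close> as \<open>\<epsilon>\<close> tends to 0.\<close>

definition mollify :: "real \<Rightarrow> plane_fun \<Rightarrow> plane_fun" where
  "mollify \<epsilon> u z = (\<integral>y. u (z - \<epsilon> *\<^sub>R y) * complex_of_real (gauss y) \<partial>lborel)"

lemma mollify_measurable:
  assumes [measurable]: "u \<in> borel_measurable borel"
  shows "mollify \<epsilon> u \<in> borel_measurable borel"
  unfolding mollify_def[abs_def]
  by (rule lborel.borel_measurable_lebesgue_integral) measurable

lemma mollify_bound:
  assumes [measurable]: "u \<in> borel_measurable borel" and bd: "\<And>z. cmod (u z) \<le> C"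
  shows "cmod (mollify \<epsilon> u z) \<le> C"
proof -
  have g: "integrable lborel (\<lambda>y. C * gauss y)"
    using gauss_integrable by (simp add: complex_of_real_integrable_eq)
  have le: "cmod (u (z - \<epsilon> *\<^sub>R y) * complex_of_real (gauss y)) \<le> C * gauss y" for y
    by (simp add: norm_mult mult_right_mono bd)
  have "cmod (mollify \<epsilon> u z) \<le> (\<integral>y. C * gauss y \<partial>lborel)"
    unfolding mollify_def
  proof (rule Bochner_Integration.integral_norm_bound_integral[OF _ g le])
    show "integrable lborel (\<lambda>y. u (z - \<epsilon> *\<^sub>R y) * complex_of_real (gauss y))"
      by (rule Bochner_Integration.integrable_bound[OF g]) (simp, intro AE_I2 order_trans[OF le], simp)
  qed
  also have "\<dots> = C" using gauss_integral by simp
  finally show ?thesis .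
qed

lemma mollify_tendsto:
  assumes cont: "continuous_on UNIV u" and bd: "\<And>z. cmod (u z) \<le> C"
  shows "(\<lambda>n. mollify (1 / real (Suc n)) u z) \<longlonglongrightarrow> u z"
proof -
  have [measurable]: "u \<in> borel_measurable borel" using cont by (rule borel_measurable_continuous_onI)
  have "(\<lambda>n. \<integral>y. u (z - (1 / real (Suc n)) *\<^sub>R y) * complex_of_real (gauss y) \<partial>lborel) \<longlonglongrightarrow> (\<integral>y. u z * complex_of_real (gauss y) \<partial>lborel)"
  proof (rule integral_dominated_convergence[where w="\<lambda>y. C * gauss y"])
    show "integrable lborel (\<lambda>y. C * gauss y)"
      using gauss_integrable by (simp add: complex_of_real_integrable_eq)
    show "AE y in lborel. (\<lambda>n. u (z - (1 / real (Suc n)) *\<^sub>R y) * complex_of_real (gauss y)) \<longlonglongrightarrow> u z * complex_of_real (gauss y)"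
    proof (rule AE_I2)
      fix y
      have "(\<lambda>n. z - (1 / real (Suc n)) *\<^sub>R y) \<longlonglongrightarrow> z - 0 *\<^sub>R y"
        using LIMSEQ_inverse_real_of_nat by (intro tendsto_intros) (simp add: inverse_eq_divide)
      then have "(\<lambda>n. u (z - (1 / real (Suc n)) *\<^sub>R y)) \<longlonglongrightarrow> u z"
      proof (intro isCont_tendsto_compose[where g=u])
        show "isCont u z" using cont continuous_on_eq_continuous_at open_UNIV by blast
      qed simp
      then show "(\<lambda>n. u (z - (1 / real (Suc n)) *\<^sub>R y) * complex_of_real (gauss y)) \<longlonglongrightarrow> u z * complex_of_real (gauss y)"
        by (intro tendsto_intros)
    qed
    show "AE y in lborel. norm (u (z - (1 / real (Suc n)) *\<^sub>R y) * complex_of_real (gauss y)) \<le> C * gauss y" for n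
      using bd by (intro AE_I2) (simp add: norm_mult mult_right_mono)
  qed measurable
  moreover have "(\<integral>y. complex_of_real (gauss y) \<partial>lborel) = 1" using gauss_integral by simp
  ultimately show ?thesis by (simp add: mollify_def)
qed

text \<open>The Gaussian is written as the transform of a Gaussian, the integrals are exchanged, and
  the variable is rescaled by \<open>\<epsilon>\<close>. In the limit this is Fourier inversion:
  \<open>gauss 0\<close> is 1 / (2 pi), so the usual factor (2 pi)^2 is distributed over both
  sides.\<close>

lemma mollify_eq:
  assumes u: "integrable lborel u" and \<epsilon>: "0 < \<epsilon>"
  shows "2 * pi * mollify \<epsilon> u z = (\<integral>\<eta>. gauss (\<epsilon> *\<^sub>R \<eta>) * (cnj (fker \<eta> z) * fourier u \<eta>) \<partial>lborel)"
proof -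
  note [measurable] = borel_measurable_integrable[OF u] fourier_measurable[OF borel_measurable_integrable[OF u, unfolded measurable_lborel2]]
  let ?v = "\<lambda>y. u (z - \<epsilon> *\<^sub>R y)"
  have v: "integrable lborel ?v"
    using plane_affine_integrable[OF u, of "- \<epsilon>" z] \<epsilon> by simp
  have int: "integrable (lborel \<Otimes>\<^sub>M lborel) (\<lambda>(y, \<theta>). fker (- y) \<theta> * (?v y * complex_of_real (gauss \<theta>)))"
    by (rule product_integrable[OF v gauss_integrable]) auto
  have inner: "(\<integral>y. fker (- y) \<theta> * ?v y \<partial>lborel) = complex_of_real (1 / \<epsilon>\<^sup>2) * (cnj (fker ((1 / \<epsilon>) *\<^sub>R \<theta>) z) * fourier u ((1 / \<epsilon>) *\<^sub>R \<theta>))" for \<theta>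
  proof -
    let ?\<eta> = "(1 / \<epsilon>) *\<^sub>R \<theta>"
    have "fourier u ?\<eta> = (- \<epsilon>)\<^sup>2 *\<^sub>R (\<integral>y. fker ?\<eta> (z + (- \<epsilon>) *\<^sub>R y) * u (z + (- \<epsilon>) *\<^sub>R y) \<partial>lborel)"
      unfolding fourier_eq using \<epsilon> by (intro plane_affine_integral) auto
    also have "(\<lambda>y. fker ?\<eta> (z + (- \<epsilon>) *\<^sub>R y) * u (z + (- \<epsilon>) *\<^sub>R y)) = (\<lambda>y. fker ?\<eta> z * (fker (- y) \<theta> * ?v y))"
    proof
      fix y
      have "snd (z + (- \<epsilon>) *\<^sub>R y) * snd ?\<eta> = snd z * snd ?\<eta> - snd y * snd \<theta>"
        "fst (z + (- \<epsilon>) *\<^sub>R y) * fst ?\<eta> = fst z * fst ?\<eta> - fst y * fst \<theta>"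
        using \<epsilon> by (simp_all add: field_simps)
      then have "fker ?\<eta> (z + (- \<epsilon>) *\<^sub>R y) = fker ?\<eta> z * fker (- y) \<theta>"
        unfolding fker_def by (simp only: exp_add[symmetric]) (simp add: algebra_simps)
      then show "fker ?\<eta> (z + (- \<epsilon>) *\<^sub>R y) * u (z + (- \<epsilon>) *\<^sub>R y) = fker ?\<eta> z * (fker (- y) \<theta> * ?v y)"
        by simp
    qed
    finally have F: "fourier u ?\<eta> = complex_of_real (\<epsilon>\<^sup>2) * (fker ?\<eta> z * (\<integral>y. fker (- y) \<theta> * ?v y \<partial>lborel))"
      by (simp add: scaleR_conv_of_real)
    have 1: "cnj (fker ?\<eta> z) * fker ?\<eta> z = 1"
      by (metis complex_norm_square mult.commute norm_fker of_real_1 power_one)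
    have "cnj (fker ?\<eta> z) * fourier u ?\<eta> = complex_of_real (\<epsilon>\<^sup>2) * ((cnj (fker ?\<eta> z) * fker ?\<eta> z) * (\<integral>y. fker (- y) \<theta> * ?v y \<partial>lborel))"
      unfolding F by (simp only: mult_ac)
    then have "complex_of_real (1 / \<epsilon>\<^sup>2) * (cnj (fker ?\<eta> z) * fourier u ?\<eta>) = complex_of_real (1 / \<epsilon>\<^sup>2) * (complex_of_real (\<epsilon>\<^sup>2) * (\<integral>y. fker (- y) \<theta> * ?v y \<partial>lborel))"
      unfolding 1 by simp
    also have "\<dots> = complex_of_real (1 / \<epsilon>\<^sup>2 * \<epsilon>\<^sup>2) * (\<integral>y. fker (- y) \<theta> * ?v y \<partial>lborel)"
      by (simp only: of_real_mult mult.assoc)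
    also have "1 / \<epsilon>\<^sup>2 * \<epsilon>\<^sup>2 = 1" using \<epsilon> by simp
    finally show ?thesis by simp
  qed
  have "2 * pi * mollify \<epsilon> u z = (\<integral>y. ?v y * (2 * pi * gauss y) \<partial>lborel)"
    unfolding mollify_def by (subst integral_mult_right_zero[symmetric]) (intro Bochner_Integration.integral_cong refl, simp)
  also have "\<dots> = (\<integral>y. ?v y * (\<integral>\<theta>. fker (- y) \<theta> * complex_of_real (gauss \<theta>) \<partial>lborel) \<partial>lborel)"
    unfolding gauss_fourier by simp
  also have "\<dots> = (\<integral>y. (\<integral>\<theta>. fker (- y) \<theta> * (?v y * complex_of_real (gauss \<theta>)) \<partial>lborel) \<partial>lborel)"
  proof (intro Bochner_Integration.integral_cong refl)
    fix y
    show "?v y * (\<integral>\<theta>. fker (- y) \<theta> * complex_of_real (gauss \<theta>) \<partial>lborel) = (\<integral>\<theta>. fker (- y) \<theta> * (?v y * complex_of_real (gauss \<theta>)) \<partial>lborel)"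
      by (subst integral_mult_right_zero[symmetric]) (simp only: mult.left_commute)
  qed
  also have "\<dots> = (\<integral>\<theta>. (\<integral>y. fker (- y) \<theta> * (?v y * complex_of_real (gauss \<theta>)) \<partial>lborel) \<partial>lborel)"
    by (rule lborel_pair.Fubini_integral[OF int, symmetric])
  also have "\<dots> = (\<integral>\<theta>. complex_of_real (1 / \<epsilon>\<^sup>2) * (complex_of_real (gauss \<theta>) * (cnj (fker ((1 / \<epsilon>) *\<^sub>R \<theta>) z) * fourier u ((1 / \<epsilon>) *\<^sub>R \<theta>))) \<partial>lborel)"
  proof (intro Bochner_Integration.integral_cong refl)
    fix \<theta>
    have "(\<integral>y. fker (- y) \<theta> * (?v y * complex_of_real (gauss \<theta>)) \<partial>lborel) = complex_of_real (gauss \<theta>) * (\<integral>y. fker (- y) \<theta> * ?v y \<partial>lborel)"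
      by (subst integral_mult_right_zero[symmetric]) (simp only: mult_ac)
    also have "\<dots> = complex_of_real (1 / \<epsilon>\<^sup>2) * (complex_of_real (gauss \<theta>) * (cnj (fker ((1 / \<epsilon>) *\<^sub>R \<theta>) z) * fourier u ((1 / \<epsilon>) *\<^sub>R \<theta>)))"
      unfolding inner by (simp only: mult.left_commute)
    finally show "(\<integral>y. fker (- y) \<theta> * (?v y * complex_of_real (gauss \<theta>)) \<partial>lborel) = \<dots>" .
  qed
  also have "\<dots> = (1 / \<epsilon>)\<^sup>2 *\<^sub>R (\<integral>\<theta>. complex_of_real (gauss (\<epsilon> *\<^sub>R (0 + (1 / \<epsilon>) *\<^sub>R \<theta>))) * (cnj (fker (0 + (1 / \<epsilon>) *\<^sub>R \<theta>) z) * fourier u (0 + (1 / \<epsilon>) *\<^sub>R \<theta>)) \<partial>lborel)"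
    using \<epsilon> unfolding integral_mult_right_zero by (simp add: scaleR_conv_of_real power_divide)
  also have "\<dots> = (\<integral>\<eta>. gauss (\<epsilon> *\<^sub>R \<eta>) * (cnj (fker \<eta> z) * fourier u \<eta>) \<partial>lborel)"
  proof (rule plane_affine_integral[symmetric])
    have [measurable]: "cnj \<in> borel_measurable borel"
      by (intro borel_measurable_continuous_onI continuous_intros)
    show "(\<lambda>\<eta>. complex_of_real (gauss (\<epsilon> *\<^sub>R \<eta>)) * (cnj (fker \<eta> z) * fourier u \<eta>)) \<in> borel_measurable borel"
      by measurable
  qed (use \<epsilon> in simp)
  finally show ?thesis .
qed

lemma norm_fourier_mollify_mult_le:
  assumes u: "integrable lborel u" and fu: "integrable lborel (fourier u)" and v: "integrable lborel v" and \<epsilon>: "0 < \<epsilon>"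
  shows "ennreal (cmod (fourier (\<lambda>z. mollify \<epsilon> u z * v z) \<zeta>)) \<le> (\<integral>\<^sup>+\<eta>. ennreal (cmod (fourier u \<eta>)) * ennreal (cmod (fourier v (\<zeta> - \<eta>))) \<partial>lborel)"
proof -
  note [measurable] = borel_measurable_integrable[OF u, unfolded measurable_lborel2] borel_measurable_integrable[OF fu, unfolded measurable_lborel2]
    borel_measurable_integrable[OF v, unfolded measurable_lborel2]
  have int: "integrable (lborel \<Otimes>\<^sub>M lborel) (\<lambda>(z, \<eta>). (gauss (\<epsilon> *\<^sub>R \<eta>) * fker (\<zeta> - \<eta>) z) * (v z * fourier u \<eta>))"
    by (rule product_integrable[OF v fu]) (auto simp: norm_mult gauss_le_1)
  have "2 * pi * fourier (\<lambda>z. mollify \<epsilon> u z * v z) \<zeta> = (\<integral>z. fker \<zeta> z * v z * (2 * pi * mollify \<epsilon> u z) \<partial>lborel)"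
    unfolding fourier_eq by (subst integral_mult_right_zero[symmetric]) (intro Bochner_Integration.integral_cong refl, simp only: mult_ac)
  also have "\<dots> = (\<integral>z. (\<integral>\<eta>. (gauss (\<epsilon> *\<^sub>R \<eta>) * fker (\<zeta> - \<eta>) z) * (v z * fourier u \<eta>) \<partial>lborel) \<partial>lborel)"
    unfolding mollify_eq[OF u \<epsilon>]
  proof (intro Bochner_Integration.integral_cong refl)
    fix z
    show "fker \<zeta> z * v z * (\<integral>\<eta>. gauss (\<epsilon> *\<^sub>R \<eta>) * (cnj (fker \<eta> z) * fourier u \<eta>) \<partial>lborel) = (\<integral>\<eta>. (gauss (\<epsilon> *\<^sub>R \<eta>) * fker (\<zeta> - \<eta>) z) * (v z * fourier u \<eta>) \<partial>lborel)"
      unfolding fker_shift[symmetric] by (subst integral_mult_right_zero[symmetric]) (simp only: mult_ac)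
  qed
  also have "\<dots> = (\<integral>\<eta>. (\<integral>z. (gauss (\<epsilon> *\<^sub>R \<eta>) * fker (\<zeta> - \<eta>) z) * (v z * fourier u \<eta>) \<partial>lborel) \<partial>lborel)"
    by (rule lborel_pair.Fubini_integral[OF int, symmetric])
  also have "\<dots> = (\<integral>\<eta>. gauss (\<epsilon> *\<^sub>R \<eta>) * (fourier u \<eta> * fourier v (\<zeta> - \<eta>)) \<partial>lborel)"
    unfolding fourier_eq[of v]
  proof (intro Bochner_Integration.integral_cong refl)
    fix \<eta>
    have "(\<integral>z. (gauss (\<epsilon> *\<^sub>R \<eta>) * fker (\<zeta> - \<eta>) z) * (v z * fourier u \<eta>) \<partial>lborel) = (\<integral>z. (gauss (\<epsilon> *\<^sub>R \<eta>) * fourier u \<eta>) * (fker (\<zeta> - \<eta>) z * v z) \<partial>lborel)"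
      by (simp only: mult_ac)
    also have "\<dots> = (gauss (\<epsilon> *\<^sub>R \<eta>) * fourier u \<eta>) * (\<integral>z. fker (\<zeta> - \<eta>) z * v z \<partial>lborel)"
      by (rule integral_mult_right_zero)
    finally show "(\<integral>z. (gauss (\<epsilon> *\<^sub>R \<eta>) * fker (\<zeta> - \<eta>) z) * (v z * fourier u \<eta>) \<partial>lborel) = gauss (\<epsilon> *\<^sub>R \<eta>) * (fourier u \<eta> * (\<integral>z. fker (\<zeta> - \<eta>) z * v z \<partial>lborel))"
      by (simp only: mult.assoc)
  qed
  finally have eq: "2 * pi * fourier (\<lambda>z. mollify \<epsilon> u z * v z) \<zeta> = (\<integral>\<eta>. gauss (\<epsilon> *\<^sub>R \<eta>) * (fourier u \<eta> * fourier v (\<zeta> - \<eta>)) \<partial>lborel)" .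
  \<comment> \<open>Only an inequality is kept: the factor 2 pi is at least 1 and the cutoff is at
    most 1.\<close>
  have "cmod (fourier (\<lambda>z. mollify \<epsilon> u z * v z) \<zeta>) \<le> cmod (2 * pi * fourier (\<lambda>z. mollify \<epsilon> u z * v z) \<zeta>)"
    using pi_gt3 by (simp add: norm_mult mult_le_cancel_right1)
  then have "ennreal (cmod (fourier (\<lambda>z. mollify \<epsilon> u z * v z) \<zeta>)) \<le> ennreal (cmod (\<integral>\<eta>. gauss (\<epsilon> *\<^sub>R \<eta>) * (fourier u \<eta> * fourier v (\<zeta> - \<eta>)) \<partial>lborel))"
    unfolding eq by (rule ennreal_leI)
  also have "\<dots> \<le> (\<integral>\<^sup>+\<eta>. ennreal (cmod (gauss (\<epsilon> *\<^sub>R \<eta>) * (fourier u \<eta> * fourier v (\<zeta> - \<eta>)))) \<partial>lborel)"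
  proof (rule integral_norm_bound_ennreal, rule Bochner_Integration.integrable_bound[OF fu[THEN integrable_norm, THEN integrable_mult_right, of "\<integral>z. cmod (v z) \<partial>lborel"]])
    note [measurable] = fourier_measurable[of v]
    show "(\<lambda>\<eta>. gauss (\<epsilon> *\<^sub>R \<eta>) * (fourier u \<eta> * fourier v (\<zeta> - \<eta>))) \<in> borel_measurable lborel"
      by measurable
    have "cmod (fourier u \<eta>) * (gauss (\<epsilon> *\<^sub>R \<eta>) * cmod (fourier v (\<zeta> - \<eta>))) \<le> cmod (fourier u \<eta>) * (1 * (\<integral>z. cmod (v z) \<partial>lborel))" for \<eta>
      by (intro mult_left_mono mult_mono gauss_le_1 norm_fourier_le v) auto
    then show "AE \<eta> in lborel. cmod (gauss (\<epsilon> *\<^sub>R \<eta>) * (fourier u \<eta> * fourier v (\<zeta> - \<eta>))) \<le> norm ((\<integral>z. cmod (v z) \<partial>lborel) * norm (fourier u \<eta>))"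
      by (intro AE_I2) (simp add: norm_mult mult_ac)
  qed
  also have "\<dots> \<le> (\<integral>\<^sup>+\<eta>. ennreal (cmod (fourier u \<eta>)) * ennreal (cmod (fourier v (\<zeta> - \<eta>))) \<partial>lborel)"
  proof (intro nn_integral_mono)
    fix \<eta>
    have "cmod (gauss (\<epsilon> *\<^sub>R \<eta>) * (fourier u \<eta> * fourier v (\<zeta> - \<eta>))) \<le> cmod (fourier u \<eta>) * cmod (fourier v (\<zeta> - \<eta>))"
      by (simp add: norm_mult gauss_le_1 mult_left_le_one_le)
    then show "ennreal (cmod (gauss (\<epsilon> *\<^sub>R \<eta>) * (fourier u \<eta> * fourier v (\<zeta> - \<eta>)))) \<le> ennreal (cmod (fourier u \<eta>)) * ennreal (cmod (fourier v (\<zeta> - \<eta>)))"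
      by (subst ennreal_mult[symmetric]) (auto intro: ennreal_leI)
  qed
  finally show ?thesis .
qed

lemma fourier_schwartz_integrable:
  assumes "u \<in> schwartz"
  shows "integrable lborel (fourier u)"
proof -
  obtain C where C: "0 \<le> C" "\<And>\<zeta>. cmod (fourier u \<zeta>) \<le> C * (jb (fst \<zeta>) powr (- real 2) * jb (snd \<zeta>) powr (- real 2))"
    using fourier_rapid[OF assms, of 2] by blast
  have [measurable]: "fourier u \<in> borel_measurable borel"
    by (intro fourier_measurable decaying_measurable schwartz_decaying0 assms)
  show ?thesis
    by (rule Bochner_Integration.integrable_bound[OF integrable_mult_right[OF plane_weight_integrable, of C]])
       (use C in \<open>auto intro!: AE_I2 order_trans[OF C(2)]\<close>)
qed

text \<open>The bound for the mollified function does not depend on its width, so it passes to the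
  limit; \<open>C * cmod (v z)\<close> dominates the integrands.\<close>

lemma norm_fourier_mult_le:
  assumes "u \<in> schwartz" "v \<in> schwartz"
  shows "ennreal (cmod (fourier (\<lambda>z. u z * v z) \<zeta>)) \<le> (\<integral>\<^sup>+\<eta>. ennreal (cmod (fourier u \<eta>)) * ennreal (cmod (fourier v (\<zeta> - \<eta>))) \<partial>lborel)"
proof -
  have du: "decaying u" and dv: "decaying v" using assms schwartz_decaying0 by auto
  have u: "integrable lborel u" and v: "integrable lborel v" using du dv decaying_integrable by auto
  note [measurable] = decaying_measurable[OF du] decaying_measurable[OF dv] mollify_measurable[OF decaying_measurable[OF du]]
  obtain C where C: "0 \<le> C" "\<And>z. cmod (u z) \<le> C" using decaying_bounded[OF du] by blast
  have "(\<lambda>n. fourier (\<lambda>z. mollify (1 / real (Suc n)) u z * v z) \<zeta>) \<longlonglongrightarrow> fourier (\<lambda>z. u z * v z) \<zeta>"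
    unfolding fourier_eq
  proof (rule integral_dominated_convergence[where w="\<lambda>z. C * cmod (v z)"])
    show "integrable lborel (\<lambda>z. C * cmod (v z))" using v by simp
    show "AE z in lborel. (\<lambda>n. fker \<zeta> z * (mollify (1 / real (Suc n)) u z * v z)) \<longlonglongrightarrow> fker \<zeta> z * (u z * v z)"
      using du C by (intro AE_I2 tendsto_intros mollify_tendsto[where C=C]) (auto simp: decaying_def)
    show "AE z in lborel. cmod (fker \<zeta> z * (mollify (1 / real (Suc n)) u z * v z)) \<le> C * cmod (v z)" for n
      by (intro AE_I2) (simp add: norm_mult mult_right_mono mollify_bound[OF _ C(2)])
  qed measurable
  then have "(\<lambda>n. ennreal (cmod (fourier (\<lambda>z. mollify (1 / real (Suc n)) u z * v z) \<zeta>))) \<longlonglongrightarrow> ennreal (cmod (fourier (\<lambda>z. u z * v z) \<zeta>))"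
    by (intro tendsto_ennrealI tendsto_norm)
  then show ?thesis
    by (rule LIMSEQ_le_const2)
       (use norm_fourier_mollify_mult_le[OF u fourier_schwartz_integrable[OF assms(1)] v] in auto)
qed

section \<open>Weighted norms of Schwartz functions\<close>

text \<open>Polynomially bounded weights, for which the weighted norm of a Schwartz function is
  finite. All three norms are of this kind, so their properties are proved once.\<close>

definition tempered :: "(real \<times> real \<Rightarrow> real) \<Rightarrow> bool" where
  "tempered W \<longleftrightarrow> W \<in> borel_measurable borel \<and> (\<forall>\<zeta>. 0 \<le> W \<zeta>) \<and>
     (\<exists>C N. \<forall>\<zeta>. W \<zeta> \<le> C * (jb (fst \<zeta>) powr real N * jb (snd \<zeta>) powr real N))"

definition wnorm :: "(real \<times> real \<Rightarrow> real) \<Rightarrow> plane_fun \<Rightarrow> real" where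
  "wnorm W f = sqrt (\<integral>\<zeta>. W \<zeta> * (cmod (fourier f \<zeta>))\<^sup>2 \<partial>lborel)"

lemma tempered_nonneg: "tempered W \<Longrightarrow> 0 \<le> W \<zeta>"
  unfolding tempered_def by blast

lemma tempered_measurable: "tempered W \<Longrightarrow> W \<in> borel_measurable borel"
  by (simp add: tempered_def)

lemma tempered_mult:
  assumes "tempered W" "tempered W'"
  shows "tempered (\<lambda>\<zeta>. W \<zeta> * W' \<zeta>)"
proof -
  obtain C N where C: "\<And>\<zeta>. W \<zeta> \<le> C * (jb (fst \<zeta>) powr real N * jb (snd \<zeta>) powr real N)"
    using assms(1) unfolding tempered_def by blast
  obtain C' N' where C': "\<And>\<zeta>. W' \<zeta> \<le> C' * (jb (fst \<zeta>) powr real N' * jb (snd \<zeta>) powr real N')"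
    using assms(2) unfolding tempered_def by blast
  have nn: "0 \<le> W \<zeta>" "0 \<le> W' \<zeta>" for \<zeta> using assms tempered_nonneg by auto
  have "W \<zeta> * W' \<zeta> \<le> (C * C') * (jb (fst \<zeta>) powr real (N + N') * jb (snd \<zeta>) powr real (N + N'))" for \<zeta>
  proof -
    have "W \<zeta> * W' \<zeta> \<le> (C * (jb (fst \<zeta>) powr real N * jb (snd \<zeta>) powr real N)) * (C' * (jb (fst \<zeta>) powr real N' * jb (snd \<zeta>) powr real N'))"
      by (rule mult_mono[OF C C']) (use nn order_trans[OF nn(1) C] in auto)
    then show ?thesis by (simp add: powr_add mult_ac)
  qed
  moreover have "(\<lambda>\<zeta>. W \<zeta> * W' \<zeta>) \<in> borel_measurable borel" using assms by (auto simp: tempered_def)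
  ultimately show ?thesis unfolding tempered_def using nn by (blast intro: mult_nonneg_nonneg)
qed

text \<open>As \<open>f\<close> is at least 1, any real exponent, negative ones included, may be
  raised to a natural number.\<close>

lemma tempered_powr:
  assumes [measurable]: "f \<in> borel_measurable borel" and f: "\<And>\<zeta>. 1 \<le> f \<zeta>"
    and le: "\<And>\<zeta>. f \<zeta> \<le> C * (jb (fst \<zeta>) powr real N * jb (snd \<zeta>) powr real N)"
  shows "tempered (\<lambda>\<zeta>. f \<zeta> powr p)"
proof -
  define M where "M = nat \<lceil>\<bar>p\<bar>\<rceil>"
  have M: "p \<le> real M" unfolding M_def by linarith
  have C: "0 \<le> C"
  proof (rule ccontr)
    assume "\<not> 0 \<le> C"
    then have "C * (jb (fst (0::real \<times> real)) powr real N * jb (snd (0::real \<times> real)) powr real N) \<le> 0"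
      by (intro mult_nonpos_nonneg) auto
    then show False using le[of 0] f[of 0] by linarith
  qed
  have "f \<zeta> powr p \<le> C powr real M * (jb (fst \<zeta>) powr real (N * M) * jb (snd \<zeta>) powr real (N * M))" for \<zeta>
  proof -
    have "f \<zeta> powr p \<le> f \<zeta> powr real M" using f M by (rule powr_mono[rotated])
    also have "\<dots> \<le> (C * (jb (fst \<zeta>) powr real N * jb (snd \<zeta>) powr real N)) powr real M"
      using f[of \<zeta>] le[of \<zeta>] by (intro powr_mono2) auto
    also have "\<dots> = C powr real M * (jb (fst \<zeta>) powr real (N * M) * jb (snd \<zeta>) powr real (N * M))"
      using C by (simp add: powr_mult powr_powr)
    finally show ?thesis .
  qed
  then show ?thesis unfolding tempered_def by (auto intro!: exI[of _ "C powr real M"] exI[of _ "N * M"])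
qed

lemma tempered_jb_fst: "tempered (\<lambda>\<zeta>. jb (fst \<zeta>) powr p)"
proof (rule tempered_powr[where C=1 and N=1])
  fix \<zeta> :: "real \<times> real"
  have "jb (fst \<zeta>) * 1 \<le> jb (fst \<zeta>) * jb (snd \<zeta>)" by (intro mult_left_mono jb_ge_1) auto
  then show "jb (fst \<zeta>) \<le> 1 * (jb (fst \<zeta>) powr real 1 * jb (snd \<zeta>) powr real 1)" by simp
qed (auto simp: jb_ge_1)

lemma tempered_jb_snd: "tempered (\<lambda>\<zeta>. jb (snd \<zeta>) powr p)"
proof (rule tempered_powr[where C=1 and N=1])
  fix \<zeta> :: "real \<times> real"
  have "1 * jb (snd \<zeta>) \<le> jb (fst \<zeta>) * jb (snd \<zeta>)" by (intro mult_right_mono jb_ge_1) auto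
  then show "jb (snd \<zeta>) \<le> 1 * (jb (fst \<zeta>) powr real 1 * jb (snd \<zeta>) powr real 1)" by simp
qed (auto simp: jb_ge_1)

lemma md_le: "md \<zeta> \<le> jb (fst \<zeta>) + \<bar>snd \<zeta>\<bar> ^ 5"
  using jb_add_abs[of "fst \<zeta>" "- (snd \<zeta> ^ 5)"] by (simp add: md_def power_abs)

lemma tempered_md: "tempered (\<lambda>\<zeta>. md \<zeta> powr p)"
proof (rule tempered_powr[where C=2 and N=5])
  fix \<zeta> :: "real \<times> real"
  have "\<bar>snd \<zeta>\<bar> ^ 5 \<le> jb (snd \<zeta>) ^ 5" by (rule power_mono[OF abs_le_jb]) simp
  then have "md \<zeta> \<le> jb (fst \<zeta>) + jb (snd \<zeta>) ^ 5"
    using md_le[of \<zeta>] by linarith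
  also have "\<dots> \<le> jb (fst \<zeta>) ^ 5 * jb (snd \<zeta>) ^ 5 + jb (fst \<zeta>) ^ 5 * jb (snd \<zeta>) ^ 5"
  proof (rule add_mono)
    have "jb (fst \<zeta>) ^ 1 * 1 \<le> jb (fst \<zeta>) ^ 5 * jb (snd \<zeta>) ^ 5"
      by (intro mult_mono power_increasing one_le_power jb_ge_1) auto
    then show "jb (fst \<zeta>) \<le> jb (fst \<zeta>) ^ 5 * jb (snd \<zeta>) ^ 5" by simp
    have "1 * jb (snd \<zeta>) ^ 5 \<le> jb (fst \<zeta>) ^ 5 * jb (snd \<zeta>) ^ 5"
      by (intro mult_right_mono one_le_power jb_ge_1) auto
    then show "jb (snd \<zeta>) ^ 5 \<le> jb (fst \<zeta>) ^ 5 * jb (snd \<zeta>) ^ 5" by simp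
  qed
  finally show "md \<zeta> \<le> 2 * (jb (fst \<zeta>) powr real 5 * jb (snd \<zeta>) powr real 5)"
    by (simp add: powr_realpow[of _ 5, simplified])
qed (auto simp: md_ge_1)

lemma tempered_low: "tempered (\<lambda>\<zeta>. indicator {\<xi>::real. \<bar>\<xi>\<bar> \<le> 1} (snd \<zeta>))"
  unfolding tempered_def
proof (intro conjI allI exI)
  have [measurable]: "{\<xi>::real. \<bar>\<xi>\<bar> \<le> 1} \<in> sets borel" by measurable
  show "(\<lambda>\<zeta>::real \<times> real. indicator {\<xi>::real. \<bar>\<xi>\<bar> \<le> 1} (snd \<zeta>) :: real) \<in> borel_measurable borel" by measurable
  show "indicator {\<xi>::real. \<bar>\<xi>\<bar> \<le> 1} (snd \<zeta>) \<le> 1 * (jb (fst \<zeta>) powr real 0 * jb (snd \<zeta>) powr real 0)" for \<zeta>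
    by (auto split: split_indicator)
qed auto

lemma wnorm_integrable:
  assumes "tempered W" "f \<in> schwartz"
  shows "integrable lborel (\<lambda>\<zeta>. W \<zeta> * (cmod (fourier f \<zeta>))\<^sup>2)"
proof -
  have [measurable]: "W \<in> borel_measurable borel" and W0: "\<And>\<zeta>. 0 \<le> W \<zeta>" using assms(1) tempered_measurable tempered_nonneg by auto
  obtain C N where C: "\<And>\<zeta>. W \<zeta> \<le> C * (jb (fst \<zeta>) powr real N * jb (snd \<zeta>) powr real N)"
    using assms(1) unfolding tempered_def by blast
  \<comment> \<open>Two orders beyond the growth of \<open>W\<close> leave an integrable weight; one
    factor of the square supplies this decay, the other is merely bounded.\<close>
  obtain B where B: "0 \<le> B" "\<And>\<zeta>. cmod (fourier f \<zeta>) \<le> B * (jb (fst \<zeta>) powr (- real (N + 2)) * jb (snd \<zeta>) powr (- real (N + 2)))"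
    using fourier_rapid[OF assms(2), of "N + 2"] by blast
  have [measurable]: "fourier f \<in> borel_measurable borel"
    by (intro fourier_measurable decaying_measurable schwartz_decaying0 assms)
  have B1: "cmod (fourier f \<zeta>) \<le> B" for \<zeta>
  proof -
    have "cmod (fourier f \<zeta>) \<le> B * (1 * 1)"
      by (rule order_trans[OF B(2)], intro mult_left_mono mult_mono jb_powr_neg_le_1) (use B in auto)
    then show ?thesis by simp
  qed
  have p: "jb y powr real N * jb y powr (- real (N + 2)) = jb y powr (- 2)" for y
    unfolding powr_add[symmetric] by simp
  have le: "W \<zeta> * (cmod (fourier f \<zeta>))\<^sup>2 \<le> (C * B * B) * (jb (fst \<zeta>) powr (- 2) * jb (snd \<zeta>) powr (- 2))" for \<zeta>
  proof -
    have "W \<zeta> * (cmod (fourier f \<zeta>) * cmod (fourier f \<zeta>)) \<le>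
      (C * (jb (fst \<zeta>) powr real N * jb (snd \<zeta>) powr real N)) * ((B * (jb (fst \<zeta>) powr (- real (N + 2)) * jb (snd \<zeta>) powr (- real (N + 2)))) * B)"
    proof (rule mult_mono[OF C])
      show "cmod (fourier f \<zeta>) * cmod (fourier f \<zeta>) \<le> B * (jb (fst \<zeta>) powr (- real (N + 2)) * jb (snd \<zeta>) powr (- real (N + 2))) * B"
        by (rule mult_mono[OF B(2) B1]) (use B in auto)
      show "0 \<le> C * (jb (fst \<zeta>) powr real N * jb (snd \<zeta>) powr real N)" using order_trans[OF W0 C] .
    qed auto
    also have "\<dots> = (C * B * B) * ((jb (fst \<zeta>) powr real N * jb (fst \<zeta>) powr (- real (N + 2))) * (jb (snd \<zeta>) powr real N * jb (snd \<zeta>) powr (- real (N + 2))))"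
      by (simp only: mult_ac)
    finally show ?thesis unfolding p by (simp only: power2_eq_square)
  qed
  show ?thesis
  proof (rule Bochner_Integration.integrable_bound[OF integrable_mult_right[OF plane_weight_integrable, of "C * B * B"]])
    show "AE \<zeta> in lborel. norm (W \<zeta> * (cmod (fourier f \<zeta>))\<^sup>2) \<le> norm ((C * B * B) * (jb (fst \<zeta>) powr (- 2) * jb (snd \<zeta>) powr (- 2)))"
    proof (rule AE_I2)
      fix \<zeta>
      have "norm (W \<zeta> * (cmod (fourier f \<zeta>))\<^sup>2) = W \<zeta> * (cmod (fourier f \<zeta>))\<^sup>2"
        using W0 by (simp add: abs_mult)
      also have "\<dots> \<le> norm ((C * B * B) * (jb (fst \<zeta>) powr (- 2) * jb (snd \<zeta>) powr (- 2)))"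
        by (rule order_trans[OF le]) (simp only: real_norm_def abs_ge_self)
      finally show "norm (W \<zeta> * (cmod (fourier f \<zeta>))\<^sup>2) \<le> norm ((C * B * B) * (jb (fst \<zeta>) powr (- 2) * jb (snd \<zeta>) powr (- 2)))" .
    qed
  qed measurable
qed

lemma wnorm_square:
  assumes "\<And>\<zeta>. 0 \<le> W \<zeta>"
  shows "(wnorm W f)\<^sup>2 = (\<integral>\<zeta>. W \<zeta> * (cmod (fourier f \<zeta>))\<^sup>2 \<partial>lborel)"
  unfolding wnorm_def using assms by (intro real_sqrt_pow2 integral_nonneg_AE) auto

lemma wnorm_nonneg: "tempered W \<Longrightarrow> 0 \<le> wnorm W f"
  unfolding wnorm_def by (intro real_sqrt_ge_zero integral_nonneg_AE) (simp add: tempered_nonneg)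

lemma wnorm_nn_integral:
  assumes "tempered W" "f \<in> schwartz"
  shows "(\<integral>\<^sup>+\<zeta>. ennreal (W \<zeta> * (cmod (fourier f \<zeta>))\<^sup>2) \<partial>lborel) = ennreal ((wnorm W f)\<^sup>2)"
proof -
  have W: "\<And>\<zeta>. 0 \<le> W \<zeta>" using assms(1) by (rule tempered_nonneg)
  show ?thesis
    unfolding wnorm_square[OF W]
    by (rule nn_integral_eq_integral[OF wnorm_integrable[OF assms]]) (use W in auto)
qed

lemma power2_sum_weighted:
  fixes x y r :: real
  assumes "0 < r"
  shows "(x + y)\<^sup>2 \<le> (1 + r) * x\<^sup>2 + (1 + 1 / r) * y\<^sup>2"
proof -
  have "0 \<le> (r * x - y)\<^sup>2 / r" using assms by simp
  also have "(r * x - y)\<^sup>2 / r = r * x\<^sup>2 + (1 / r) * y\<^sup>2 - 2 * x * y"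
    using assms by (simp add: power2_eq_square field_simps)
  finally show ?thesis by (simp add: power2_sum algebra_simps)
qed

text \<open>Minkowski's inequality: the optimal \<open>r\<close> in the previous lemma is the quotient of the norms.\<close>

lemma wnorm_triangle:
  assumes W: "tempered W" and f: "f \<in> schwartz" and g: "g \<in> schwartz"
  shows "wnorm W (\<lambda>z. f z - g z) \<le> wnorm W f + wnorm W g"
proof -
  have W0: "\<And>\<zeta>. 0 \<le> W \<zeta>" using W by (rule tempered_nonneg)
  let ?A = "wnorm W f" and ?B = "wnorm W g"
  have nn: "0 \<le> ?A" "0 \<le> ?B" using wnorm_nonneg[OF W] by auto
  have "wnorm W (\<lambda>z. f z - g z) \<le> ?A + ?B + e" if e: "0 < e" for e
  proof -
    \<comment> \<open>Both norms are enlarged to positive numbers so that their quotient exists even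
      if one of them vanishes.\<close>
    let ?a = "?A + e / 2" and ?b = "?B + e / 2"
    have ab: "0 < ?a" "0 < ?b" using nn e by auto
    let ?r = "?b / ?a"
    have r: "0 < ?r" using ab by simp
    have "(wnorm W (\<lambda>z. f z - g z))\<^sup>2 = (\<integral>\<zeta>. W \<zeta> * (cmod (fourier (\<lambda>z. f z - g z) \<zeta>))\<^sup>2 \<partial>lborel)"
      by (rule wnorm_square[OF W0])
    also have "\<dots> \<le> (\<integral>\<zeta>. (1 + ?r) * (W \<zeta> * (cmod (fourier f \<zeta>))\<^sup>2) + (1 + 1 / ?r) * (W \<zeta> * (cmod (fourier g \<zeta>))\<^sup>2) \<partial>lborel)"
    proof (rule integral_mono)
      show "integrable lborel (\<lambda>\<zeta>. W \<zeta> * (cmod (fourier (\<lambda>z. f z - g z) \<zeta>))\<^sup>2)"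
        by (intro wnorm_integrable W diff_schwartz f g)
      show "integrable lborel (\<lambda>\<zeta>. (1 + ?r) * (W \<zeta> * (cmod (fourier f \<zeta>))\<^sup>2) + (1 + 1 / ?r) * (W \<zeta> * (cmod (fourier g \<zeta>))\<^sup>2))"
        by (intro Bochner_Integration.integrable_add integrable_mult_right wnorm_integrable W f g)
      fix \<zeta>
      have "fourier (\<lambda>z. f z - g z) \<zeta> = fourier f \<zeta> - fourier g \<zeta>"
        by (intro fourier_diff decaying_integrable schwartz_decaying0 f g)
      then have "(cmod (fourier (\<lambda>z. f z - g z) \<zeta>))\<^sup>2 \<le> (cmod (fourier f \<zeta>) + cmod (fourier g \<zeta>))\<^sup>2"
        by (intro power_mono) (auto intro: norm_triangle_ineq4)
      also have "\<dots> \<le> (1 + ?r) * (cmod (fourier f \<zeta>))\<^sup>2 + (1 + 1 / ?r) * (cmod (fourier g \<zeta>))\<^sup>2"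
        by (rule power2_sum_weighted[OF r])
      finally have "W \<zeta> * (cmod (fourier (\<lambda>z. f z - g z) \<zeta>))\<^sup>2 \<le> W \<zeta> * ((1 + ?r) * (cmod (fourier f \<zeta>))\<^sup>2 + (1 + 1 / ?r) * (cmod (fourier g \<zeta>))\<^sup>2)"
        by (rule mult_left_mono[OF _ W0])
      then show "W \<zeta> * (cmod (fourier (\<lambda>z. f z - g z) \<zeta>))\<^sup>2 \<le> (1 + ?r) * (W \<zeta> * (cmod (fourier f \<zeta>))\<^sup>2) + (1 + 1 / ?r) * (W \<zeta> * (cmod (fourier g \<zeta>))\<^sup>2)"
        by (simp only: distrib_left mult.left_commute)
    qed
    also have "\<dots> = (1 + ?r) * ?A\<^sup>2 + (1 + 1 / ?r) * ?B\<^sup>2"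
      unfolding wnorm_square[OF W0]
      by (subst Bochner_Integration.integral_add) (intro integrable_mult_right wnorm_integrable W f g, intro integrable_mult_right wnorm_integrable W f g, simp)
    also have "\<dots> \<le> (1 + ?r) * ?a\<^sup>2 + (1 + 1 / ?r) * ?b\<^sup>2"
      using r e nn by (intro add_mono mult_left_mono power_mono) auto
    also have "\<dots> = (?a + ?b)\<^sup>2"
    proof -
      have "(1 + b / a) * a\<^sup>2 + (1 + 1 / (b / a)) * b\<^sup>2 = (a + b)\<^sup>2" if "0 < a" "0 < b" for a b :: real
        using that by (simp add: field_simps power2_eq_square)
      then show ?thesis using ab .
    qed
    finally have "(wnorm W (\<lambda>z. f z - g z))\<^sup>2 \<le> (?a + ?b)\<^sup>2" .
    then have "wnorm W (\<lambda>z. f z - g z) \<le> ?a + ?b"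
      by (rule power2_le_imp_le) (use ab in linarith)
    then show ?thesis by linarith
  qed
  then show ?thesis by (rule field_le_epsilon)
qed

lemma wnorm_zero: "wnorm W (\<lambda>z. 0) = 0"
  by (simp add: wnorm_def fourier_eq)

section \<open>The bilinear estimate for Schwartz functions\<close>

text \<open>By homogeneity. The radii are positive upper bounds, not the norms themselves, so that
  functions of norm zero are covered as well.\<close>

lemma bdd_mult_bound:
  assumes "bdd_mult m"
  obtains C where "0 \<le> C" "\<And>f g h A B D. f \<in> borel_measurable borel \<Longrightarrow> g \<in> borel_measurable borel \<Longrightarrow> h \<in> borel_measurable borel \<Longrightarrow>
    0 < A \<Longrightarrow> 0 < B \<Longrightarrow> 0 < D \<Longrightarrow> (\<integral>\<^sup>+z. f z ^ 2 \<partial>lborel) \<le> ennreal (A\<^sup>2) \<Longrightarrow> (\<integral>\<^sup>+z. g z ^ 2 \<partial>lborel) \<le> ennreal (B\<^sup>2) \<Longrightarrow>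
    (\<integral>\<^sup>+z. h z ^ 2 \<partial>lborel) \<le> ennreal (D\<^sup>2) \<Longrightarrow> trilin m f g h \<le> ennreal (C * A * B * D)"
proof -
  obtain C where C: "C \<ge> 0" "\<And>f g h. f \<in> unit_ball \<Longrightarrow> g \<in> unit_ball \<Longrightarrow> h \<in> unit_ball \<Longrightarrow> trilin m f g h \<le> ennreal C"
    by (rule bdd_multE[OF assms]) blast
  have norm: "(\<lambda>z. ennreal (1 / A) * f z) \<in> unit_ball"
    if "f \<in> borel_measurable borel" "0 < A" "(\<integral>\<^sup>+z. f z ^ 2 \<partial>lborel) \<le> ennreal (A\<^sup>2)" for f A
  proof -
    note [measurable] = that(1)
    have "(\<integral>\<^sup>+z. (ennreal (1 / A) * f z)\<^sup>2 \<partial>lborel) = ennreal ((1 / A)\<^sup>2) * (\<integral>\<^sup>+z. f z ^ 2 \<partial>lborel)"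
      using that(2) by (simp add: power_mult_distrib ennreal_power nn_integral_cmult)
    also have "\<dots> \<le> ennreal ((1 / A)\<^sup>2) * ennreal (A\<^sup>2)" by (rule mult_left_mono[OF that(3)]) simp
    also have "\<dots> = 1" using that(2) by (simp add: ennreal_mult[symmetric] power_divide)
    finally show ?thesis by (simp add: unit_ball_def)
  qed
  show ?thesis
  proof (rule that[OF C(1)])
    fix f g h :: "real \<times> real \<Rightarrow> ennreal" and A B D :: real
    assume m: "f \<in> borel_measurable borel" "g \<in> borel_measurable borel" "h \<in> borel_measurable borel"
      and pos: "0 < A" "0 < B" "0 < D"
      and le: "(\<integral>\<^sup>+z. f z ^ 2 \<partial>lborel) \<le> ennreal (A\<^sup>2)" "(\<integral>\<^sup>+z. g z ^ 2 \<partial>lborel) \<le> ennreal (B\<^sup>2)" "(\<integral>\<^sup>+z. h z ^ 2 \<partial>lborel) \<le> ennreal (D\<^sup>2)"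
    note [measurable] = m bdd_mult_meas[OF assms]
    let ?f = "\<lambda>z. ennreal (1 / A) * f z" and ?g = "\<lambda>z. ennreal (1 / B) * g z" and ?h = "\<lambda>z. ennreal (1 / D) * h z"
    have "trilin m ?f ?g ?h = (\<integral>\<^sup>+a. \<integral>\<^sup>+c. ennreal (1 / A * (1 / B) * (1 / D)) * (ennreal (m a c) * f a * g c * h (a + c)) \<partial>lborel \<partial>lborel)"
    proof -
      have "ennreal (1 / A * (1 / B) * (1 / D)) = ennreal (1 / A) * ennreal (1 / B) * ennreal (1 / D)"
      proof -
        have "0 \<le> 1 / A" "0 \<le> 1 / B" "0 \<le> 1 / D" using pos by auto
        then show ?thesis by (simp only: ennreal_mult mult_nonneg_nonneg)
      qed
      then show ?thesis unfolding trilin_def by (simp only: mult_ac)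
    qed
    also have "\<dots> = ennreal (1 / A * (1 / B) * (1 / D)) * trilin m f g h"
      unfolding trilin_def by (simp add: nn_integral_cmult)
    finally have "ennreal (A * B * D) * (ennreal (1 / A * (1 / B) * (1 / D)) * trilin m f g h) \<le> ennreal (A * B * D) * ennreal C"
      using C(2)[OF norm norm norm, OF m(1) pos(1) le(1) m(2) pos(2) le(2) m(3) pos(3) le(3)] by (intro mult_left_mono) auto
    moreover have "ennreal (A * B * D) * ennreal (1 / A * (1 / B) * (1 / D)) = 1"
      using pos by (simp add: ennreal_mult[symmetric])
    ultimately show "trilin m f g h \<le> ennreal (C * A * B * D)"
      using pos C(1) by (simp add: ennreal_mult[symmetric] mult.assoc[symmetric]) (simp add: mult_ac)
  qed
qed

definition X_weight :: "real \<Rightarrow> real \<Rightarrow> real \<times> real \<Rightarrow> real" where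
  "X_weight s b \<zeta> = jb (snd \<zeta>) powr (2 * s) * md \<zeta> powr (2 * b)"
definition Y_weight :: "real \<Rightarrow> real \<Rightarrow> real \<times> real \<Rightarrow> real" where
  "Y_weight s b \<zeta> = jb (fst \<zeta>) powr (2 * s / 5) * md \<zeta> powr (2 * b)"
definition D_weight :: "real \<Rightarrow> real \<times> real \<Rightarrow> real" where
  "D_weight \<alpha> \<zeta> = jb (fst \<zeta>) powr (2 * \<alpha>) * indicator {\<xi>. \<bar>\<xi>\<bar> \<le> 1} (snd \<zeta>)"

lemma norms_eq_wnorm: "X_norm s b = wnorm (X_weight s b)" "Y_norm s b = wnorm (Y_weight s b)" "D_norm \<alpha> = wnorm (D_weight \<alpha>)"
  by (auto simp: fun_eq_iff X_norm_def Y_norm_def D_norm_def wnorm_def X_weight_def Y_weight_def D_weight_def md_def case_prod_unfold)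

lemma tempered_weights: "tempered (X_weight s b)" "tempered (Y_weight s b)" "tempered (D_weight \<alpha>)"
  unfolding X_weight_def[abs_def] Y_weight_def[abs_def] D_weight_def[abs_def]
  by (intro tempered_mult tempered_jb_fst tempered_jb_snd tempered_md tempered_low)+

text \<open>One weight for both parts of the norm: its square is below the sum of the two weights,
  while its product with \<open>winv\<close> is bounded below.\<close>

definition XD_weight :: "real \<Rightarrow> real \<Rightarrow> real \<Rightarrow> real \<times> real \<Rightarrow> real" where
  "XD_weight s b \<alpha> \<zeta> = (if \<bar>snd \<zeta>\<bar> \<le> 1 then jb (fst \<zeta>) powr \<alpha> else jb (snd \<zeta>) powr s * md \<zeta> powr b)"

lemma XD_weight_nonneg [simp]: "0 \<le> XD_weight s b \<alpha> \<zeta>" by (simp add: XD_weight_def)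
lemma XD_weight_measurable [measurable]: "XD_weight s b \<alpha> \<in> borel_measurable borel"
  unfolding XD_weight_def by measurable

lemma XD_weight_square_le: "(XD_weight s b \<alpha> \<zeta>)\<^sup>2 \<le> X_weight s b \<zeta> + D_weight \<alpha> \<zeta>"
proof -
  have sq: "(x powr p)\<^sup>2 = x powr (2 * p)" for x p :: real
    by (simp add: power2_eq_square powr_add[symmetric])
  show ?thesis by (auto simp: XD_weight_def X_weight_def D_weight_def sq power_mult_distrib)
qed

text \<open>For low frequencies \<open>md \<zeta> \<le> 2 * jb (fst \<zeta>)\<close>, which costs
  \<open>2 powr \<alpha>\<close>; for high ones the two factors are reciprocal.\<close>

lemma winv_XD_weight:
  assumes "0 \<le> \<alpha>"
  shows "1 \<le> 2 powr \<alpha> * (winv s b \<alpha> \<zeta> * XD_weight s b \<alpha> \<zeta>)"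
proof (cases "\<bar>snd \<zeta>\<bar> \<le> 1")
  case True
  have "md \<zeta> \<le> jb (fst \<zeta>) + 1" using md_le[of \<zeta>] power_le_one[of "\<bar>snd \<zeta>\<bar>" 5] True by simp
  then have "md \<zeta> \<le> 2 * jb (fst \<zeta>)" using jb_ge_1[of "fst \<zeta>"] by linarith
  then have "md \<zeta> powr \<alpha> \<le> (2 * jb (fst \<zeta>)) powr \<alpha>" using assms by (intro powr_mono2) auto
  also have "\<dots> = 2 powr \<alpha> * jb (fst \<zeta>) powr \<alpha>" by (simp add: powr_mult)
  finally have "md \<zeta> powr \<alpha> * md \<zeta> powr (- \<alpha>) \<le> 2 powr \<alpha> * jb (fst \<zeta>) powr \<alpha> * md \<zeta> powr (- \<alpha>)"
    by (rule mult_right_mono) auto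
  moreover have "md \<zeta> powr \<alpha> * md \<zeta> powr (- \<alpha>) = 1" by (simp add: powr_add[symmetric])
  ultimately show ?thesis using True by (simp add: winv_def XD_weight_def mult_ac)
next
  case False
  have "winv s b \<alpha> \<zeta> * XD_weight s b \<alpha> \<zeta> = (jb (snd \<zeta>) powr (- s) * jb (snd \<zeta>) powr s) * (md \<zeta> powr (- b) * md \<zeta> powr b)"
    using False by (simp add: winv_def XD_weight_def mult_ac)
  also have "\<dots> = 1" by (simp add: powr_add[symmetric])
  finally show ?thesis using assms ge_one_powr_ge_zero[of 2 \<alpha>] by simp
qed

lemma XD_square_integral:
  assumes "u \<in> schwartz"
  shows "(\<integral>\<^sup>+\<zeta>. (ennreal (XD_weight s b \<alpha> \<zeta> * cmod (fourier u \<zeta>)))\<^sup>2 \<partial>lborel) \<le> ennreal ((XD_norm s b \<alpha> u)\<^sup>2)"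
proof -
  have [measurable]: "fourier u \<in> borel_measurable borel"
    by (intro fourier_measurable decaying_measurable schwartz_decaying0 assms)
  have [measurable]: "X_weight s b \<in> borel_measurable borel" "D_weight \<alpha> \<in> borel_measurable borel"
    by (intro tempered_measurable tempered_weights)+
  have nn: "0 \<le> X_weight s b \<zeta>" "0 \<le> D_weight \<alpha> \<zeta>" for \<zeta>
    by (intro tempered_nonneg tempered_weights)+
  have "(\<integral>\<^sup>+\<zeta>. (ennreal (XD_weight s b \<alpha> \<zeta> * cmod (fourier u \<zeta>)))\<^sup>2 \<partial>lborel) \<le>
    (\<integral>\<^sup>+\<zeta>. ennreal (X_weight s b \<zeta> * (cmod (fourier u \<zeta>))\<^sup>2) + ennreal (D_weight \<alpha> \<zeta> * (cmod (fourier u \<zeta>))\<^sup>2) \<partial>lborel)"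
  proof (rule nn_integral_mono)
    fix \<zeta>
    have "(XD_weight s b \<alpha> \<zeta> * cmod (fourier u \<zeta>))\<^sup>2 \<le> (X_weight s b \<zeta> + D_weight \<alpha> \<zeta>) * (cmod (fourier u \<zeta>))\<^sup>2"
      unfolding power_mult_distrib by (rule mult_right_mono[OF XD_weight_square_le]) simp
    then have "ennreal ((XD_weight s b \<alpha> \<zeta> * cmod (fourier u \<zeta>))\<^sup>2) \<le> ennreal (X_weight s b \<zeta> * (cmod (fourier u \<zeta>))\<^sup>2 + D_weight \<alpha> \<zeta> * (cmod (fourier u \<zeta>))\<^sup>2)"
      by (intro ennreal_leI) (simp only: distrib_right)
    then show "(ennreal (XD_weight s b \<alpha> \<zeta> * cmod (fourier u \<zeta>)))\<^sup>2 \<le> ennreal (X_weight s b \<zeta> * (cmod (fourier u \<zeta>))\<^sup>2) + ennreal (D_weight \<alpha> \<zeta> * (cmod (fourier u \<zeta>))\<^sup>2)"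
      using nn by (simp add: ennreal_power)
  qed
  also have "\<dots> = ennreal ((X_norm s b u)\<^sup>2) + ennreal ((D_norm \<alpha> u)\<^sup>2)"
    unfolding norms_eq_wnorm wnorm_nn_integral[OF tempered_weights(1) assms, symmetric] wnorm_nn_integral[OF tempered_weights(3) assms, symmetric]
    by (rule nn_integral_add) auto
  also have "\<dots> = ennreal ((X_norm s b u)\<^sup>2 + (D_norm \<alpha> u)\<^sup>2)" by simp
  also have "\<dots> \<le> ennreal ((XD_norm s b \<alpha> u)\<^sup>2)"
    unfolding XD_norm_def power2_sum norms_eq_wnorm
    using wnorm_nonneg[OF tempered_weights(1)[of s b], of u] wnorm_nonneg[OF tempered_weights(3)[of \<alpha>], of u]
    by (intro ennreal_leI) simp
  finally show ?thesis .
qed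

lemma XD_norm_nonneg: "0 \<le> XD_norm s b \<alpha> u"
  unfolding XD_norm_def norms_eq_wnorm by (intro add_nonneg_nonneg wnorm_nonneg tempered_weights)

text \<open>The trilinear bound is applied to \<open>H = \<langle>\<tau>\<rangle>\<^sup>s\<^sup>/\<^sup>5 \<langle>\<tau> - \<xi>\<^sup>5\<rangle>\<^sup>-\<^sup>b |(\<partial>\<^sub>x(uv))^|\<close> itself, whose norm is known to be finite, and then
  one factor of it is cancelled.\<close>

lemma schwartz_bilinear_estimate:
  assumes m: "bdd_mult (kawahara_mult s b \<alpha>)" and \<alpha>: "0 \<le> \<alpha>"
  obtains K where "0 \<le> K" "\<And>u v. u \<in> schwartz \<Longrightarrow> v \<in> schwartz \<Longrightarrow>
    Y_norm s (- b) (dx (\<lambda>z. u z * v z)) \<le> K * XD_norm s b \<alpha> u * XD_norm s b \<alpha> v"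
proof -
  obtain C where C: "0 \<le> C" "\<And>f g h A B D. f \<in> borel_measurable borel \<Longrightarrow> g \<in> borel_measurable borel \<Longrightarrow> h \<in> borel_measurable borel \<Longrightarrow>
    0 < A \<Longrightarrow> 0 < B \<Longrightarrow> 0 < D \<Longrightarrow> (\<integral>\<^sup>+z. f z ^ 2 \<partial>lborel) \<le> ennreal (A\<^sup>2) \<Longrightarrow> (\<integral>\<^sup>+z. g z ^ 2 \<partial>lborel) \<le> ennreal (B\<^sup>2) \<Longrightarrow>
    (\<integral>\<^sup>+z. h z ^ 2 \<partial>lborel) \<le> ennreal (D\<^sup>2) \<Longrightarrow> trilin (kawahara_mult s b \<alpha>) f g h \<le> ennreal (C * A * B * D)"
    by (rule bdd_mult_bound[OF m]) (rule that)
  define k where "k = 2 powr \<alpha>"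
  have k: "0 < k" by (simp add: k_def)
  define K where "K = k * k * C"
  have "Y_norm s (- b) (dx (\<lambda>z. u z * v z)) \<le> K * XD_norm s b \<alpha> u * XD_norm s b \<alpha> v"
    if u: "u \<in> schwartz" and v: "v \<in> schwartz" for u v
  proof -
    let ?uv = "\<lambda>z. u z * v z"
    have uv: "?uv \<in> schwartz" by (rule mult_schwartz[OF u v])
    define Y A B where "Y = Y_norm s (- b) (dx ?uv)" and "A = XD_norm s b \<alpha> u" and "B = XD_norm s b \<alpha> v"
    have nn: "0 \<le> Y" "0 \<le> A" "0 \<le> B"
      unfolding Y_def A_def B_def by (auto simp: XD_norm_nonneg norms_eq_wnorm wnorm_nonneg tempered_weights)
    note [measurable] = fourier_measurable[OF decaying_measurable[OF schwartz_decaying0[OF u]]]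
      fourier_measurable[OF decaying_measurable[OF schwartz_decaying0[OF v]]]
      fourier_measurable[OF decaying_measurable[OF schwartz_decaying0[OF uv]]]
    define F where "F w \<zeta> = ennreal (XD_weight s b \<alpha> \<zeta> * cmod (fourier w \<zeta>))" for w \<zeta>
    define q where "q \<zeta> = jb (fst \<zeta>) powr (s / 5) * md \<zeta> powr (- b) * \<bar>snd \<zeta>\<bar>" for \<zeta>
    define H where "H \<zeta> = ennreal (q \<zeta> * cmod (fourier ?uv \<zeta>))" for \<zeta>
    have q0: "0 \<le> q \<zeta>" for \<zeta> by (simp add: q_def)
    have [measurable]: "F u \<in> borel_measurable borel" "F v \<in> borel_measurable borel" "H \<in> borel_measurable borel"
      unfolding F_def[abs_def] H_def[abs_def] q_def[abs_def] by measurable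
    have sq: "(x powr p)\<^sup>2 = x powr (2 * p)" for x p :: real
      by (simp add: power2_eq_square powr_add[symmetric])
    have H2: "(\<integral>\<^sup>+\<zeta>. (H \<zeta>)\<^sup>2 \<partial>lborel) = ennreal (Y\<^sup>2)"
    proof -
      have "(H \<zeta>)\<^sup>2 = ennreal (Y_weight s (- b) \<zeta> * (cmod (fourier (dx ?uv) \<zeta>))\<^sup>2)" for \<zeta>
        using fourier_dx[OF uv, of "fst \<zeta>" "snd \<zeta>"] q0[of \<zeta>]
        by (simp add: H_def ennreal_power Y_weight_def q_def power_mult_distrib sq norm_mult mult_ac)
      then show ?thesis
        unfolding Y_def norms_eq_wnorm wnorm_nn_integral[OF tempered_weights(2) dx_schwartz[OF uv], symmetric] by simp
    qed
    have le: "ennreal (Y\<^sup>2) \<le> ennreal (k * k) * trilin (kawahara_mult s b \<alpha>) (F u) (F v) H"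
    proof -
      have 1: "ennreal (cmod (fourier w \<zeta>)) \<le> ennreal (k * winv s b \<alpha> \<zeta>) * F w \<zeta>" for w \<zeta>
      proof -
        have "1 * cmod (fourier w \<zeta>) \<le> (k * (winv s b \<alpha> \<zeta> * XD_weight s b \<alpha> \<zeta>)) * cmod (fourier w \<zeta>)"
          unfolding k_def by (intro mult_right_mono winv_XD_weight \<alpha>) auto
        then show ?thesis
          unfolding F_def using k by (subst ennreal_mult[symmetric]) (auto intro!: ennreal_leI simp: mult_ac)
      qed
      have "ennreal (Y\<^sup>2) = (\<integral>\<^sup>+\<zeta>. H \<zeta> * H \<zeta> \<partial>lborel)" unfolding H2[symmetric] by (simp add: power2_eq_square)
      also have "\<dots> \<le> (\<integral>\<^sup>+\<zeta>. \<integral>\<^sup>+\<eta>. ennreal (k * k) * (ennreal (kawahara_mult s b \<alpha> \<eta> (\<zeta> - \<eta>)) * F u \<eta> * F v (\<zeta> - \<eta>) * H \<zeta>) \<partial>lborel \<partial>lborel)"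
      proof (rule nn_integral_mono)
        fix \<zeta>
        have "H \<zeta> * H \<zeta> = H \<zeta> * ennreal (q \<zeta>) * ennreal (cmod (fourier ?uv \<zeta>))"
          unfolding H_def[of \<zeta>] using q0[of \<zeta>] by (simp add: ennreal_mult mult_ac)
        also have "\<dots> \<le> H \<zeta> * ennreal (q \<zeta>) * (\<integral>\<^sup>+\<eta>. ennreal (cmod (fourier u \<eta>)) * ennreal (cmod (fourier v (\<zeta> - \<eta>))) \<partial>lborel)"
          by (intro mult_left_mono norm_fourier_mult_le u v) auto
        also have "\<dots> = (\<integral>\<^sup>+\<eta>. H \<zeta> * ennreal (q \<zeta>) * (ennreal (cmod (fourier u \<eta>)) * ennreal (cmod (fourier v (\<zeta> - \<eta>)))) \<partial>lborel)"
          by (rule nn_integral_cmult[symmetric]) measurable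
        also have "\<dots> \<le> (\<integral>\<^sup>+\<eta>. ennreal (k * k) * (ennreal (kawahara_mult s b \<alpha> \<eta> (\<zeta> - \<eta>)) * F u \<eta> * F v (\<zeta> - \<eta>) * H \<zeta>) \<partial>lborel)"
        proof (rule nn_integral_mono)
          fix \<eta>
          have "H \<zeta> * ennreal (q \<zeta>) * (ennreal (cmod (fourier u \<eta>)) * ennreal (cmod (fourier v (\<zeta> - \<eta>)))) \<le>
            H \<zeta> * ennreal (q \<zeta>) * ((ennreal (k * winv s b \<alpha> \<eta>) * F u \<eta>) * (ennreal (k * winv s b \<alpha> (\<zeta> - \<eta>)) * F v (\<zeta> - \<eta>)))"
            by (intro mult_left_mono mult_mono 1) auto
          also have "\<dots> = (ennreal (q \<zeta>) * ennreal (k * winv s b \<alpha> \<eta>) * ennreal (k * winv s b \<alpha> (\<zeta> - \<eta>))) * (F u \<eta> * F v (\<zeta> - \<eta>) * H \<zeta>)"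
            by (simp only: mult_ac)
          also have "ennreal (q \<zeta>) * ennreal (k * winv s b \<alpha> \<eta>) * ennreal (k * winv s b \<alpha> (\<zeta> - \<eta>)) = ennreal (q \<zeta> * (k * winv s b \<alpha> \<eta>) * (k * winv s b \<alpha> (\<zeta> - \<eta>)))"
            using q0[of \<zeta>] k by (simp add: ennreal_mult)
          also have "q \<zeta> * (k * winv s b \<alpha> \<eta>) * (k * winv s b \<alpha> (\<zeta> - \<eta>)) = k * k * kawahara_mult s b \<alpha> \<eta> (\<zeta> - \<eta>)"
            by (simp add: kawahara_mult_def q_def mult_ac)
          also have "ennreal (k * k * kawahara_mult s b \<alpha> \<eta> (\<zeta> - \<eta>)) = ennreal (k * k) * ennreal (kawahara_mult s b \<alpha> \<eta> (\<zeta> - \<eta>))"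
            using k by (intro ennreal_mult kawahara_mult_nonneg) auto
          finally show "H \<zeta> * ennreal (q \<zeta>) * (ennreal (cmod (fourier u \<eta>)) * ennreal (cmod (fourier v (\<zeta> - \<eta>)))) \<le>
            ennreal (k * k) * (ennreal (kawahara_mult s b \<alpha> \<eta> (\<zeta> - \<eta>)) * F u \<eta> * F v (\<zeta> - \<eta>) * H \<zeta>)"
            by (simp only: mult.assoc)
        qed
        finally show "H \<zeta> * H \<zeta> \<le> (\<integral>\<^sup>+\<eta>. ennreal (k * k) * (ennreal (kawahara_mult s b \<alpha> \<eta> (\<zeta> - \<eta>)) * F u \<eta> * F v (\<zeta> - \<eta>) * H \<zeta>) \<partial>lborel)" .
      qed
      also have "\<dots> = ennreal (k * k) * (\<integral>\<^sup>+\<zeta>. \<integral>\<^sup>+\<eta>. ennreal (kawahara_mult s b \<alpha> \<eta> (\<zeta> - \<eta>)) * F u \<eta> * F v (\<zeta> - \<eta>) * H \<zeta> \<partial>lborel \<partial>lborel)"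
        by (simp add: nn_integral_cmult)
      also have "\<dots> = ennreal (k * k) * trilin (kawahara_mult s b \<alpha>) (F u) (F v) H"
        by (subst trilin_alt) auto
      finally show ?thesis .
    qed
    \<comment> \<open>The radii exceed the norms by \<open>e\<close> to be positive; the limit from
      the right restores the norms.\<close>
    have eps: "Y\<^sup>2 \<le> K * (A + e) * (B + e) * (Y + e)" if e: "0 < e" for e
    proof -
      have mono: "ennreal (x\<^sup>2) \<le> ennreal ((x + e)\<^sup>2)" if "0 \<le> x" for x
        using that e by (intro ennreal_leI power_mono) auto
      have "trilin (kawahara_mult s b \<alpha>) (F u) (F v) H \<le> ennreal (C * (A + e) * (B + e) * (Y + e))"
      proof (rule C(2))
        show "(\<integral>\<^sup>+\<zeta>. (F u \<zeta>)\<^sup>2 \<partial>lborel) \<le> ennreal ((A + e)\<^sup>2)"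
          using order_trans[OF XD_square_integral[OF u] mono] nn unfolding F_def A_def by blast
        show "(\<integral>\<^sup>+\<zeta>. (F v \<zeta>)\<^sup>2 \<partial>lborel) \<le> ennreal ((B + e)\<^sup>2)"
          using order_trans[OF XD_square_integral[OF v] mono] nn unfolding F_def B_def by blast
        show "(\<integral>\<^sup>+\<zeta>. (H \<zeta>)\<^sup>2 \<partial>lborel) \<le> ennreal ((Y + e)\<^sup>2)"
          unfolding H2 by (rule mono[OF nn(1)])
      qed (use nn e in auto)
      then have "ennreal (Y\<^sup>2) \<le> ennreal (k * k) * ennreal (C * (A + e) * (B + e) * (Y + e))"
        by (intro order_trans[OF le] mult_left_mono) auto
      also have "\<dots> = ennreal (K * (A + e) * (B + e) * (Y + e))"
        using k C(1) nn e by (simp add: ennreal_mult[symmetric] K_def mult_ac)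
      finally have "ennreal (Y\<^sup>2) \<le> ennreal (K * (A + e) * (B + e) * (Y + e))" .
      moreover have "0 \<le> K * (A + e) * (B + e) * (Y + e)"
        using k C(1) nn e unfolding K_def by (intro mult_nonneg_nonneg add_nonneg_nonneg) auto
      ultimately show ?thesis by (simp only: ennreal_le_iff)
    qed
    have "((\<lambda>e. K * (A + e) * (B + e) * (Y + e)) \<longlongrightarrow> K * (A + 0) * (B + 0) * (Y + 0)) (at_right 0)"
      by (intro tendsto_intros)
    moreover have "\<forall>\<^sub>F e in at_right 0. Y\<^sup>2 \<le> K * (A + e) * (B + e) * (Y + e)"
      using eventually_at_right_less[of "0 :: real"] by (rule eventually_mono) (rule eps)
    ultimately have "Y\<^sup>2 \<le> K * (A + 0) * (B + 0) * (Y + 0)"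
      by (rule tendsto_lowerbound) simp
    then have YY: "Y * Y \<le> (K * A * B) * Y" by (simp add: power2_eq_square)
    show ?thesis
    proof (cases "Y = 0")
      case True
      then show ?thesis using nn k C(1) unfolding Y_def[symmetric] A_def[symmetric] B_def[symmetric] by (simp add: K_def)
    next
      case False
      then have "Y \<le> K * A * B" using YY nn by (simp add: mult_le_cancel_right)
      then show ?thesis by (simp add: Y_def A_def B_def)
    qed
  qed
  moreover have "0 \<le> K" using k C(1) by (simp add: K_def)
  ultimately show ?thesis by (rule that[rotated])
qed

section \<open>Extension to the completions\<close>

text \<open>Subtraction is the only operation on functions that occurs: symmetry follows from the
  triangle inequality for differences applied to 0. The locale covers the weighted norms and also
  \<open>XD_norm\<close>, which is a sum of two of them.\<close>

locale schwartz_seminorm =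
  fixes N :: "plane_fun \<Rightarrow> real"
  assumes nonneg: "0 \<le> N f"
    and zero: "N (\<lambda>z. 0) = 0"
    and triangle: "f \<in> schwartz \<Longrightarrow> g \<in> schwartz \<Longrightarrow> N (\<lambda>z. f z - g z) \<le> N f + N g"
begin

lemma zero_schwartz: "f \<in> schwartz \<Longrightarrow> (\<lambda>z. 0) \<in> schwartz"
  using diff_schwartz[of f f] by simp

lemma commute:
  assumes "f \<in> schwartz" "g \<in> schwartz"
  shows "N (\<lambda>z. f z - g z) = N (\<lambda>z. g z - f z)"
proof -
  have le: "N (\<lambda>z. g z - f z) \<le> N (\<lambda>z. f z - g z)" if "f \<in> schwartz" "g \<in> schwartz" for f g
    using triangle[OF zero_schwartz[OF that(1)] diff_schwartz[OF that]] zero by simp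
  show ?thesis by (intro antisym le assms)
qed

lemma triangle3:
  assumes "f \<in> schwartz" "g \<in> schwartz" "h \<in> schwartz"
  shows "N (\<lambda>z. f z - h z) \<le> N (\<lambda>z. f z - g z) + N (\<lambda>z. g z - h z)"
proof -
  have "N (\<lambda>z. (f z - g z) - (h z - g z)) \<le> N (\<lambda>z. f z - g z) + N (\<lambda>z. h z - g z)"
    by (intro triangle diff_schwartz assms)
  then show ?thesis using commute[OF assms(3,2)] by simp
qed

lemma le_diff_add:
  assumes "f \<in> schwartz" "g \<in> schwartz"
  shows "N f \<le> N (\<lambda>z. f z - g z) + N g"
  using triangle3[OF assms zero_schwartz[OF assms(1)]] by simp

lemma abs_diff_le:
  assumes "f \<in> schwartz" "g \<in> schwartz"
  shows "\<bar>N f - N g\<bar> \<le> N (\<lambda>z. f z - g z)"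
  using le_diff_add[OF assms] le_diff_add[OF assms(2,1)] commute[OF assms] by linarith

lemma cauchy_seqs_schwartz: "w \<in> cauchy_seqs N \<Longrightarrow> w n \<in> schwartz"
  by (simp add: cauchy_seqs_def)

lemma cauchy_seqs_convergent:
  assumes "w \<in> cauchy_seqs N"
  shows "convergent (\<lambda>n. N (w n))"
proof -
  have "Cauchy (\<lambda>n. N (w n))"
  proof (rule metric_CauchyI)
    fix e :: real assume "0 < e"
    then obtain M where M: "\<And>m n. M \<le> m \<Longrightarrow> M \<le> n \<Longrightarrow> N (\<lambda>z. w m z - w n z) < e"
      using assms unfolding cauchy_seqs_def by blast
    have "dist (N (w m)) (N (w n)) < e" if "M \<le> m" "M \<le> n" for m n
      using abs_diff_le[OF cauchy_seqs_schwartz[OF assms] cauchy_seqs_schwartz[OF assms], of m n] M[OF that]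
      by (simp add: dist_real_def)
    then show "\<exists>M. \<forall>m\<ge>M. \<forall>n\<ge>M. dist (N (w m)) (N (w n)) < e" by blast
  qed
  then show ?thesis by (simp add: Cauchy_convergent_iff)
qed

lemma cauchy_seqs_bounded:
  assumes "w \<in> cauchy_seqs N"
  obtains R where "0 < R" "\<And>n. N (w n) \<le> R"
proof -
  obtain R where "0 < R" "\<And>n. norm (N (w n)) \<le> R"
    using convergent_imp_Bseq[OF cauchy_seqs_convergent[OF assms]] unfolding Bseq_def by blast
  then show ?thesis using that[of R] abs_ge_self order_trans by (metis real_norm_def)
qed

lemma null_rel_refl: "w \<in> cauchy_seqs N \<Longrightarrow> (w, w) \<in> null_rel N"
  by (simp add: null_rel_def zero)

lemma completion_class:
  assumes "U \<in> schwartz_completion N"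
  obtains u where "u \<in> U" "U \<subseteq> cauchy_seqs N" "\<And>u'. u' \<in> U \<Longrightarrow> (\<lambda>n. N (\<lambda>z. u n z - u' n z)) \<longlonglongrightarrow> 0"
proof -
  obtain u where u: "u \<in> cauchy_seqs N" "U = null_rel N `` {u}"
    using assms unfolding schwartz_completion_def by (rule quotientE)
  show ?thesis
  proof (rule that[of u])
    show "u \<in> U" using null_rel_refl[OF u(1)] u(2) by simp
  qed (auto simp: u(2) null_rel_def)
qed

lemma completion_norm_rep:
  assumes "U \<in> schwartz_completion N"
  obtains u where "u \<in> U" "u \<in> cauchy_seqs N" "(\<lambda>n. N (u n)) \<longlonglongrightarrow> completion_norm N U"
proof -
  obtain u0 where u0: "u0 \<in> U" "U \<subseteq> cauchy_seqs N" using completion_class[OF assms] by blast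
  define u where "u = (SOME w. w \<in> U)"
  have "u \<in> U" unfolding u_def using u0(1) by (rule someI[where P="\<lambda>w. w \<in> U"])
  moreover from this have "u \<in> cauchy_seqs N" using u0 by blast
  moreover from this have "(\<lambda>n. N (u n)) \<longlonglongrightarrow> completion_norm N U"
    unfolding completion_norm_def u_def[symmetric] by (simp add: cauchy_seqs_convergent convergent_LIMSEQ_iff[symmetric])
  ultimately show ?thesis by (rule that)
qed

end

lemma wnorm_seminorm: "tempered W \<Longrightarrow> schwartz_seminorm (wnorm W)"
  by unfold_locales (auto simp: wnorm_zero intro: wnorm_nonneg wnorm_triangle)

lemma XD_norm_seminorm: "schwartz_seminorm (XD_norm s b \<alpha>)"
proof
  fix f g assume fg: "f \<in> schwartz" "g \<in> schwartz"
  show "XD_norm s b \<alpha> (\<lambda>z. f z - g z) \<le> XD_norm s b \<alpha> f + XD_norm s b \<alpha> g"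
    unfolding XD_norm_def norms_eq_wnorm
    using wnorm_triangle[OF tempered_weights(1)[of s b] fg] wnorm_triangle[OF tempered_weights(3)[of \<alpha>] fg] by linarith
next
  show "XD_norm s b \<alpha> (\<lambda>z. 0) = 0" by (simp add: XD_norm_def norms_eq_wnorm wnorm_zero)
qed (rule XD_norm_nonneg)

lemma dx_mult_differences:
  assumes "u \<in> schwartz" "u' \<in> schwartz" "v \<in> schwartz"
  shows "(\<lambda>z. dx (\<lambda>y. u y * v y) z - dx (\<lambda>y. u' y * v y) z) = dx (\<lambda>y. (u y - u' y) * v y)"
    "(\<lambda>z. dx (\<lambda>y. v y * u y) z - dx (\<lambda>y. v y * u' y) z) = dx (\<lambda>y. v y * (u y - u' y))"
proof -
  have d: "f differentiable (at z)" if "f \<in> schwartz" for f z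
    using schwartz_part(1)[OF that, of 0 0] by simp
  show "(\<lambda>z. dx (\<lambda>y. u y * v y) z - dx (\<lambda>y. u' y * v y) z) = dx (\<lambda>y. (u y - u' y) * v y)"
    using partial_diff(1)[of "\<lambda>y. u y * v y" "\<lambda>y. u' y * v y"] d mult_schwartz assms by (simp add: left_diff_distrib)
  show "(\<lambda>z. dx (\<lambda>y. v y * u y) z - dx (\<lambda>y. v y * u' y) z) = dx (\<lambda>y. v y * (u y - u' y))"
    using partial_diff(1)[of "\<lambda>y. v y * u y" "\<lambda>y. v y * u' y"] d mult_schwartz assms by (simp add: right_diff_distrib)
qed

text \<open>Extension of a bounded bilinear map by telescoping: replacing one factor at a time
  bounds the difference of two products. So products along representatives form Cauchy sequences of
  one single class, which is \<open>dx_mult N U V\<close>.\<close>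

lemma completion_bilinear:
  assumes N: "schwartz_seminorm N" and M: "schwartz_seminorm M" and K: "0 \<le> K"
    and est: "\<And>u v. u \<in> schwartz \<Longrightarrow> v \<in> schwartz \<Longrightarrow> N (dx (\<lambda>z. u z * v z)) \<le> K * M u * M v"
    and U: "U \<in> schwartz_completion M" and V: "V \<in> schwartz_completion M"
  shows "dx_mult N U V \<in> schwartz_completion N"
    "completion_norm N (dx_mult N U V) \<le> K * completion_norm M U * completion_norm M V"
proof -
  interpret N: schwartz_seminorm N by (rule N)
  interpret M: schwartz_seminorm M by (rule M)
  let ?B = "\<lambda>u v. dx (\<lambda>y. u y * v y)"
  have B: "?B u v \<in> schwartz" if "u \<in> schwartz" "v \<in> schwartz" for u v
    by (intro dx_schwartz mult_schwartz that)
  have diff: "N (\<lambda>z. ?B u v z - ?B u' v' z) \<le> K * M (\<lambda>z. u z - u' z) * M v + K * M u' * M (\<lambda>z. v z - v' z)"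
    if "u \<in> schwartz" "u' \<in> schwartz" "v \<in> schwartz" "v' \<in> schwartz" for u u' v v'
  proof -
    have "N (\<lambda>z. ?B u v z - ?B u' v' z) \<le> N (\<lambda>z. ?B u v z - ?B u' v z) + N (\<lambda>z. ?B u' v z - ?B u' v' z)"
      by (intro N.triangle3 B that)
    also have "\<dots> \<le> K * M (\<lambda>z. u z - u' z) * M v + K * M u' * M (\<lambda>z. v z - v' z)"
      unfolding dx_mult_differences(1)[OF that(1,2,3)] dx_mult_differences(2)[OF that(3,4,2)]
      by (intro add_mono est diff_schwartz that)
    finally show ?thesis .
  qed
  obtain u0 where u0: "u0 \<in> U" "U \<subseteq> cauchy_seqs M" "\<And>u'. u' \<in> U \<Longrightarrow> (\<lambda>n. M (\<lambda>z. u0 n z - u' n z)) \<longlonglongrightarrow> 0"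
    using M.completion_class[OF U] by blast
  obtain v0 where v0: "v0 \<in> V" "V \<subseteq> cauchy_seqs M" "\<And>v'. v' \<in> V \<Longrightarrow> (\<lambda>n. M (\<lambda>z. v0 n z - v' n z)) \<longlonglongrightarrow> 0"
    using M.completion_class[OF V] by blast
  have SU: "u n \<in> schwartz" if "u \<in> U" for u n using that u0(2) M.cauchy_seqs_schwartz by blast
  have SV: "v n \<in> schwartz" if "v \<in> V" for v n using that v0(2) M.cauchy_seqs_schwartz by blast
  define W where "W n = ?B (u0 n) (v0 n)" for n
  have WS: "W n \<in> schwartz" for n unfolding W_def by (intro B SU SV u0(1) v0(1))
  have cu: "u0 \<in> cauchy_seqs M" and cv: "v0 \<in> cauchy_seqs M" using u0 v0 by auto
  obtain R where R: "0 < R" "\<And>n. M (u0 n) \<le> R" using M.cauchy_seqs_bounded[OF cu] by blast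
  obtain R' where R': "0 < R'" "\<And>n. M (v0 n) \<le> R'" using M.cauchy_seqs_bounded[OF cv] by blast
  have WC: "W \<in> cauchy_seqs N"
    unfolding cauchy_seqs_def
  proof (intro CollectI conjI allI impI WS)
    fix e :: real assume e: "0 < e"
    \<comment> \<open>Makes \<open>d * (K * R' + K * R)\<close> smaller than \<open>e\<close>; the 1
      covers \<open>K = 0\<close>.\<close>
    define d where "d = e / (K * R' + K * R + 1)"
    have pos: "0 < K * R' + K * R + 1" using K R(1) R'(1) by (intro add_nonneg_pos add_nonneg_nonneg mult_nonneg_nonneg) auto
    then have d: "0 < d" using e by (simp add: d_def)
    obtain n1 where n1: "\<And>m n. n1 \<le> m \<Longrightarrow> n1 \<le> n \<Longrightarrow> M (\<lambda>z. u0 m z - u0 n z) < d"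
      using cu d unfolding cauchy_seqs_def by blast
    obtain n2 where n2: "\<And>m n. n2 \<le> m \<Longrightarrow> n2 \<le> n \<Longrightarrow> M (\<lambda>z. v0 m z - v0 n z) < d"
      using cv d unfolding cauchy_seqs_def by blast
    have "N (\<lambda>z. W m z - W n z) < e" if "max n1 n2 \<le> m" "max n1 n2 \<le> n" for m n
    proof -
      have "N (\<lambda>z. W m z - W n z) \<le> K * M (\<lambda>z. u0 m z - u0 n z) * M (v0 m) + K * M (u0 n) * M (\<lambda>z. v0 m z - v0 n z)"
        unfolding W_def by (intro diff SU SV u0(1) v0(1))
      also have "\<dots> \<le> K * d * R' + K * R * d"
        using n1[of m n] n2[of m n] that K R R' d M.nonneg
        by (intro add_mono mult_mono mult_left_mono mult_nonneg_nonneg) (auto intro: less_imp_le)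
      also have "\<dots> = d * (K * R' + K * R)" by (simp add: algebra_simps)
      also have "\<dots> < d * (K * R' + K * R + 1)" using d by simp
      also have "\<dots> = e" using pos by (simp add: d_def)
      finally show ?thesis .
    qed
    then show "\<exists>M. \<forall>m\<ge>M. \<forall>n\<ge>M. N (\<lambda>z. W m z - W n z) < e" by blast
  qed
  have conv: "(\<lambda>n. N (\<lambda>z. W n z - ?B (u n) (v n) z)) \<longlonglongrightarrow> 0" if u: "u \<in> U" and v: "v \<in> V" for u v
  proof -
    have "u \<in> cauchy_seqs M" using u u0 by auto
    then obtain r where r: "0 < r" "\<And>n. M (u n) \<le> r" using M.cauchy_seqs_bounded by blast
    have "(\<lambda>n. K * M (\<lambda>z. u0 n z - u n z) * R' + K * r * M (\<lambda>z. v0 n z - v n z)) \<longlonglongrightarrow> K * 0 * R' + K * r * 0"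
      by (intro tendsto_intros u0 v0 u v)
    then have lim: "(\<lambda>n. K * M (\<lambda>z. u0 n z - u n z) * R' + K * r * M (\<lambda>z. v0 n z - v n z)) \<longlonglongrightarrow> 0" by simp
    show ?thesis
    proof (rule tendsto_sandwich[OF _ _ tendsto_const lim])
      show "\<forall>\<^sub>F n in sequentially. 0 \<le> N (\<lambda>z. W n z - ?B (u n) (v n) z)" using N.nonneg by simp
      have "N (\<lambda>z. W n z - ?B (u n) (v n) z) \<le> K * M (\<lambda>z. u0 n z - u n z) * R' + K * r * M (\<lambda>z. v0 n z - v n z)" for n
      proof -
        have "N (\<lambda>z. W n z - ?B (u n) (v n) z) \<le> K * M (\<lambda>z. u0 n z - u n z) * M (v0 n) + K * M (u n) * M (\<lambda>z. v0 n z - v n z)"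
          unfolding W_def by (intro diff SU SV u0(1) v0(1) u v)
        also have "\<dots> \<le> K * M (\<lambda>z. u0 n z - u n z) * R' + K * r * M (\<lambda>z. v0 n z - v n z)"
          using K R' r M.nonneg by (intro add_mono mult_mono mult_left_mono mult_nonneg_nonneg) (auto intro: less_imp_le)
        finally show ?thesis .
      qed
      then show "\<forall>\<^sub>F n in sequentially. N (\<lambda>z. W n z - ?B (u n) (v n) z) \<le> K * M (\<lambda>z. u0 n z - u n z) * R' + K * r * M (\<lambda>z. v0 n z - v n z)"
        by simp
    qed
  qed
  \<comment> \<open>One fixed pair of representatives determines the class; \<open>conv\<close>
    shows that any other pair has the same limit.\<close>
  have eq: "dx_mult N U V = null_rel N `` {W}"
  proof (intro set_eqI iffI)
    fix w assume "w \<in> dx_mult N U V"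
    then have w: "w \<in> cauchy_seqs N" "(\<lambda>n. N (\<lambda>z. w n z - W n z)) \<longlonglongrightarrow> 0"
      using u0(1) v0(1) by (auto simp: dx_mult_def W_def)
    then have "(\<lambda>n. N (\<lambda>z. W n z - w n z)) \<longlonglongrightarrow> 0"
      using N.commute[OF WS N.cauchy_seqs_schwartz[OF w(1)]] by simp
    then show "w \<in> null_rel N `` {W}" using w WC by (simp add: null_rel_def)
  next
    fix w assume "w \<in> null_rel N `` {W}"
    then have w: "w \<in> cauchy_seqs N" "(\<lambda>n. N (\<lambda>z. W n z - w n z)) \<longlonglongrightarrow> 0"
      by (auto simp: null_rel_def)
    have wS: "w n \<in> schwartz" for n by (rule N.cauchy_seqs_schwartz[OF w(1)])
    have "(\<lambda>n. N (\<lambda>z. w n z - ?B (u n) (v n) z)) \<longlonglongrightarrow> 0" if u: "u \<in> U" and v: "v \<in> V" for u v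
    proof (rule tendsto_sandwich[OF _ _ tendsto_const])
      show "(\<lambda>n. N (\<lambda>z. W n z - w n z) + N (\<lambda>z. W n z - ?B (u n) (v n) z)) \<longlonglongrightarrow> 0"
        using tendsto_add[OF w(2) conv[OF u v]] by simp
      show "\<forall>\<^sub>F n in sequentially. 0 \<le> N (\<lambda>z. w n z - ?B (u n) (v n) z)" using N.nonneg by simp
      have "N (\<lambda>z. w n z - ?B (u n) (v n) z) \<le> N (\<lambda>z. W n z - w n z) + N (\<lambda>z. W n z - ?B (u n) (v n) z)" for n
        using N.triangle3[OF wS[of n] WS[of n] B[OF SU[OF u, of n] SV[OF v, of n]]] N.commute[OF wS[of n] WS[of n]] by simp
      then show "\<forall>\<^sub>F n in sequentially. N (\<lambda>z. w n z - ?B (u n) (v n) z) \<le> N (\<lambda>z. W n z - w n z) + N (\<lambda>z. W n z - ?B (u n) (v n) z)"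
        by simp
    qed
    then show "w \<in> dx_mult N U V" using w(1) by (simp add: dx_mult_def)
  qed
  show mem: "dx_mult N U V \<in> schwartz_completion N"
    unfolding eq schwartz_completion_def by (rule quotientI[OF WC])
  \<comment> \<open>\<open>completion_norm\<close> is taken along a chosen representative, so the
    three chosen sequences are compared: \<open>w\<close> differs from the product of
    \<open>u\<close> and \<open>v\<close> by a null sequence, and the estimate passes to the
    limit.\<close>
  obtain w where w: "w \<in> dx_mult N U V" "w \<in> cauchy_seqs N" "(\<lambda>n. N (w n)) \<longlonglongrightarrow> completion_norm N (dx_mult N U V)"
    using N.completion_norm_rep[OF mem] by blast
  obtain u where u: "u \<in> U" "(\<lambda>n. M (u n)) \<longlonglongrightarrow> completion_norm M U"
    using M.completion_norm_rep[OF U] by blast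
  obtain v where v: "v \<in> V" "(\<lambda>n. M (v n)) \<longlonglongrightarrow> completion_norm M V"
    using M.completion_norm_rep[OF V] by blast
  have "(\<lambda>n. N (\<lambda>z. w n z - ?B (u n) (v n) z)) \<longlonglongrightarrow> 0" using w(1) u(1) v(1) by (auto simp: dx_mult_def)
  then have "(\<lambda>n. N (\<lambda>z. w n z - ?B (u n) (v n) z) + K * M (u n) * M (v n)) \<longlonglongrightarrow> 0 + K * completion_norm M U * completion_norm M V"
    by (intro tendsto_intros u v)
  moreover have "N (w n) \<le> N (\<lambda>z. w n z - ?B (u n) (v n) z) + K * M (u n) * M (v n)" for n
    using N.le_diff_add[OF N.cauchy_seqs_schwartz[OF w(2), of n] B[OF SU[OF u(1), of n] SV[OF v(1), of n]]] est[OF SU[OF u(1), of n] SV[OF v(1), of n]] by linarith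
  ultimately have "completion_norm N (dx_mult N U V) \<le> 0 + K * completion_norm M U * completion_norm M V"
    by (intro LIMSEQ_le[OF w(3)]) auto
  then show "completion_norm N (dx_mult N U V) \<le> K * completion_norm M U * completion_norm M V" by simp
qed

theorem proposition5p2:
  fixes s :: real
  assumes "- 7 / 4 < s" and "s < 5 / 2"
  shows "\<exists>b::real. b < 1 / 2 \<and> (\<forall>\<alpha>::real. \<alpha> > 1 / 2 \<longrightarrow> (\<exists>c::real.
    \<forall>U \<in> schwartz_completion (XD_norm s b \<alpha>). \<forall>V \<in> schwartz_completion (XD_norm s b \<alpha>).
      dx_mult (Y_norm s (- b)) U V \<in> schwartz_completion (Y_norm s (- b)) \<and>
      completion_norm (Y_norm s (- b)) (dx_mult (Y_norm s (- b)) U V)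
        \<le> c * completion_norm (XD_norm s b \<alpha>) U * completion_norm (XD_norm s b \<alpha>) V))"
proof -
  \<comment> \<open>\<open>b\<close> is fixed before \<alpha>; only the constant \<open>K\<close>
    below may depend on \<alpha>.\<close>
  obtain b where b: "b < 1 / 2" "\<And>\<alpha>. 1 / 2 < \<alpha> \<Longrightarrow> bdd_mult (kawahara_mult s b \<alpha>)"
    using kawahara_mult_bounded[OF assms] by blast
  have Y: "schwartz_seminorm (Y_norm s (- b))"
    unfolding norms_eq_wnorm by (rule wnorm_seminorm[OF tempered_weights(2)])
  show ?thesis
  proof (rule exI[of _ b], intro conjI allI impI b(1))
    fix \<alpha> :: real assume \<alpha>: "1 / 2 < \<alpha>"
    then have "0 \<le> \<alpha>" by linarith
    obtain K where K: "0 \<le> K" "\<And>u v. u \<in> schwartz \<Longrightarrow> v \<in> schwartz \<Longrightarrow>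
        Y_norm s (- b) (dx (\<lambda>z. u z * v z)) \<le> K * XD_norm s b \<alpha> u * XD_norm s b \<alpha> v"
      by (rule schwartz_bilinear_estimate[OF b(2)[OF \<alpha>] \<open>0 \<le> \<alpha>\<close>]) (rule that)
    show "\<exists>c::real. \<forall>U \<in> schwartz_completion (XD_norm s b \<alpha>). \<forall>V \<in> schwartz_completion (XD_norm s b \<alpha>).
      dx_mult (Y_norm s (- b)) U V \<in> schwartz_completion (Y_norm s (- b)) \<and>
      completion_norm (Y_norm s (- b)) (dx_mult (Y_norm s (- b)) U V)
        \<le> c * completion_norm (XD_norm s b \<alpha>) U * completion_norm (XD_norm s b \<alpha>) V"
      by (intro exI[of _ K] ballI conjI completion_bilinear[OF Y XD_norm_seminorm K])
  qed
qed

end
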